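(* Let $(G,P,\theta)$ be an algebraic dynamical system and let $\{M_p\mid p\in P\}$ be the associated collection of right-Hilbert $C^*(G)$-bimodules. Then the semigroup $M:=\bigsqcup_{p\in P}M_p$ with multiplication characterised by $$\pi_p(\delta_g)\pi_q(\delta_h)=\pi_{pq}(\delta_{g\theta_p(h)})\quad\text{for }p,q\in P,\ g,h\in G,$$ is a product system of right-Hilbert $C^*(G)$-bimodules over $P$.
   Context: A semigroup $P$ with identity $1$ is right LCM if it is left cancellative and, for all $p,q\in P$, $pP\cap qP$ is either empty or equal to $rP$ for some $r\in P$. An algebraic dynamical system is a triple $(G,P,\theta)$ consisting of a countable discrete group $G$, a countable right LCM semigroup $P$ with identity, and an action $\theta$ of $P$ by injective group endomorphisms of $G$ (so $\theta_1=\mathrm{id}$, $\theta_{pq}=\theta_p\theta_q$) such that $\theta_p(G)\cap\theta_q(G)=\theta_r(G)$ whenever $pP\cap qP=rP$. Let $\delta_g$, $g\in G$, be the canonical unitaries generating the full group $C^*$-algebra $C^*(G)$. For $p\in P$ let $\alpha_p$ be the injective unital $*$-endomorphism of $C^*(G)$ with $\alpha_p(\delta_g)=\delta_{\theta_p(g)}$ and $L_p:C^*(G)\to C^*(G)$ the unital positive linear map with $L_p(\delta_g)=\delta_{\theta_p^{-1}(g)}$ if $g\in\theta_p(G)$ and $L_p(\delta_g)=0$ otherwise. The right-Hilbert $C^*(G)$-bimodule $M_p$ is obtained from the vector space $C^*(G)$ with right action $a\cdot b=a\alpha_p(b)$ and pre-inner product $\langle a,b\rangle_p=L_p(a^*b)$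 by dividing out $N_p=\{a\mid L_p(a^*a)=0\}$ and completing; the left action $\varphi_p$ is induced by left multiplication. $\pi_p:C^*(G)\to C^*(G)/N_p\subseteq M_p$ is the quotient map. A right-Hilbert $A$-bimodule is a right Hilbert $A$-module with a left action of $A$ by adjointable operators. A product system of right-Hilbert $A$-bimodules over a left cancellative semigroup $S$ with identity $1$ is a semigroup $M=\bigsqcup_{p\in S}M_p$ where each $M_p$ is a right-Hilbert $A$-bimodule; $x\otimes_Ay\mapsto xy$ determines an isomorphism $M_p\otimes_AM_q\cong M_{pq}$ for all $p,q\in S$ with $p\neq1$; $M_1={}_AA_A$; and the products $M_1\times M_p\to M_p$ and $M_p\times M_1\to M_p$ are given by the module actions of $A$ on $M_p$. *)

theory Defs
  imports "HOL-Analysis.Analysis" "HOL-Library.Poly_Mapping"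
begin

section \<open>Unital $C^*$-algebras\<close>

class star =
  fixes star :: "'a \<Rightarrow> 'a"

class scaleC =
  fixes scaleC :: "complex \<Rightarrow> 'a \<Rightarrow> 'a"  (infixr \<open>*\<^sub>C\<close> 75)

class cstar_algebra_1 = real_normed_algebra_1 + complete_space + star + scaleC +
  assumes scaleC_of_real: "complex_of_real r *\<^sub>C x = r *\<^sub>R x"
    and scaleC_add_right: "c *\<^sub>C (x + y) = c *\<^sub>C x + c *\<^sub>C y"
    and scaleC_add_left: "(c + d) *\<^sub>C x = c *\<^sub>C x + d *\<^sub>C x"
    and scaleC_scaleC: "c *\<^sub>C d *\<^sub>C x = (c * d) *\<^sub>C x"
    and mult_scaleC_left: "(c *\<^sub>C x) * y = c *\<^sub>C (x * y)"
    and mult_scaleC_right: "x * (c *\<^sub>C y) = c *\<^sub>C (x * y)"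
    and norm_scaleC: "norm (c *\<^sub>C x) = cmod c * norm x"
    and star_add: "star (x + y) = star x + star y"
    and star_scaleC: "star (c *\<^sub>C x) = cnj c *\<^sub>C star x"
    and star_mult: "star (x * y) = star y * star x"
    and star_star: "star (star x) = x"
    and cstar_identity: "norm (star x * x) = (norm x)\<^sup>2"

definition cpos :: "'a::{star,times} \<Rightarrow> bool" where
  "cpos a \<longleftrightarrow> (\<exists>b. a = star b * b)"

instantiation complex :: cstar_algebra_1
begin

definition star_complex :: "complex \<Rightarrow> complex" where "star_complex = cnj"
definition scaleC_complex :: "complex \<Rightarrow> complex \<Rightarrow> complex" where "scaleC_complex = (*)"

instance
  by standard
    (auto simp: star_complex_def scaleC_complex_def scaleR_conv_of_real algebra_simps
      norm_mult power2_eq_square)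

end


section \<open>Hilbert modules and bimodules\<close>

text \<open>Inner products are conjugate linear in the first and linear in the second variable.\<close>

record ('a, 'x) hmod =
  hcarr :: "'x set"
  hzero :: 'x
  hadd :: "'x \<Rightarrow> 'x \<Rightarrow> 'x"
  hscale :: "complex \<Rightarrow> 'x \<Rightarrow> 'x"
  hract :: "'x \<Rightarrow> 'a \<Rightarrow> 'x"
  hinn :: "'x \<Rightarrow> 'x \<Rightarrow> 'a"

record ('a, 'x) hbimod = "('a, 'x) hmod" +
  hlact :: "'a \<Rightarrow> 'x \<Rightarrow> 'x"

definition hdiff :: "('a, 'x, 'z) hmod_scheme \<Rightarrow> 'x \<Rightarrow> 'x \<Rightarrow> 'x" where
  "hdiff X x y = hadd X x (hscale X (-1) y)"

definition hnorm :: "('a::real_normed_vector, 'x, 'z) hmod_scheme \<Rightarrow> 'x \<Rightarrow> real" where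
  "hnorm X x = sqrt (norm (hinn X x x))"

definition hCauchy :: "('a::real_normed_vector, 'x, 'z) hmod_scheme \<Rightarrow> (nat \<Rightarrow> 'x) \<Rightarrow> bool" where
  "hCauchy X s \<longleftrightarrow> (\<forall>n. s n \<in> hcarr X) \<and>
     (\<forall>e>0. \<exists>N. \<forall>m\<ge>N. \<forall>n\<ge>N. hnorm X (hdiff X (s m) (s n)) < e)"

locale pre_hilbert_module =
  fixes X :: "('a::cstar_algebra_1, 'x, 'z) hmod_scheme"
  assumes zero_closed: "hzero X \<in> hcarr X"
    and add_closed: "\<lbrakk>x \<in> hcarr X; y \<in> hcarr X\<rbrakk> \<Longrightarrow> hadd X x y \<in> hcarr X"
    and scale_closed: "x \<in> hcarr X \<Longrightarrow> hscale X c x \<in> hcarr X"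
    and ract_closed: "x \<in> hcarr X \<Longrightarrow> hract X x a \<in> hcarr X"
    and add_assoc: "\<lbrakk>x \<in> hcarr X; y \<in> hcarr X; z \<in> hcarr X\<rbrakk> \<Longrightarrow>
          hadd X (hadd X x y) z = hadd X x (hadd X y z)"
    and add_commute: "\<lbrakk>x \<in> hcarr X; y \<in> hcarr X\<rbrakk> \<Longrightarrow> hadd X x y = hadd X y x"
    and add_zero: "x \<in> hcarr X \<Longrightarrow> hadd X x (hzero X) = x"
    and diff_self: "x \<in> hcarr X \<Longrightarrow> hdiff X x x = hzero X"
    and scale_add_right: "\<lbrakk>x \<in> hcarr X; y \<in> hcarr X\<rbrakk> \<Longrightarrow>
          hscale X c (hadd X x y) = hadd X (hscale X c x) (hscale X c y)"
    and scale_add_left: "x \<in> hcarr X \<Longrightarrow>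
          hscale X (c + d) x = hadd X (hscale X c x) (hscale X d x)"
    and scale_scale: "x \<in> hcarr X \<Longrightarrow> hscale X c (hscale X d x) = hscale X (c * d) x"
    and scale_one: "x \<in> hcarr X \<Longrightarrow> hscale X 1 x = x"
    and ract_add_left: "\<lbrakk>x \<in> hcarr X; y \<in> hcarr X\<rbrakk> \<Longrightarrow>
          hract X (hadd X x y) a = hadd X (hract X x a) (hract X y a)"
    and ract_add_right: "x \<in> hcarr X \<Longrightarrow>
          hract X x (a + b) = hadd X (hract X x a) (hract X x b)"
    and ract_mult: "x \<in> hcarr X \<Longrightarrow> hract X x (a * b) = hract X (hract X x a) b"
    and ract_scale_left: "x \<in> hcarr X \<Longrightarrow> hract X (hscale X c x) a = hscale X c (hract X x a)"
    and ract_scale_right: "x \<in> hcarr X \<Longrightarrow> hract X x (c *\<^sub>C a) = hscale X c (hract X x a)"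
    and inn_add: "\<lbrakk>x \<in> hcarr X; y \<in> hcarr X; z \<in> hcarr X\<rbrakk> \<Longrightarrow>
          hinn X x (hadd X y z) = hinn X x y + hinn X x z"
    and inn_scale: "\<lbrakk>x \<in> hcarr X; y \<in> hcarr X\<rbrakk> \<Longrightarrow> hinn X x (hscale X c y) = c *\<^sub>C hinn X x y"
    and inn_ract: "\<lbrakk>x \<in> hcarr X; y \<in> hcarr X\<rbrakk> \<Longrightarrow> hinn X x (hract X y a) = hinn X x y * a"
    and inn_star: "\<lbrakk>x \<in> hcarr X; y \<in> hcarr X\<rbrakk> \<Longrightarrow> star (hinn X x y) = hinn X y x"
    and inn_pos: "x \<in> hcarr X \<Longrightarrow> cpos (hinn X x x)"

locale hilbert_module = pre_hilbert_module +
  assumes inn_definite: "\<lbrakk>x \<in> hcarr X; hinn X x x = 0\<rbrakk> \<Longrightarrow> x = hzero X"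
    and complete: "hCauchy X s \<Longrightarrow> \<exists>x\<in>hcarr X. (\<lambda>n. hnorm X (hdiff X (s n) x)) \<longlonglongrightarrow> 0"

definition adjoint_pair ::
    "('a, 'x, 'z) hmod_scheme \<Rightarrow> ('x \<Rightarrow> 'x) \<Rightarrow> ('x \<Rightarrow> 'x) \<Rightarrow> bool" where
  "adjoint_pair X T S \<longleftrightarrow>
     (\<forall>x\<in>hcarr X. T x \<in> hcarr X \<and> S x \<in> hcarr X) \<and>
     (\<forall>x\<in>hcarr X. \<forall>y\<in>hcarr X. hinn X (T x) y = hinn X x (S y))"

text \<open>
  A left action by adjointable operators is a $*$-homomorphism from the algebra into the adjointable
  operators. Linearity of each operator, and its commuting with the right action, are
  automatic for adjointable operators. The left action need not be nondegenerate.
\<close>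

locale hilbert_bimodule = hilbert_module X
  for X :: "('a::cstar_algebra_1, 'x, 'z) hbimod_scheme" +
  assumes lact_adjoint: "adjoint_pair X (hlact X a) (hlact X (star a))"
    and lact_add: "x \<in> hcarr X \<Longrightarrow> hlact X (a + b) x = hadd X (hlact X a x) (hlact X b x)"
    and lact_scale: "x \<in> hcarr X \<Longrightarrow> hlact X (c *\<^sub>C a) x = hscale X c (hlact X a x)"
    and lact_mult: "x \<in> hcarr X \<Longrightarrow> hlact X (a * b) x = hlact X a (hlact X b x)"

definition bimod_iso ::
    "('a, 'x, 'z) hbimod_scheme \<Rightarrow> ('a, 'y, 'w) hbimod_scheme \<Rightarrow> ('x \<Rightarrow> 'y) \<Rightarrow> bool" where
  "bimod_iso X Y T \<longleftrightarrow>
     bij_betw T (hcarr X) (hcarr Y) \<and>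
     (\<forall>x\<in>hcarr X. \<forall>y\<in>hcarr X. T (hadd X x y) = hadd Y (T x) (T y)) \<and>
     (\<forall>x\<in>hcarr X. \<forall>c. T (hscale X c x) = hscale Y c (T x)) \<and>
     (\<forall>x\<in>hcarr X. \<forall>a. T (hract X x a) = hract Y (T x) a) \<and>
     (\<forall>x\<in>hcarr X. \<forall>a. T (hlact X a x) = hlact Y a (T x)) \<and>
     (\<forall>x\<in>hcarr X. \<forall>y\<in>hcarr X. hinn Y (T x) (T y) = hinn X x y)"

definition std_bimod :: "('a::cstar_algebra_1, 'a) hbimod" where
  "std_bimod = \<lparr>hcarr = UNIV, hzero = 0, hadd = (+), hscale = (*\<^sub>C), hract = (*),
     hinn = (\<lambda>a b. star a * b), hlact = (*)\<rparr>"


subsection \<open>Separation and completion\<close>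

text \<open>
  The elements of the completion are the classes of Cauchy sequences modulo null sequences.
  This divides out the vectors of length zero and completes in one step.
\<close>

definition hclass :: "('a::real_normed_vector, 'x, 'z) hmod_scheme \<Rightarrow> (nat \<Rightarrow> 'x) \<Rightarrow> (nat \<Rightarrow> 'x) set"
  where
  "hclass V s = {t. hCauchy V t \<and> (\<lambda>n. hnorm V (hdiff V (t n) (s n))) \<longlonglongrightarrow> 0}"

definition hrep :: "(nat \<Rightarrow> 'x) set \<Rightarrow> nat \<Rightarrow> 'x" where
  "hrep S = (SOME s. s \<in> S)"

definition hcompletion ::
    "('a::real_normed_vector, 'x) hbimod \<Rightarrow> ('a, (nat \<Rightarrow> 'x) set) hbimod" where
  "hcompletion V =
     \<lparr>hcarr = hclass V ` {s. hCauchy V s},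
      hzero = hclass V (\<lambda>n. hzero V),
      hadd = (\<lambda>S T. hclass V (\<lambda>n. hadd V (hrep S n) (hrep T n))),
      hscale = (\<lambda>c S. hclass V (\<lambda>n. hscale V c (hrep S n))),
      hract = (\<lambda>S a. hclass V (\<lambda>n. hract V (hrep S n) a)),
      hinn = (\<lambda>S T. lim (\<lambda>n. hinn V (hrep S n) (hrep T n))),
      hlact = (\<lambda>a S. hclass V (\<lambda>n. hlact V a (hrep S n)))\<rparr>"

definition hembed :: "('a::real_normed_vector, 'x) hbimod \<Rightarrow> 'x \<Rightarrow> (nat \<Rightarrow> 'x) set" where
  "hembed V x = hclass V (\<lambda>n. x)"


subsection \<open>Interior tensor product\<close>

text \<open>
  The completion is taken of the free vector space on pairs of vectors. The elements by which one
  passes to the algebraic (balanced) tensor product have length zero, hence are divided out as well.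
\<close>

definition pre_tensor ::
    "('a::cstar_algebra_1, 'x) hbimod \<Rightarrow> ('a, 'y) hbimod \<Rightarrow> ('a, ('x \<times> 'y) \<Rightarrow>\<^sub>0 complex) hbimod"
  where
  "pre_tensor X Y =
     \<lparr>hcarr = {u. Poly_Mapping.keys u \<subseteq> hcarr X \<times> hcarr Y},
      hzero = 0,
      hadd = (+),
      hscale = (\<lambda>c. Poly_Mapping.map ((*) c)),
      hract = (\<lambda>u a. \<Sum>k\<in>Poly_Mapping.keys u.
         Poly_Mapping.single (fst k, hract Y (snd k) a) (Poly_Mapping.lookup u k)),
      hinn = (\<lambda>u v. \<Sum>k\<in>Poly_Mapping.keys u. \<Sum>l\<in>Poly_Mapping.keys v.
         (cnj (Poly_Mapping.lookup u k) * Poly_Mapping.lookup v l) *\<^sub>C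
           hinn Y (snd k) (hlact Y (hinn X (fst k) (fst l)) (snd l))),
      hlact = (\<lambda>a u. \<Sum>k\<in>Poly_Mapping.keys u.
         Poly_Mapping.single (hlact X a (fst k), snd k) (Poly_Mapping.lookup u k))\<rparr>"

definition tensor ::
    "('a::cstar_algebra_1, 'x) hbimod \<Rightarrow> ('a, 'y) hbimod \<Rightarrow>
     ('a, (nat \<Rightarrow> ('x \<times> 'y) \<Rightarrow>\<^sub>0 complex) set) hbimod"
  where
  "tensor X Y = hcompletion (pre_tensor X Y)"

definition elem_tensor ::
    "('a::cstar_algebra_1, 'x) hbimod \<Rightarrow> ('a, 'y) hbimod \<Rightarrow> 'x \<Rightarrow> 'y \<Rightarrow>
     (nat \<Rightarrow> ('x \<times> 'y) \<Rightarrow>\<^sub>0 complex) set"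
  where
  "elem_tensor X Y x y = hembed (pre_tensor X Y) (Poly_Mapping.single (x, y) 1)"


section \<open>Product systems\<close>

definition fibre_union :: "('p \<Rightarrow> ('a, 'x) hbimod) \<Rightarrow> ('p \<times> 'x) set" where
  "fibre_union X = (SIGMA p:UNIV. hcarr (X p))"

text \<open>
  All fibres have their elements in one type, so the requirement that the fibre over 1 is the algebra
  is stated through an identification \<open>\<iota>\<close>, an isomorphism of bimodules. The last two conjuncts say that
  multiplication by elements of the fibre over 1 is given by the module actions.
\<close>

definition product_system ::
    "('p::monoid_mult \<Rightarrow> ('a::cstar_algebra_1, 'x) hbimod) \<Rightarrow> ('a \<Rightarrow> 'x) \<Rightarrow>
     ('p \<times> 'x \<Rightarrow> 'p \<times> 'x \<Rightarrow> 'p \<times> 'x) \<Rightarrow> bool"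
  where
  "product_system X \<iota> m \<longleftrightarrow>
     (\<forall>p q r :: 'p. p * q = p * r \<longrightarrow> q = r) \<and>
     (\<forall>p. hilbert_bimodule (X p)) \<and>
     (\<forall>u\<in>fibre_union X. \<forall>v\<in>fibre_union X. m u v \<in> fibre_union X) \<and>
     (\<forall>u\<in>fibre_union X. \<forall>v\<in>fibre_union X. \<forall>w\<in>fibre_union X. m (m u v) w = m u (m v w)) \<and>
     (\<forall>p q. p \<noteq> 1 \<longrightarrow>
        (\<exists>T. bimod_iso (tensor (X p) (X q)) (X (p * q)) T \<and>
             (\<forall>x\<in>hcarr (X p). \<forall>y\<in>hcarr (X q).
                m (p, x) (q, y) = (p * q, T (elem_tensor (X p) (X q) x y))))) \<and>
     bimod_iso std_bimod (X 1) \<iota> \<and>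
     (\<forall>p a. \<forall>x\<in>hcarr (X p). m (1, \<iota> a) (p, x) = (p, hlact (X p) a x)) \<and>
     (\<forall>p a. \<forall>x\<in>hcarr (X p). m (p, x) (1, \<iota> a) = (p, hract (X p) x a))"

definition bounded_fibrewise_bilinear ::
    "('p::monoid_mult \<Rightarrow> ('a::cstar_algebra_1, 'x) hbimod) \<Rightarrow>
     ('p \<times> 'x \<Rightarrow> 'p \<times> 'x \<Rightarrow> 'p \<times> 'x) \<Rightarrow> bool"
  where
  "bounded_fibrewise_bilinear X m \<longleftrightarrow>
     (\<forall>p q. \<exists>b C. \<forall>x\<in>hcarr (X p). \<forall>y\<in>hcarr (X q).
        m (p, x) (q, y) = (p * q, b x y) \<and> b x y \<in> hcarr (X (p * q)) \<and>
        hnorm (X (p * q)) (b x y) \<le> C * hnorm (X p) x * hnorm (X q) y \<and>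
        (\<forall>x'\<in>hcarr (X p). b (hadd (X p) x x') y = hadd (X (p * q)) (b x y) (b x' y)) \<and>
        (\<forall>y'\<in>hcarr (X q). b x (hadd (X q) y y') = hadd (X (p * q)) (b x y) (b x y')) \<and>
        (\<forall>c. b (hscale (X p) c x) y = hscale (X (p * q)) c (b x y) \<and>
             b x (hscale (X q) c y) = hscale (X (p * q)) c (b x y)))"


section \<open>The full group $C^*$-algebra\<close>

text \<open>
  Groups are written additively, as in \<^class>\<open>group_add\<close>, and need not be commutative. The complex
  group algebra is \<open>'g \<Rightarrow>\<^sub>0 complex\<close>, with the convolution product of
  \<^theory>\<open>HOL-Library.Poly_Mapping\<close>.
\<close>

lift_definition gstar :: "('g::group_add \<Rightarrow>\<^sub>0 complex) \<Rightarrow> ('g \<Rightarrow>\<^sub>0 complex)"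
  is "\<lambda>f g. cnj (f (- g))"
proof -
  fix f :: "'g \<Rightarrow> complex"
  assume "finite {g. f g \<noteq> 0}"
  then have "finite (uminus ` {g. f g \<noteq> 0})" by simp
  moreover have "{g. cnj (f (- g)) \<noteq> 0} \<subseteq> uminus ` {g. f g \<noteq> 0}"
    by (auto simp: image_iff) (metis minus_minus)
  ultimately show "finite {g. cnj (f (- g)) \<noteq> 0}" by (rule rev_finite_subset)
qed

text \<open>Hilbert spaces are Hilbert modules over the complex numbers.\<close>

locale star_rep = hilbert_module H
  for H :: "(complex, 'x, 'z) hmod_scheme" +
  fixes \<rho> :: "('g::group_add \<Rightarrow>\<^sub>0 complex) \<Rightarrow> 'x \<Rightarrow> 'x"
  assumes rep_adjoint: "adjoint_pair H (\<rho> f) (\<rho> (gstar f))"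
    and rep_add: "x \<in> hcarr H \<Longrightarrow> \<rho> (f + g) x = hadd H (\<rho> f x) (\<rho> g x)"
    and rep_scale: "x \<in> hcarr H \<Longrightarrow> \<rho> (Poly_Mapping.map ((*) c) f) x = hscale H c (\<rho> f x)"
    and rep_mult: "x \<in> hcarr H \<Longrightarrow> \<rho> (f * g) x = \<rho> f (\<rho> g x)"
    and rep_one: "x \<in> hcarr H \<Longrightarrow> \<rho> 1 x = x"

text \<open>
  The universal norm is the supremum of the operator norms over all unital $*$-representations of the
  group algebra (equivalently, unitary representations of the group) on Hilbert spaces. HOL cannot
  quantify over all types, so the Hilbert spaces have their elements in one fixed type. That type
  is large enough: a cyclic representation is equivalent to one on the
  completion of the group algebra in a semi-inner product, and cyclic representations already give
  the supremum.
\<close>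

definition unorm :: "('g::group_add \<Rightarrow>\<^sub>0 complex) \<Rightarrow> real" where
  "unorm f = Sup {hnorm H (\<rho> f x) | (H :: (complex, (nat \<Rightarrow> ('g \<Rightarrow>\<^sub>0 complex)) set) hmod) \<rho> x.
     star_rep H \<rho> \<and> x \<in> hcarr H \<and> hnorm H x \<le> 1}"


subsection \<open>The universal norm is a $C^*$-seminorm\<close>

context pre_hilbert_module
begin

lemma inn_add_left:
  assumes "x \<in> hcarr X" "y \<in> hcarr X" "z \<in> hcarr X"
  shows "hinn X (hadd X x y) z = hinn X x z + hinn X y z"
  using inn_add[of z x y] assms by (metis inn_star add_closed star_add)

lemma inn_scale_left:
  assumes "x \<in> hcarr X" "y \<in> hcarr X"
  shows "hinn X (hscale X c x) y = cnj c *\<^sub>C hinn X x y"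
  using inn_scale[of y x c] assms by (metis inn_star scale_closed star_scaleC)

lemma inn_zero: "x \<in> hcarr X \<Longrightarrow> hinn X x (hzero X) = 0"
  using inn_add[of x "hzero X" "hzero X"] zero_closed add_zero by simp

lemma diff_closed: "x \<in> hcarr X \<Longrightarrow> y \<in> hcarr X \<Longrightarrow> hdiff X x y \<in> hcarr X"
  by (simp add: hdiff_def add_closed scale_closed)

end

locale hilbert_space = hilbert_module H for H :: "(complex, 'x, 'z) hmod_scheme"
begin

lemma inn_self_real: "x \<in> hcarr H \<Longrightarrow> hinn H x x = complex_of_real ((hnorm H x)\<^sup>2)"
proof -
  assume "x \<in> hcarr H"
  then obtain b where b: "hinn H x x = b * cnj b"
    using inn_pos[of x] by (auto simp: cpos_def star_complex_def mult.commute)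
  then have "hnorm H x = cmod b" by (simp add: hnorm_def norm_mult)
  then show ?thesis using b complex_norm_square[of b] by simp
qed

lemma hnorm_nonneg: "hnorm H x \<ge> 0"
  by (simp add: hnorm_def)

lemma hnorm_scale: "x \<in> hcarr H \<Longrightarrow> hnorm H (hscale H c x) = cmod c * hnorm H x"
  by (simp add: hnorm_def inn_scale inn_scale_left scale_closed scaleC_complex_def norm_mult
      real_sqrt_mult)

lemma cauchy_schwarz:
  assumes x: "x \<in> hcarr H" and y: "y \<in> hcarr H"
  shows "cmod (hinn H x y) \<le> hnorm H x * hnorm H y"
proof (cases "hnorm H y = 0")
  case True
  then have "hinn H y y = 0" using inn_self_real[OF y] by simp
  then have "y = hzero H" using inn_definite y by blast
  then show ?thesis using x by (simp add: inn_zero hnorm_nonneg True)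
next
  case False
  define a where "a = hinn H y x"
  define N where "N = (hnorm H y)\<^sup>2"
  have N: "N > 0" using False by (simp add: N_def)
  define c where "c = - a / complex_of_real N"
  define z where "z = hadd H x (hscale H c y)"
  have z: "z \<in> hcarr H" using x y by (simp add: z_def add_closed scale_closed)
  have xy: "hinn H x y = cnj a"
    using inn_star[OF y x] by (simp add: a_def star_complex_def)
  have "hinn H z z = hinn H x x + c * cnj a + cnj c * a + cnj c * (c * complex_of_real N)"
    using x y xy inn_self_real[OF y]
    by (simp add: z_def inn_add inn_add_left inn_scale inn_scale_left add_closed scale_closed
        scaleC_complex_def a_def N_def algebra_simps)
  also have "\<dots> = complex_of_real ((hnorm H x)\<^sup>2 - (cmod a)\<^sup>2 / N)"
  proof -
    have "a * cnj a = complex_of_real ((cmod a)\<^sup>2)"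
      by (rule complex_norm_square[symmetric])
    moreover have "c * cnj a + cnj c * a + cnj c * (c * complex_of_real N) =
        - (a * cnj a) / complex_of_real N"
      using N by (simp add: c_def field_simps)
    ultimately show ?thesis
      using inn_self_real[OF x] by (simp add: add.assoc)
  qed
  finally have "complex_of_real ((hnorm H z)\<^sup>2) = complex_of_real ((hnorm H x)\<^sup>2 - (cmod a)\<^sup>2 / N)"
    using inn_self_real[OF z] by simp
  then have "(hnorm H z)\<^sup>2 = (hnorm H x)\<^sup>2 - (cmod a)\<^sup>2 / N"
    using of_real_eq_iff by blast
  then have "(cmod a)\<^sup>2 / N \<le> (hnorm H x)\<^sup>2"
    by (metis diff_ge_0_iff_ge zero_le_power2)
  then have "(cmod a)\<^sup>2 \<le> (hnorm H x * hnorm H y)\<^sup>2"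
    using N by (simp add: N_def field_simps power_mult_distrib)
  then have "cmod a \<le> hnorm H x * hnorm H y"
    by (rule power2_le_imp_le) (simp add: hnorm_nonneg)
  then show ?thesis by (simp add: xy)
qed

lemma hnorm_triangle:
  assumes x: "x \<in> hcarr H" and y: "y \<in> hcarr H"
  shows "hnorm H (hadd H x y) \<le> hnorm H x + hnorm H y"
proof (rule power2_le_imp_le)
  have "complex_of_real ((hnorm H (hadd H x y))\<^sup>2) =
      hinn H x x + hinn H y x + hinn H x y + hinn H y y"
    using x y inn_self_real[OF add_closed[OF x y]]
    by (simp add: inn_add inn_add_left add_closed add.assoc)
  then have "(hnorm H (hadd H x y))\<^sup>2 = cmod (hinn H x x + hinn H y x + hinn H x y + hinn H y y)"
    by (metis norm_of_real abs_power2)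
  also have "\<dots> \<le> cmod (hinn H x x) + cmod (hinn H y x) + cmod (hinn H x y) + cmod (hinn H y y)"
    by (meson add_mono norm_triangle_ineq order_refl order_trans)
  also have "\<dots> \<le> (hnorm H x + hnorm H y)\<^sup>2"
    using cauchy_schwarz[OF x y] cauchy_schwarz[OF y x]
    by (simp add: hnorm_def power2_sum algebra_simps)
  finally show "(hnorm H (hadd H x y))\<^sup>2 \<le> (hnorm H x + hnorm H y)\<^sup>2" .
qed (simp add: hnorm_nonneg)

end

lemma poly_mapping_single_induct [case_names single sum]:
  fixes f :: "'g \<Rightarrow>\<^sub>0 'b::comm_monoid_add"
  assumes single: "\<And>g c. P (Poly_Mapping.single g c)"
    and sum: "\<And>f1 f2. P f1 \<Longrightarrow> P f2 \<Longrightarrow> P (f1 + f2)"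
  shows "P f"
proof (induction f rule: update_induct)
  case const
  show ?case using single[of undefined 0] by simp
next
  case (update f g c)
  have "Poly_Mapping.update g c f = Poly_Mapping.single g c + f"
    using update(1)
    by (intro poly_mapping_eqI)
      (auto simp: lookup_update lookup_add lookup_single in_keys_iff when_def)
  then show ?case using sum[OF single update(3)] by simp
qed

lemma gstar_single: "gstar (Poly_Mapping.single g c) = Poly_Mapping.single (- g) (cnj c)"
  by transfer (auto simp: fun_eq_iff when_def)

lemma gstar_add: "gstar (f + h) = gstar f + gstar h"
  by transfer auto

lemma gstar_gstar: "gstar (gstar f) = f"
  by transfer auto

lemma gstar_mult: "gstar (f * h) = gstar h * gstar f"
proof (induction f rule: poly_mapping_single_induct)
  case (single g c)
  show ?case
    by (induction h rule: poly_mapping_single_induct)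
      (simp_all add: gstar_add gstar_single mult_single minus_add distrib_left distrib_right
        mult.commute)
next
  case (sum f1 f2)
  then show ?case by (simp add: gstar_add distrib_left distrib_right)
qed

lemma gstar_one: "gstar 1 = 1"
  by (metis gstar_single complex_cnj_one minus_zero single_one)

lemma gmap_eq: "Poly_Mapping.map ((*) c) f = Poly_Mapping.single 0 c * f"
  for f :: "'g::group_add \<Rightarrow>\<^sub>0 complex"
  by (rule mult_map_scale_conv_mult)

sublocale star_rep \<subseteq> hilbert_space
  by unfold_locales

context star_rep
begin

lemma rep_closed: "x \<in> hcarr H \<Longrightarrow> \<rho> f x \<in> hcarr H"
  using rep_adjoint by (auto simp: adjoint_pair_def)

lemma rep_inn: "x \<in> hcarr H \<Longrightarrow> y \<in> hcarr H \<Longrightarrow> hinn H (\<rho> f x) y = hinn H x (\<rho> (gstar f) y)"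
  using rep_adjoint[of f] by (auto simp: adjoint_pair_def)

lemma rep_hnorm_sq:
  assumes "x \<in> hcarr H"
  shows "complex_of_real ((hnorm H (\<rho> f x))\<^sup>2) = hinn H x (\<rho> (gstar f * f) x)"
  using assms rep_inn[of x "\<rho> f x" f] inn_self_real[of "\<rho> f x"]
  by (simp add: rep_closed rep_mult)

lemma rep_scalar: "x \<in> hcarr H \<Longrightarrow> \<rho> (Poly_Mapping.single 0 c) x = hscale H c x"
  using rep_scale[of x c 1] rep_one by (simp add: gmap_eq)

lemma rep_single_norm:
  assumes "x \<in> hcarr H"
  shows "hnorm H (\<rho> (Poly_Mapping.single g c) x) = cmod c * hnorm H x"
proof -
  have "complex_of_real ((hnorm H (\<rho> (Poly_Mapping.single g c) x))\<^sup>2) =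
      hinn H x (\<rho> (Poly_Mapping.single 0 (cnj c * c)) x)"
    using rep_hnorm_sq[OF assms, of "Poly_Mapping.single g c"]
    by (simp add: gstar_single mult_single)
  also have "\<dots> = (cnj c * c) * complex_of_real ((hnorm H x)\<^sup>2)"
    using assms by (simp add: rep_scalar inn_scale inn_self_real scaleC_complex_def)
  also have "\<dots> = complex_of_real ((cmod c * hnorm H x)\<^sup>2)"
    using complex_norm_square[of c] by (simp add: power_mult_distrib mult.commute)
  finally have "(hnorm H (\<rho> (Poly_Mapping.single g c) x))\<^sup>2 = (cmod c * hnorm H x)\<^sup>2"
    using of_real_eq_iff by blast
  then show ?thesis
    by (simp add: hnorm_nonneg power2_eq_iff_nonneg)
qed

end

lemma rep_bounded:
  fixes f :: "'g::group_add \<Rightarrow>\<^sub>0 complex"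
  shows "\<exists>C\<ge>0. \<forall>(H :: (complex, 'x) hmod) \<rho> x. star_rep H \<rho> \<longrightarrow> x \<in> hcarr H \<longrightarrow>
    hnorm H (\<rho> f x) \<le> C * hnorm H x"
proof (induction f rule: poly_mapping_single_induct)
  case (single g c)
  show ?case
    by (rule exI[of _ "cmod c"]) (auto simp: star_rep.rep_single_norm)
next
  case (sum f1 f2)
  then obtain C1 C2 where C: "C1 \<ge> 0" "C2 \<ge> 0"
    and C1: "\<And>(H :: (complex, 'x) hmod) \<rho> x. star_rep H \<rho> \<Longrightarrow> x \<in> hcarr H \<Longrightarrow>
      hnorm H (\<rho> f1 x) \<le> C1 * hnorm H x"
    and C2: "\<And>(H :: (complex, 'x) hmod) \<rho> x. star_rep H \<rho> \<Longrightarrow> x \<in> hcarr H \<Longrightarrow>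
      hnorm H (\<rho> f2 x) \<le> C2 * hnorm H x"
    by blast
  have "hnorm H (\<rho> (f1 + f2) x) \<le> (C1 + C2) * hnorm H x"
    if r: "star_rep H \<rho>" and x: "x \<in> hcarr H" for H :: "(complex, 'x) hmod" and \<rho> x
  proof -
    interpret star_rep H \<rho> by (rule r)
    have "hnorm H (\<rho> (f1 + f2) x) \<le> hnorm H (\<rho> f1 x) + hnorm H (\<rho> f2 x)"
      using hnorm_triangle[OF rep_closed[OF x] rep_closed[OF x]] rep_add[OF x] by simp
    also have "\<dots> \<le> C1 * hnorm H x + C2 * hnorm H x"
      using C1[OF r x] C2[OF r x] by simp
    finally show ?thesis by (simp add: distrib_right)
  qed
  then show ?case using C by (intro exI[of _ "C1 + C2"]) auto
qed


lemma trivial_rep: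
  obtains H :: "(complex, (nat \<Rightarrow> ('g::group_add \<Rightarrow>\<^sub>0 complex)) set) hmod"
    and \<rho> :: "('g \<Rightarrow>\<^sub>0 complex) \<Rightarrow> (nat \<Rightarrow> ('g \<Rightarrow>\<^sub>0 complex)) set \<Rightarrow> (nat \<Rightarrow> ('g \<Rightarrow>\<^sub>0 complex)) set"
    and x
  where "star_rep H \<rho>" "x \<in> hcarr H" "hnorm H x = 1"
proof -
  define e :: "complex \<Rightarrow> (nat \<Rightarrow> ('g \<Rightarrow>\<^sub>0 complex)) set"
    where "e c = {\<lambda>_. Poly_Mapping.single 0 c}" for c
  define d where "d = inv e"
  have "inj e"
    by (auto simp: inj_def e_def fun_eq_iff dest: injD[OF inj_single])
  then have [simp]: "d (e c) = c" for c
    by (simp add: d_def)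
  define H :: "(complex, (nat \<Rightarrow> ('g \<Rightarrow>\<^sub>0 complex)) set) hmod" where
    "H = \<lparr>hcarr = range e, hzero = e 0, hadd = (\<lambda>x y. e (d x + d y)),
      hscale = (\<lambda>c x. e (c * d x)), hract = (\<lambda>x c. e (d x * c)), hinn = (\<lambda>x y. cnj (d x) * d y)\<rparr>"
  define t :: "('g \<Rightarrow>\<^sub>0 complex) \<Rightarrow> complex"
    where "t f = (\<Sum>g\<in>Poly_Mapping.keys f. Poly_Mapping.lookup f g)" for f
  define \<rho> where "\<rho> f x = e (t f * d x)" for f x
  have t_eq: "t f = (\<Sum>g\<in>A. Poly_Mapping.lookup f g)"
    if "finite A" "Poly_Mapping.keys f \<subseteq> A" for A f
    unfolding t_def using that by (intro sum.mono_neutral_left) (auto simp: in_keys_iff)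
  have t_add: "t (f + h) = t f + t h" for f h
  proof -
    let ?A = "Poly_Mapping.keys f \<union> Poly_Mapping.keys h"
    have "t (f + h) = (\<Sum>g\<in>?A. Poly_Mapping.lookup (f + h) g)"
      by (rule t_eq) (use Poly_Mapping.keys_add[of f h] in auto)
    then show ?thesis
      using t_eq[of ?A f] t_eq[of ?A h] by (simp add: lookup_add sum.distrib)
  qed
  have t_single: "t (Poly_Mapping.single g c) = c" for g c
    using t_eq[of "{g}" "Poly_Mapping.single g c"] by simp
  have t_mult: "t (f * h) = t f * t h" for f h
  proof (induction f rule: poly_mapping_single_induct)
    case (single g c)
    show ?case
      by (induction h rule: poly_mapping_single_induct)
        (simp_all add: t_add t_single mult_single distrib_left)
  next
    case (sum f1 f2)
    then show ?case by (simp add: t_add distrib_right)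
  qed
  have t_star: "t (gstar f) = cnj (t f)" for f
    by (induction f rule: poly_mapping_single_induct)
      (simp_all add: t_add t_single gstar_add gstar_single)
  have t_one: "t 1 = 1"
    using t_single[of 0 1] by simp
  have norm: "hnorm H x = cmod (d x)" for x
    by (simp add: hnorm_def H_def norm_mult)
  have "star_rep H \<rho>"
  proof unfold_locales
    fix s assume s: "hCauchy H s"
    have diff: "hnorm H (hdiff H x y) = cmod (d x - d y)" for x y
      by (simp add: norm hdiff_def) (simp add: H_def)
    have "Cauchy (\<lambda>n. d (s n))"
      using s unfolding hCauchy_def diff Cauchy_def dist_norm by blast
    then obtain l where "(\<lambda>n. d (s n)) \<longlonglongrightarrow> l"
      using Cauchy_convergent convergent_def by blast
    then have "(\<lambda>n. cmod (d (s n) - l)) \<longlonglongrightarrow> 0"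
      using Lim_null tendsto_norm_zero by blast
    then show "\<exists>x\<in>hcarr H. (\<lambda>n. hnorm H (hdiff H (s n) x)) \<longlonglongrightarrow> 0"
      by (intro bexI[of _ "e l"]) (simp add: diff, simp add: H_def)
  next
    show "cpos (hinn H x x)" for x
      unfolding cpos_def by (rule exI[of _ "d x"]) (simp add: H_def star_complex_def)
  qed (auto simp: H_def hdiff_def \<rho>_def adjoint_pair_def algebra_simps star_complex_def
      scaleC_complex_def t_add t_mult t_star t_one t_single gmap_eq)
  moreover have "e 1 \<in> hcarr H" by (simp add: H_def)
  moreover have "hnorm H (e 1) = 1" by (simp add: norm)
  ultimately show thesis by (rule that)
qed

lemma unorm_bound:
  fixes H :: "(complex, (nat \<Rightarrow> ('g::group_add \<Rightarrow>\<^sub>0 complex)) set) hmod"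
    and f :: "'g \<Rightarrow>\<^sub>0 complex"
  assumes "star_rep H \<rho>" and x: "x \<in> hcarr H"
  shows "hnorm H (\<rho> f x) \<le> unorm f * hnorm H x"
proof -
  interpret star_rep H \<rho> by fact
  from rep_bounded[of f] obtain C where C: "C \<ge> 0"
    and C0: "\<forall>(K :: (complex, (nat \<Rightarrow> ('g \<Rightarrow>\<^sub>0 complex)) set) hmod) \<sigma> y.
      star_rep K \<sigma> \<longrightarrow> y \<in> hcarr K \<longrightarrow> hnorm K (\<sigma> f y) \<le> C * hnorm K y"
    by (elim exE conjE)
  have C1: "hnorm K (\<sigma> f y) \<le> C * hnorm K y" if "star_rep K \<sigma>" "y \<in> hcarr K"
    for K :: "(complex, (nat \<Rightarrow> ('g \<Rightarrow>\<^sub>0 complex)) set) hmod" and \<sigma> y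
    using C0[rule_format, OF that] .
  show ?thesis
  proof (cases "hnorm H x = 0")
    case True
    then show ?thesis using C1[OF assms] by simp
  next
    case False
    define y where "y = hscale H (complex_of_real (1 / hnorm H x)) x"
    have y: "y \<in> hcarr H" "hnorm H y = 1"
      using x False by (simp_all add: y_def scale_closed hnorm_scale norm_divide hnorm_nonneg)
    have "hnorm H (\<rho> f y) \<le> unorm f"
      unfolding unorm_def
    proof (rule cSup_upper)
      show "bdd_above {hnorm H (\<rho> f x) |
         (H :: (complex, (nat \<Rightarrow> ('g \<Rightarrow>\<^sub>0 complex)) set) hmod) \<rho> x.
         star_rep H \<rho> \<and> x \<in> hcarr H \<and> hnorm H x \<le> 1}"
      proof (rule bdd_aboveI)
        fix r assume "r \<in> {hnorm H (\<rho> f x) |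
           (H :: (complex, (nat \<Rightarrow> ('g \<Rightarrow>\<^sub>0 complex)) set) hmod) \<rho> x.
           star_rep H \<rho> \<and> x \<in> hcarr H \<and> hnorm H x \<le> 1}"
        then obtain K :: "(complex, (nat \<Rightarrow> ('g \<Rightarrow>\<^sub>0 complex)) set) hmod" and \<sigma> z
          where h: "star_rep K \<sigma>" "z \<in> hcarr K" "hnorm K z \<le> 1" "r = hnorm K (\<sigma> f z)"
          by (elim CollectE exE conjE)
        have "r \<le> C * hnorm K z" using C1[OF h(1,2)] h(4) by simp
        also have "\<dots> \<le> C" using C h(3) by (simp add: mult_left_le)
        finally show "r \<le> C" .
      qed
    next
      show "hnorm H (\<rho> f y) \<in> {hnorm H (\<rho> f x) |
         (H :: (complex, (nat \<Rightarrow> ('g \<Rightarrow>\<^sub>0 complex)) set) hmod) \<rho> x.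
         star_rep H \<rho> \<and> x \<in> hcarr H \<and> hnorm H x \<le> 1}"
        using assms(1) y by (intro CollectI exI[of _ H] exI[of _ \<rho>] exI[of _ y]) simp
    qed
    moreover have "hnorm H (\<rho> f y) = hnorm H (\<rho> f x) / hnorm H x"
    proof -
      have "\<rho> f y = \<rho> (f * Poly_Mapping.single 0 (complex_of_real (1 / hnorm H x))) x"
        using x by (simp add: y_def rep_mult rep_scalar)
      also have "f * Poly_Mapping.single 0 c = Poly_Mapping.single 0 c * f" for c
        by (induction f rule: poly_mapping_single_induct)
          (simp_all add: distrib_left distrib_right mult_single mult.commute)
      finally have "\<rho> f y = hscale H (complex_of_real (1 / hnorm H x)) (\<rho> f x)"
        using x by (simp add: rep_mult rep_scalar rep_closed)
      then show ?thesis
        using x by (simp add: hnorm_scale rep_closed norm_divide hnorm_nonneg)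
    qed
    ultimately show ?thesis
      using False hnorm_nonneg[of x] by (simp add: divide_le_eq)
  qed
qed

lemma unorm_least:
  fixes f :: "'g::group_add \<Rightarrow>\<^sub>0 complex"
  assumes B: "B \<ge> 0"
    and le: "\<And>(H :: (complex, (nat \<Rightarrow> ('g \<Rightarrow>\<^sub>0 complex)) set) hmod) \<rho> x.
      star_rep H \<rho> \<Longrightarrow> x \<in> hcarr H \<Longrightarrow> hnorm H (\<rho> f x) \<le> B * hnorm H x"
  shows "unorm f \<le> B"
  unfolding unorm_def
proof (rule cSup_least)
  obtain H :: "(complex, (nat \<Rightarrow> ('g \<Rightarrow>\<^sub>0 complex)) set) hmod"
      and \<rho> :: "('g \<Rightarrow>\<^sub>0 complex) \<Rightarrow> (nat \<Rightarrow> ('g \<Rightarrow>\<^sub>0 complex)) set \<Rightarrow> _" and x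
    where "star_rep H \<rho>" "x \<in> hcarr H" "hnorm H x = 1"
    by (rule trivial_rep)
  then have "hnorm H (\<rho> f x) \<in> {hnorm H (\<rho> f x) |
         (H :: (complex, (nat \<Rightarrow> ('g \<Rightarrow>\<^sub>0 complex)) set) hmod) \<rho> x.
         star_rep H \<rho> \<and> x \<in> hcarr H \<and> hnorm H x \<le> 1}"
    by (intro CollectI exI[of _ H] exI[of _ \<rho>] exI[of _ x]) simp
  then show "{hnorm H (\<rho> f x) |
         (H :: (complex, (nat \<Rightarrow> ('g \<Rightarrow>\<^sub>0 complex)) set) hmod) \<rho> x.
         star_rep H \<rho> \<and> x \<in> hcarr H \<and> hnorm H x \<le> 1} \<noteq> {}"
    by blast
next
  fix r assume "r \<in> {hnorm H (\<rho> f x) |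
         (H :: (complex, (nat \<Rightarrow> ('g \<Rightarrow>\<^sub>0 complex)) set) hmod) \<rho> x.
         star_rep H \<rho> \<and> x \<in> hcarr H \<and> hnorm H x \<le> 1}"
  then obtain H :: "(complex, (nat \<Rightarrow> ('g \<Rightarrow>\<^sub>0 complex)) set) hmod" and \<rho> x
    where h: "star_rep H \<rho>" "x \<in> hcarr H" "hnorm H x \<le> 1" "r = hnorm H (\<rho> f x)"
    by (elim CollectE exE conjE)
  then have "r \<le> B * hnorm H x" using le[OF h(1,2)] by simp
  also have "\<dots> \<le> B" using B h(3) by (simp add: mult_left_le)
  finally show "r \<le> B" .
qed

lemma unorm_nonneg: "unorm f \<ge> 0"
proof -
  obtain H :: "(complex, (nat \<Rightarrow> ('a \<Rightarrow>\<^sub>0 complex)) set) hmod"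
      and \<rho> :: "('a \<Rightarrow>\<^sub>0 complex) \<Rightarrow> (nat \<Rightarrow> ('a \<Rightarrow>\<^sub>0 complex)) set \<Rightarrow> _" and x
    where r: "star_rep H \<rho>" "x \<in> hcarr H" "hnorm H x = 1"
    by (rule trivial_rep)
  have "0 \<le> hnorm H (\<rho> f x)" by (simp add: hnorm_def)
  then show ?thesis using unorm_bound[OF r(1,2), of f] r(3) by simp
qed

lemma unorm_add: "unorm (f + h) \<le> unorm f + unorm h"
proof (rule unorm_least)
  fix H :: "(complex, (nat \<Rightarrow> ('a \<Rightarrow>\<^sub>0 complex)) set) hmod"
    and \<rho> :: "('a \<Rightarrow>\<^sub>0 complex) \<Rightarrow> _" and x
  assume r: "star_rep H \<rho>" and x: "x \<in> hcarr H"
  interpret star_rep H \<rho> by fact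
  show "hnorm H (\<rho> (f + h) x) \<le> (unorm f + unorm h) * hnorm H x"
    using hnorm_triangle[OF rep_closed[OF x, of f] rep_closed[OF x, of h]] rep_add[OF x]
      unorm_bound[OF r x, of f] unorm_bound[OF r x, of h] by (simp add: distrib_right)
qed (simp add: unorm_nonneg)

lemma unorm_mult: "unorm (f * h) \<le> unorm f * unorm h"
proof (rule unorm_least)
  fix H :: "(complex, (nat \<Rightarrow> ('a \<Rightarrow>\<^sub>0 complex)) set) hmod"
    and \<rho> :: "('a \<Rightarrow>\<^sub>0 complex) \<Rightarrow> _" and x
  assume r: "star_rep H \<rho>" and x: "x \<in> hcarr H"
  interpret star_rep H \<rho> by fact
  have "hnorm H (\<rho> (f * h) x) \<le> unorm f * hnorm H (\<rho> h x)"
    using unorm_bound[OF r rep_closed[OF x]] x by (simp add: rep_mult)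
  also have "\<dots> \<le> unorm f * (unorm h * hnorm H x)"
    using unorm_bound[OF r x] unorm_nonneg by (intro mult_left_mono)
  finally show "hnorm H (\<rho> (f * h) x) \<le> unorm f * unorm h * hnorm H x"
    by (simp add: mult.assoc)
qed (simp add: unorm_nonneg)

lemma unorm_one: "unorm 1 = 1"
proof (rule antisym)
  show "unorm 1 \<le> 1"
    by (rule unorm_least) (auto simp: star_rep.rep_one)
  obtain H :: "(complex, (nat \<Rightarrow> ('a \<Rightarrow>\<^sub>0 complex)) set) hmod"
      and \<rho> :: "('a \<Rightarrow>\<^sub>0 complex) \<Rightarrow> (nat \<Rightarrow> ('a \<Rightarrow>\<^sub>0 complex)) set \<Rightarrow> _" and x
    where r: "star_rep H \<rho>" "x \<in> hcarr H" "hnorm H x = 1"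
    by (rule trivial_rep)
  then show "1 \<le> unorm (1 :: 'a \<Rightarrow>\<^sub>0 complex)"
    using unorm_bound[OF r(1,2), of 1] star_rep.rep_one[OF r(1,2)] by simp
qed

lemma unorm_scale_le: "unorm (Poly_Mapping.map ((*) c) f) \<le> cmod c * unorm f"
proof (rule unorm_least)
  fix H :: "(complex, (nat \<Rightarrow> ('a \<Rightarrow>\<^sub>0 complex)) set) hmod"
    and \<rho> :: "('a \<Rightarrow>\<^sub>0 complex) \<Rightarrow> _" and x
  assume r: "star_rep H \<rho>" and x: "x \<in> hcarr H"
  interpret star_rep H \<rho> by fact
  show "hnorm H (\<rho> (Poly_Mapping.map ((*) c) f) x) \<le> cmod c * unorm f * hnorm H x"
    using unorm_bound[OF r x, of f] x
    by (simp add: rep_scale hnorm_scale rep_closed mult.assoc mult_left_mono)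
qed (simp add: unorm_nonneg)

lemma gmap_gmap: "Poly_Mapping.map ((*) c) (Poly_Mapping.map ((*) d) f) =
    Poly_Mapping.map ((*) (c * d)) (f :: 'g::group_add \<Rightarrow>\<^sub>0 complex)"
  by (simp add: gmap_eq mult_single flip: mult.assoc)

lemma gmap_one: "Poly_Mapping.map ((*) 1) (f :: 'g::group_add \<Rightarrow>\<^sub>0 complex) = f"
  by (simp add: gmap_eq)

lemma gmap_zero: "Poly_Mapping.map ((*) 0) (f :: 'g::group_add \<Rightarrow>\<^sub>0 complex) = 0"
  by (simp add: gmap_eq)

lemma unorm_zero: "unorm (0 :: 'g::group_add \<Rightarrow>\<^sub>0 complex) = 0"
  using unorm_scale_le[of 0 "0 :: 'g \<Rightarrow>\<^sub>0 complex"] unorm_nonneg[of "0 :: 'g \<Rightarrow>\<^sub>0 complex"]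
  by (simp add: gmap_zero)

lemma unorm_scale: "unorm (Poly_Mapping.map ((*) c) f) = cmod c * unorm f"
proof (cases "c = 0")
  case True
  then show ?thesis by (simp add: gmap_zero unorm_zero)
next
  case False
  have "unorm f \<le> cmod (inverse c) * unorm (Poly_Mapping.map ((*) c) f)"
    using unorm_scale_le[of "inverse c" "Poly_Mapping.map ((*) c) f"] False
    by (simp add: gmap_gmap gmap_one)
  then have "cmod c * unorm f \<le> cmod c * (cmod (inverse c) * unorm (Poly_Mapping.map ((*) c) f))"
    by (rule mult_left_mono) simp
  also have "\<dots> = unorm (Poly_Mapping.map ((*) c) f)"
    using False by (simp add: norm_inverse)
  finally have "cmod c * unorm f \<le> unorm (Poly_Mapping.map ((*) c) f)" .
  then show ?thesis using unorm_scale_le[of c f] by simp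
qed

lemma unorm_minus: "unorm (- f) = unorm f"
proof -
  have "Poly_Mapping.map ((*) (-1)) f = - f"
    by (simp add: gmap_eq single_uminus)
  then show ?thesis using unorm_scale[of "-1" f] by simp
qed

lemma unorm_diff_commute: "unorm (f - h) = unorm (h - f)"
  using unorm_minus[of "f - h"] by simp

lemma unorm_triangle: "unorm (f - k) \<le> unorm (f - h) + unorm (h - k)"
  using unorm_add[of "f - h" "h - k"] by simp

lemma unorm_diff: "\<bar>unorm f - unorm h\<bar> \<le> unorm (f - h)"
  using unorm_add[of "f - h" h] unorm_add[of "h - f" f] unorm_diff_commute[of f h] by simp

lemma unorm_cstar_le: "(unorm f)\<^sup>2 \<le> unorm (gstar f * f)"
proof -
  have "unorm f \<le> sqrt (unorm (gstar f * f))"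
  proof (rule unorm_least)
    fix H :: "(complex, (nat \<Rightarrow> ('a \<Rightarrow>\<^sub>0 complex)) set) hmod"
      and \<rho> :: "('a \<Rightarrow>\<^sub>0 complex) \<Rightarrow> _" and x
    assume r: "star_rep H \<rho>" and x: "x \<in> hcarr H"
    interpret star_rep H \<rho> by fact
    have "(hnorm H (\<rho> f x))\<^sup>2 = cmod (hinn H x (\<rho> (gstar f * f) x))"
      using rep_hnorm_sq[OF x, of f] by (metis norm_of_real abs_power2)
    also have "\<dots> \<le> hnorm H x * hnorm H (\<rho> (gstar f * f) x)"
      using cauchy_schwarz x rep_closed by blast
    also have "\<dots> \<le> hnorm H x * (unorm (gstar f * f) * hnorm H x)"
      using unorm_bound[OF r x] hnorm_nonneg by (intro mult_left_mono)
    also have "\<dots> = (sqrt (unorm (gstar f * f)) * hnorm H x)\<^sup>2"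
      using unorm_nonneg[of "gstar f * f"] by (simp add: power_mult_distrib power2_eq_square)
    finally show "hnorm H (\<rho> f x) \<le> sqrt (unorm (gstar f * f)) * hnorm H x"
      by (rule power2_le_imp_le) (simp add: unorm_nonneg hnorm_nonneg)
  qed (simp add: unorm_nonneg)
  then have "(unorm f)\<^sup>2 \<le> (sqrt (unorm (gstar f * f)))\<^sup>2"
    by (intro power_mono unorm_nonneg)
  then show ?thesis by (simp add: unorm_nonneg)
qed

lemma unorm_gstar: "unorm (gstar f) = unorm f"
proof -
  have *: "unorm h \<le> unorm (gstar h)" for h :: "'a \<Rightarrow>\<^sub>0 complex"
  proof (cases "unorm h = 0")
    case True
    then show ?thesis by (simp add: unorm_nonneg)
  next
    case False
    then have "unorm h > 0" using unorm_nonneg[of h] by simp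
    moreover have "unorm h * unorm h \<le> unorm (gstar h) * unorm h"
      using order_trans[OF unorm_cstar_le unorm_mult, of h] by (simp add: power2_eq_square)
    ultimately show ?thesis by simp
  qed
  show ?thesis using *[of f] *[of "gstar f"] by (simp add: gstar_gstar)
qed

lemma unorm_cstar: "unorm (gstar f * f) = (unorm f)\<^sup>2"
  using unorm_cstar_le[of f] unorm_mult[of "gstar f" f] by (simp add: unorm_gstar power2_eq_square)


subsection \<open>Completion of the group algebra\<close>

definition gCauchy :: "(nat \<Rightarrow> ('g::group_add \<Rightarrow>\<^sub>0 complex)) \<Rightarrow> bool" where
  "gCauchy s \<longleftrightarrow> (\<forall>e>0. \<exists>N. \<forall>m\<ge>N. \<forall>n\<ge>N. unorm (s m - s n) < e)"

definition geq ::
    "(nat \<Rightarrow> ('g::group_add \<Rightarrow>\<^sub>0 complex)) \<Rightarrow> (nat \<Rightarrow> ('g \<Rightarrow>\<^sub>0 complex)) \<Rightarrow> bool" where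
  "geq s t \<longleftrightarrow> gCauchy s \<and> gCauchy t \<and> (\<lambda>n. unorm (s n - t n)) \<longlonglongrightarrow> 0"

lemma gCauchy_const [simp]: "gCauchy (\<lambda>_. f)"
  by (simp add: gCauchy_def unorm_zero)

lemma geq_refl [simp]: "geq s s \<longleftrightarrow> gCauchy s"
  by (simp add: geq_def unorm_zero)

lemma gCauchy_comparison:
  assumes s: "gCauchy s" and t: "gCauchy t" and C: "C > 0"
    and le: "\<And>m n. unorm (u m - u n) \<le> C * unorm (s m - s n) + C * unorm (t m - t n)"
  shows "gCauchy u"
  unfolding gCauchy_def
proof (intro allI impI)
  fix e :: real assume "e > 0"
  then have e: "e / (2 * C) > 0" using C by simp
  obtain N1 where N1: "\<forall>m\<ge>N1. \<forall>n\<ge>N1. unorm (s m - s n) < e / (2 * C)"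
    using s e unfolding gCauchy_def by blast
  obtain N2 where N2: "\<forall>m\<ge>N2. \<forall>n\<ge>N2. unorm (t m - t n) < e / (2 * C)"
    using t e unfolding gCauchy_def by blast
  have "unorm (u m - u n) < e" if "m \<ge> max N1 N2" "n \<ge> max N1 N2" for m n
  proof -
    have "unorm (s m - s n) < e / (2 * C)" "unorm (t m - t n) < e / (2 * C)"
      using N1 N2 that by simp_all
    then have "C * unorm (s m - s n) < e / 2" "C * unorm (t m - t n) < e / 2"
      using C by (simp_all add: field_simps)
    then show ?thesis using le[of m n] by simp
  qed
  then show "\<exists>N. \<forall>m\<ge>N. \<forall>n\<ge>N. unorm (u m - u n) < e" by blast
qed

lemma geq_comparison:
  assumes s: "geq s s'" and t: "geq t t'" and u: "gCauchy u" "gCauchy u'"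
    and le: "\<And>n. unorm (u n - u' n) \<le> C * unorm (s n - s' n) + C * unorm (t n - t' n)"
  shows "geq u u'"
proof -
  have "(\<lambda>n. C * unorm (s n - s' n) + C * unorm (t n - t' n)) \<longlonglongrightarrow> C * 0 + C * 0"
    using s t unfolding geq_def by (intro tendsto_intros) auto
  then have lim: "(\<lambda>n. C * unorm (s n - s' n) + C * unorm (t n - t' n)) \<longlonglongrightarrow> 0" by simp
  have "(\<lambda>n. unorm (u n - u' n)) \<longlonglongrightarrow> 0"
    by (rule tendsto_sandwich[OF _ _ tendsto_const lim]) (auto simp: unorm_nonneg le)
  then show ?thesis using u by (simp add: geq_def)
qed

lemma gCauchy_convergent:
  assumes "gCauchy s"
  shows "(\<lambda>n. unorm (s n)) \<longlonglongrightarrow> lim (\<lambda>n. unorm (s n))"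
proof -
  have "Cauchy (\<lambda>n. unorm (s n))"
    using assms unfolding Cauchy_def gCauchy_def dist_real_def
    by (meson order_le_less_trans unorm_diff)
  then show ?thesis
    by (simp add: Cauchy_convergent_iff convergent_LIMSEQ_iff)
qed

lemma gCauchy_bounded:
  assumes "gCauchy s"
  obtains B where "B > 0" "\<And>n. unorm (s n) \<le> B"
proof -
  have "Bseq (\<lambda>n. unorm (s n))"
    using gCauchy_convergent[OF assms] convergentI convergent_imp_Bseq by blast
  then obtain B where "B > 0" "\<And>n. norm (unorm (s n)) \<le> B"
    unfolding Bseq_def by blast
  then show thesis using that by (metis abs_ge_self order_trans real_norm_def)
qed

lemma gCauchy_add [simp]: "gCauchy s \<Longrightarrow> gCauchy t \<Longrightarrow> gCauchy (\<lambda>n. s n + t n)"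
  by (rule gCauchy_comparison[of s t 1])
    (use unorm_add[of "s m - s n" "t m - t n" for m n] in \<open>auto simp: algebra_simps\<close>)

lemma gCauchy_minus [simp]: "gCauchy s \<Longrightarrow> gCauchy (\<lambda>n. - s n)"
  unfolding gCauchy_def using unorm_diff_commute[of "s m" "s n" for m n] by simp

lemma gCauchy_diff [simp]: "gCauchy s \<Longrightarrow> gCauchy t \<Longrightarrow> gCauchy (\<lambda>n. s n - t n)"
  using gCauchy_add[OF _ gCauchy_minus, of s t] by simp

lemma gCauchy_star [simp]: "gCauchy s \<Longrightarrow> gCauchy (\<lambda>n. gstar (s n))"
proof -
  have "gstar f - gstar h = gstar (f - h)" for f h :: "'a \<Rightarrow>\<^sub>0 complex"
    using gstar_add[of "f - h" h] by simp
  then show "gCauchy s \<Longrightarrow> gCauchy (\<lambda>n. gstar (s n))"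
    by (simp add: gCauchy_def unorm_gstar)
qed

lemma gmap_diff: "Poly_Mapping.map ((*) c) f - Poly_Mapping.map ((*) c) h =
    Poly_Mapping.map ((*) c) (f - h :: 'g::group_add \<Rightarrow>\<^sub>0 complex)"
  by (simp add: gmap_eq right_diff_distrib)

lemma gmap_mult_right: "f * Poly_Mapping.map ((*) c) h = Poly_Mapping.map ((*) c) (f * h)"
  for f h :: "'g::group_add \<Rightarrow>\<^sub>0 complex"
proof -
  have "f * Poly_Mapping.single 0 c = Poly_Mapping.single 0 c * f"
    by (induction f rule: poly_mapping_single_induct)
      (simp_all add: distrib_left distrib_right mult_single mult.commute)
  then show ?thesis by (simp add: gmap_eq flip: mult.assoc)
qed

lemma gstar_gmap: "gstar (Poly_Mapping.map ((*) c) f) = Poly_Mapping.map ((*) (cnj c)) (gstar f)"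
  using gmap_mult_right[of "gstar f" "cnj c" 1] by (simp add: gmap_eq gstar_mult gstar_single)

lemma gstar_diff: "gstar f - gstar h = gstar (f - h)"
  using gstar_add[of "f - h" h] by simp

lemma unorm_mult_diff:
  "unorm (f * h - f' * h') \<le> unorm f * unorm (h - h') + unorm (f - f') * unorm h'"
proof -
  have "f * h - f' * h' = f * (h - h') + (f - f') * h'"
    by (simp add: algebra_simps)
  then show ?thesis
    using unorm_add[of "f * (h - h')" "(f - f') * h'"] unorm_mult[of f "h - h'"]
      unorm_mult[of "f - f'" h'] by simp
qed

lemma unorm_mult_diff_bounded:
  assumes "unorm f \<le> B" "unorm h' \<le> C"
  shows "unorm (f * h - f' * h') \<le> (B + C) * unorm (f - f') + (B + C) * unorm (h - h')"
proof -
  have "0 \<le> B" "0 \<le> C" using assms unorm_nonneg order_trans by blast+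
  then have "unorm f * unorm (h - h') \<le> (B + C) * unorm (h - h')"
    "unorm (f - f') * unorm h' \<le> unorm (f - f') * (B + C)"
    using assms by (auto intro!: mult_right_mono mult_left_mono unorm_nonneg)
  then show ?thesis
    using unorm_mult_diff[of f h f' h'] by (simp add: mult.commute)
qed

lemma gCauchy_mult [simp]:
  assumes s: "gCauchy s" and t: "gCauchy t"
  shows "gCauchy (\<lambda>n. s n * t n)"
proof -
  obtain B where B: "B > 0" "\<And>n. unorm (s n) \<le> B" using gCauchy_bounded[OF s] by blast
  obtain C where C: "C > 0" "\<And>n. unorm (t n) \<le> C" using gCauchy_bounded[OF t] by blast
  show ?thesis
    by (rule gCauchy_comparison[OF s t, of "B + C"])
      (use B C in \<open>auto intro!: unorm_mult_diff_bounded\<close>)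
qed

lemma gCauchy_map [simp]: "gCauchy s \<Longrightarrow> gCauchy (\<lambda>n. Poly_Mapping.map ((*) c) (s n))"
  unfolding gmap_eq by (rule gCauchy_mult) simp_all

quotient_type (overloaded) 'g group_cstar = "nat \<Rightarrow> ('g::group_add \<Rightarrow>\<^sub>0 complex)" / partial: geq
proof (rule part_equivpI)
  show "\<exists>s :: nat \<Rightarrow> ('g \<Rightarrow>\<^sub>0 complex). geq s s"
    by (rule exI[of _ "\<lambda>_. 0"]) simp
  show "symp (geq :: (nat \<Rightarrow> ('g \<Rightarrow>\<^sub>0 complex)) \<Rightarrow> _)"
    by (rule sympI) (simp add: geq_def unorm_diff_commute)
  show "transp (geq :: (nat \<Rightarrow> ('g \<Rightarrow>\<^sub>0 complex)) \<Rightarrow> _)"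
  proof (rule transpI)
    fix s t u :: "nat \<Rightarrow> ('g \<Rightarrow>\<^sub>0 complex)"
    assume "geq s t" "geq t u"
    then show "geq s u"
      by (rule geq_comparison[where C = 1])
        (use \<open>geq s t\<close> \<open>geq t u\<close> unorm_triangle in \<open>auto simp: geq_def\<close>)
  qed
qed

definition group_algebra_embed :: "('g::group_add \<Rightarrow>\<^sub>0 complex) \<Rightarrow> 'g group_cstar" where
  "group_algebra_embed f = abs_group_cstar (\<lambda>_. f)"

instantiation group_cstar :: (group_add) "{zero, one, plus, minus, uminus, times, star, scaleC}"
begin

lift_definition zero_group_cstar :: "'a group_cstar" is "\<lambda>_. 0"
  by simp

lift_definition one_group_cstar :: "'a group_cstar" is "\<lambda>_. 1"
  by simp

lift_definition plus_group_cstar :: "'a group_cstar \<Rightarrow> 'a group_cstar \<Rightarrow> 'a group_cstar"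
  is "\<lambda>s t n. s n + t n"
proof -
  fix s s' t t' :: "nat \<Rightarrow> ('a \<Rightarrow>\<^sub>0 complex)"
  assume "geq s s'" "geq t t'"
  then show "geq (\<lambda>n. s n + t n) (\<lambda>n. s' n + t' n)"
  proof (rule geq_comparison[where C = 1])
    show "unorm (s n + t n - (s' n + t' n)) \<le> 1 * unorm (s n - s' n) + 1 * unorm (t n - t' n)" for n
      using unorm_add[of "s n - s' n" "t n - t' n"] by (simp add: algebra_simps)
  qed (use \<open>geq s s'\<close> \<open>geq t t'\<close> in \<open>simp_all add: geq_def\<close>)
qed

lift_definition uminus_group_cstar :: "'a group_cstar \<Rightarrow> 'a group_cstar"
  is "\<lambda>s n. - s n"
proof -
  fix s s' :: "nat \<Rightarrow> ('a \<Rightarrow>\<^sub>0 complex)"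
  assume "geq s s'"
  then show "geq (\<lambda>n. - s n) (\<lambda>n. - s' n)"
    using unorm_diff_commute[of "s n" "s' n" for n] by (simp add: geq_def)
qed

lift_definition minus_group_cstar :: "'a group_cstar \<Rightarrow> 'a group_cstar \<Rightarrow> 'a group_cstar"
  is "\<lambda>s t n. s n - t n"
proof -
  fix s s' t t' :: "nat \<Rightarrow> ('a \<Rightarrow>\<^sub>0 complex)"
  assume "geq s s'" "geq t t'"
  then show "geq (\<lambda>n. s n - t n) (\<lambda>n. s' n - t' n)"
  proof (rule geq_comparison[where C = 1])
    show "unorm (s n - t n - (s' n - t' n)) \<le> 1 * unorm (s n - s' n) + 1 * unorm (t n - t' n)" for n
      using unorm_add[of "s n - s' n" "t' n - t n"] unorm_diff_commute[of "t n" "t' n"]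
      by (simp add: algebra_simps)
  qed (use \<open>geq s s'\<close> \<open>geq t t'\<close> in \<open>simp_all add: geq_def\<close>)
qed

lift_definition times_group_cstar :: "'a group_cstar \<Rightarrow> 'a group_cstar \<Rightarrow> 'a group_cstar"
  is "\<lambda>s t n. s n * t n"
proof -
  fix s s' t t' :: "nat \<Rightarrow> ('a \<Rightarrow>\<^sub>0 complex)"
  assume st: "geq s s'" "geq t t'"
  obtain B where B: "B > 0" "\<And>n. unorm (s n) \<le> B"
    using gCauchy_bounded st(1) unfolding geq_def by blast
  obtain C where C: "C > 0" "\<And>n. unorm (t' n) \<le> C"
    using gCauchy_bounded st(2) unfolding geq_def by blast
  show "geq (\<lambda>n. s n * t n) (\<lambda>n. s' n * t' n)"
    by (rule geq_comparison[OF st, where C = "B + C"])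
      (use st B C in \<open>auto simp: geq_def intro!: unorm_mult_diff_bounded\<close>)
qed

lift_definition star_group_cstar :: "'a group_cstar \<Rightarrow> 'a group_cstar"
  is "\<lambda>s n. gstar (s n)"
  by (auto simp: geq_def gstar_diff unorm_gstar)

lift_definition scaleC_group_cstar :: "complex \<Rightarrow> 'a group_cstar \<Rightarrow> 'a group_cstar"
  is "\<lambda>c s n. Poly_Mapping.map ((*) c) (s n)"
  by (auto simp: geq_def gmap_diff unorm_scale intro: tendsto_mult_right_zero)

instance ..

end

lemma group_cstar_scaleC_add_right:
  fixes x y :: "'g::group_add group_cstar"
  shows "c *\<^sub>C (x + y) = c *\<^sub>C x + c *\<^sub>C y"
  by transfer (simp add: gmap_eq distrib_left)

lemma group_cstar_scaleC_add_left:
  fixes x y :: "'g::group_add group_cstar"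
  shows "(c + d) *\<^sub>C x = c *\<^sub>C x + d *\<^sub>C x"
  by transfer (simp add: gmap_eq single_add distrib_right)

lemma group_cstar_scaleC_scaleC:
  fixes x y :: "'g::group_add group_cstar"
  shows "c *\<^sub>C d *\<^sub>C x = (c * d) *\<^sub>C x"
  by transfer (simp add: gmap_gmap)

lemma group_cstar_mult_scaleC_left:
  fixes x y :: "'g::group_add group_cstar"
  shows "(c *\<^sub>C x) * y = c *\<^sub>C (x * y)"
  by transfer (simp add: gmap_eq mult.assoc)

lemma group_cstar_mult_scaleC_right:
  fixes x y :: "'g::group_add group_cstar"
  shows "x * (c *\<^sub>C y) = c *\<^sub>C (x * y)"
  by transfer (simp add: gmap_mult_right)

instantiation group_cstar :: (group_add) real_normed_algebra_1
begin

lift_definition norm_group_cstar :: "'a group_cstar \<Rightarrow> real"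
  is "\<lambda>s. lim (\<lambda>n. unorm (s n))"
proof -
  fix s t :: "nat \<Rightarrow> ('a \<Rightarrow>\<^sub>0 complex)"
  assume st: "geq s t"
  have "(\<lambda>n. unorm (s n) - unorm (t n)) \<longlonglongrightarrow> 0"
    by (rule Lim_null_comparison[of _ "\<lambda>n. unorm (s n - t n)"])
      (use st in \<open>auto simp: geq_def intro!: always_eventually unorm_diff\<close>)
  moreover have "(\<lambda>n. unorm (s n) - unorm (t n)) \<longlonglongrightarrow>
      lim (\<lambda>n. unorm (s n)) - lim (\<lambda>n. unorm (t n))"
    using st by (intro tendsto_diff gCauchy_convergent) (simp_all add: geq_def)
  ultimately show "lim (\<lambda>n. unorm (s n)) = lim (\<lambda>n. unorm (t n))"
    using LIMSEQ_unique by fastforce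
qed

definition scaleR_group_cstar :: "real \<Rightarrow> 'a group_cstar \<Rightarrow> 'a group_cstar" where
  "scaleR_group_cstar r x = complex_of_real r *\<^sub>C x"

definition sgn_group_cstar :: "'a group_cstar \<Rightarrow> 'a group_cstar" where
  "sgn_group_cstar x = complex_of_real (inverse (norm x)) *\<^sub>C x"

definition dist_group_cstar :: "'a group_cstar \<Rightarrow> 'a group_cstar \<Rightarrow> real" where
  "dist_group_cstar x y = norm (x - y)"

definition uniformity_group_cstar :: "('a group_cstar \<times> 'a group_cstar) filter" where
  "uniformity_group_cstar = (INF e\<in>{0<..}. principal {(x, y). dist x y < e})"

definition open_group_cstar :: "'a group_cstar set \<Rightarrow> bool" where
  "open_group_cstar U \<longleftrightarrow> (\<forall>x\<in>U. \<forall>\<^sub>F (x', y) in uniformity. x' = x \<longrightarrow> y \<in> U)"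

instance
proof
  fix x y z :: "'a group_cstar" and r q :: real
  show "x + y + z = x + (y + z)" "x + y = y + x" "0 + x = x" "- x + x = 0" "x - y = x + - y"
    by (transfer; simp add: geq_def[of _ "_ :: nat \<Rightarrow> _"] unorm_zero algebra_simps)+
  show "x * y * z = x * (y * z)" "1 * x = x" "x * 1 = x" "(x + y) * z = x * z + y * z"
    "x * (y + z) = x * y + x * z"
    by (transfer; simp add: mult.assoc distrib_left distrib_right)+
  show "(0 :: 'a group_cstar) \<noteq> 1"
    by transfer (simp add: geq_def unorm_minus unorm_one LIMSEQ_const_iff)
  show "r *\<^sub>R (x + y) = r *\<^sub>R x + r *\<^sub>R y" "(r + q) *\<^sub>R x = r *\<^sub>R x + q *\<^sub>R x"
    "r *\<^sub>R q *\<^sub>R x = (r * q) *\<^sub>R x" "(r *\<^sub>R x) * y = r *\<^sub>R (x * y)"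
    "x * (r *\<^sub>R y) = r *\<^sub>R (x * y)"
    by (simp_all add: scaleR_group_cstar_def group_cstar_scaleC_add_right
        group_cstar_scaleC_add_left group_cstar_scaleC_scaleC group_cstar_mult_scaleC_left
        group_cstar_mult_scaleC_right)
  show "1 *\<^sub>R x = x"
    unfolding scaleR_group_cstar_def by transfer (simp add: gmap_one)
  show "norm (r *\<^sub>R x) = \<bar>r\<bar> * norm x"
    unfolding scaleR_group_cstar_def
    by transfer (auto simp: unorm_scale intro!: limI tendsto_mult_left gCauchy_convergent)
  show "norm (1 :: 'a group_cstar) = 1"
    by transfer (simp add: unorm_one)
  show "norm x = 0 \<longleftrightarrow> x = 0"
  proof transfer
    fix s :: "nat \<Rightarrow> ('a \<Rightarrow>\<^sub>0 complex)"
    assume "geq s s"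
    then have "(\<lambda>n. unorm (s n)) \<longlonglongrightarrow> lim (\<lambda>n. unorm (s n))"
      by (intro gCauchy_convergent) simp
    then show "lim (\<lambda>n. unorm (s n)) = 0 \<longleftrightarrow> geq s (\<lambda>_. 0)"
      using \<open>geq s s\<close> by (auto simp: geq_def intro: limI)
  qed
  show "norm (x + y) \<le> norm x + norm y"
  proof transfer
    fix s t :: "nat \<Rightarrow> ('a \<Rightarrow>\<^sub>0 complex)"
    assume "geq s s" "geq t t"
    then show "lim (\<lambda>n. unorm (s n + t n)) \<le> lim (\<lambda>n. unorm (s n)) + lim (\<lambda>n. unorm (t n))"
      by (intro LIMSEQ_le[OF gCauchy_convergent tendsto_add[OF gCauchy_convergent gCauchy_convergent]])
        (auto intro: unorm_add)
  qed
  show "norm (x * y) \<le> norm x * norm y"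
  proof transfer
    fix s t :: "nat \<Rightarrow> ('a \<Rightarrow>\<^sub>0 complex)"
    assume "geq s s" "geq t t"
    then show "lim (\<lambda>n. unorm (s n * t n)) \<le> lim (\<lambda>n. unorm (s n)) * lim (\<lambda>n. unorm (t n))"
      by (intro LIMSEQ_le[OF gCauchy_convergent tendsto_mult[OF gCauchy_convergent gCauchy_convergent]])
        (auto intro: unorm_mult)
  qed
  show "dist x y = norm (x - y)"
    by (rule dist_group_cstar_def)
  show "sgn x = inverse (norm x) *\<^sub>R x"
    by (simp add: sgn_group_cstar_def scaleR_group_cstar_def)
  show "(uniformity :: ('a group_cstar \<times> 'a group_cstar) filter) =
      (INF e\<in>{0<..}. principal {(x, y). dist x y < e})"
    by (rule uniformity_group_cstar_def)
  show "open U \<longleftrightarrow> (\<forall>x\<in>U. \<forall>\<^sub>F (x', y) in uniformity. x' = x \<longrightarrow> y \<in> U)"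
    for U :: "'a group_cstar set"
    by (rule open_group_cstar_def)
qed

end

lemma group_cstar_norm_scaleC:
  fixes x :: "'g::group_add group_cstar"
  shows "norm (c *\<^sub>C x) = cmod c * norm x"
  by transfer (auto simp: unorm_scale intro!: limI tendsto_mult_left gCauchy_convergent)

lemma group_cstar_triangle:
  fixes x y z :: "'g::group_add group_cstar"
  shows "norm (x - z) \<le> norm (x - y) + norm (y - z)"
  by (rule norm_diff_triangle_le[OF order_refl order_refl])

instance group_cstar :: (group_add) cstar_algebra_1
proof
  fix x y :: "'a group_cstar" and c d :: complex and r :: real
  show "c *\<^sub>C (x + y) = c *\<^sub>C x + c *\<^sub>C y" "(c + d) *\<^sub>C x = c *\<^sub>C x + d *\<^sub>C x"
    "c *\<^sub>C d *\<^sub>C x = (c * d) *\<^sub>C x" "(c *\<^sub>C x) * y = c *\<^sub>C (x * y)"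
    "x * (c *\<^sub>C y) = c *\<^sub>C (x * y)" "norm (c *\<^sub>C x) = cmod c * norm x"
    by (simp_all add: group_cstar_scaleC_add_right group_cstar_scaleC_add_left
        group_cstar_scaleC_scaleC group_cstar_mult_scaleC_left group_cstar_mult_scaleC_right
        group_cstar_norm_scaleC)
  show "complex_of_real r *\<^sub>C x = r *\<^sub>R x"
    by (simp add: scaleR_group_cstar_def)
  show "star (x + y) = star x + star y"
    by transfer (simp add: gstar_add)
  show "star (c *\<^sub>C x) = cnj c *\<^sub>C star x"
    by transfer (simp add: gstar_gmap)
  show "star (x * y) = star y * star x"
    by transfer (simp add: gstar_mult)
  show "star (star x) = x"
    by transfer (simp add: gstar_gstar)
  show "norm (star x * x) = (norm x)\<^sup>2"
    by transfer (auto simp: unorm_cstar intro!: limI tendsto_power gCauchy_convergent)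
next
  fix X :: "nat \<Rightarrow> 'a group_cstar"
  assume X: "Cauchy X"
  have embed: "norm (group_algebra_embed f - group_algebra_embed h) = unorm (f - h)"
    for f h :: "'a \<Rightarrow>\<^sub>0 complex"
    by (simp add: group_algebra_embed_def minus_group_cstar.abs_eq norm_group_cstar.abs_eq)
  have dense: "\<exists>f. norm (x - group_algebra_embed f) < e" if "e > 0" for x :: "'a group_cstar" and e
  proof -
    obtain s where s: "x = abs_group_cstar s" "geq s s"
      by (induction x rule: group_cstar.abs_induct) blast
    with that obtain N where N: "\<And>n. n \<ge> N \<Longrightarrow> unorm (s n - s N) < e / 2"
      unfolding geq_refl gCauchy_def by (meson half_gt_zero order_refl)
    have "lim (\<lambda>n. unorm (s n - s N)) \<le> e / 2"
      by (rule LIMSEQ_le_const2[OF gCauchy_convergent])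
        (use \<open>geq s s\<close> N in \<open>auto intro: less_imp_le\<close>)
    then have "norm (x - group_algebra_embed (s N)) < e"
      using \<open>e > 0\<close> s
      by (simp add: group_algebra_embed_def minus_group_cstar.abs_eq norm_group_cstar.abs_eq)
    then show ?thesis by blast
  qed
  have "\<exists>f. norm (X n - group_algebra_embed f) < inverse (real (Suc n))" for n
    by (rule dense) simp
  then obtain F where F: "\<And>n. norm (X n - group_algebra_embed (F n)) < inverse (real (Suc n))"
    by metis
  have small: "\<exists>N. \<forall>n\<ge>N. norm (X n - group_algebra_embed (F n)) < e" if "e > 0" for e
  proof -
    obtain N where N: "inverse (real (Suc N)) < e" using reals_Archimedean[OF \<open>e > 0\<close>] by blast
    have "norm (X n - group_algebra_embed (F n)) < e" if "n \<ge> N" for n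
    proof -
      have "inverse (real (Suc n)) \<le> inverse (real (Suc N))"
        using that by (intro le_imp_inverse_le) simp_all
      then show ?thesis using F[of n] N by linarith
    qed
    then show ?thesis by blast
  qed
  have "gCauchy F"
    unfolding gCauchy_def
  proof (intro allI impI)
    fix e :: real assume "e > 0"
    then have e: "e / 3 > 0" by simp
    obtain N1 where N1: "\<forall>n\<ge>N1. norm (X n - group_algebra_embed (F n)) < e / 3"
      using small[OF e] by blast
    obtain N2 where N2: "\<forall>m\<ge>N2. \<forall>n\<ge>N2. norm (X m - X n) < e / 3"
      using CauchyD[OF X e] by blast
    have "unorm (F m - F n) < e" if "m \<ge> max N1 N2" "n \<ge> max N1 N2" for m n
    proof -
      have "norm (X m - group_algebra_embed (F m)) < e / 3"
        "norm (X n - group_algebra_embed (F n)) < e / 3" "norm (X m - X n) < e / 3"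
        using N1 N2 that by simp_all
      then show ?thesis
        using group_cstar_triangle[of "group_algebra_embed (F m)" "group_algebra_embed (F n)" "X m"]
          group_cstar_triangle[of "X m" "group_algebra_embed (F n)" "X n"]
          norm_minus_commute[of "X m" "group_algebra_embed (F m)"]
        by (simp add: embed)
    qed
    then show "\<exists>N. \<forall>m\<ge>N. \<forall>n\<ge>N. unorm (F m - F n) < e" by blast
  qed
  define l where "l = abs_group_cstar F"
  have l: "norm (l - group_algebra_embed f) = lim (\<lambda>n. unorm (F n - f))" for f
    using \<open>gCauchy F\<close> by (simp add: l_def group_algebra_embed_def minus_group_cstar.abs_eq
        norm_group_cstar.abs_eq)
  have "\<exists>N. \<forall>n\<ge>N. dist (X n) l < e" if "e > 0" for e
  proof -
    from that have e: "e / 3 > 0" by simp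
    obtain N1 where N1: "\<forall>n\<ge>N1. norm (X n - group_algebra_embed (F n)) < e / 3"
      using small[OF e] by blast
    obtain N2 where N2: "\<forall>m\<ge>N2. \<forall>n\<ge>N2. unorm (F m - F n) < e / 3"
      using \<open>gCauchy F\<close> e unfolding gCauchy_def by blast
    have "dist (X n) l < e" if n: "n \<ge> max N1 N2" for n
    proof -
      have "lim (\<lambda>m. unorm (F m - F n)) \<le> e / 3"
        by (rule LIMSEQ_le_const2[OF gCauchy_convergent])
          (use \<open>gCauchy F\<close> N2 n in \<open>auto intro: less_imp_le\<close>)
      moreover have "norm (X n - group_algebra_embed (F n)) < e / 3"
        using N1 n by simp
      ultimately show ?thesis
        using group_cstar_triangle[of "X n" l "group_algebra_embed (F n)"]
          norm_minus_commute[of l "group_algebra_embed (F n)"] \<open>e > 0\<close>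
        by (simp add: dist_norm l)
    qed
    then show ?thesis by blast
  qed
  then have "X \<longlonglongrightarrow> l"
    by (intro metric_LIMSEQ_I) blast
  then show "convergent X"
    by (rule convergentI)
qed


definition cstar_delta :: "'g::group_add \<Rightarrow> 'g group_cstar" where
  "cstar_delta g = group_algebra_embed (Poly_Mapping.single g 1)"


section \<open>Algebraic dynamical systems\<close>

text \<open>The principal right ideal generated by \<open>p\<close> is \<open>range ((*) p)\<close>.\<close>

locale algebraic_dynamical_system =
  fixes \<theta> :: "'p::{monoid_mult, countable} \<Rightarrow> 'g::{group_add, countable} \<Rightarrow> 'g"
  assumes left_cancel: "(p :: 'p) * q = p * r \<Longrightarrow> q = r"
    and right_LCM: "range ((*) (p :: 'p)) \<inter> range ((*) q) = {} \<or>
      (\<exists>r. range ((*) p) \<inter> range ((*) q) = range ((*) r))"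
    and \<theta>_add: "\<theta> p (g + h) = \<theta> p g + \<theta> p h"
    and \<theta>_inj: "inj (\<theta> p)"
    and \<theta>_one: "\<theta> 1 = id"
    and \<theta>_mult: "\<theta> (p * q) = \<theta> p \<circ> \<theta> q"
    and \<theta>_LCM: "range ((*) p) \<inter> range ((*) q) = range ((*) r) \<Longrightarrow>
      range (\<theta> p) \<inter> range (\<theta> q) = range (\<theta> r)"

definition unital_star_hom :: "('a::cstar_algebra_1 \<Rightarrow> 'b::cstar_algebra_1) \<Rightarrow> bool" where
  "unital_star_hom f \<longleftrightarrow>
     (\<forall>x y. f (x + y) = f x + f y) \<and> (\<forall>c x. f (c *\<^sub>C x) = c *\<^sub>C f x) \<and>
     (\<forall>x y. f (x * y) = f x * f y) \<and> (\<forall>x. f (star x) = star (f x)) \<and> f 1 = 1"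

definition unital_positive_linear :: "('a::cstar_algebra_1 \<Rightarrow> 'b::cstar_algebra_1) \<Rightarrow> bool" where
  "unital_positive_linear f \<longleftrightarrow>
     (\<forall>x y. f (x + y) = f x + f y) \<and> (\<forall>c x. f (c *\<^sub>C x) = c *\<^sub>C f x) \<and>
     (\<forall>x. cpos x \<longrightarrow> cpos (f x)) \<and> f 1 = 1"

text \<open>Both maps are unique, as $*$-homomorphisms and positive maps are automatically continuous.\<close>

definition ads_\<alpha> ::
    "('p \<Rightarrow> 'g::group_add \<Rightarrow> 'g) \<Rightarrow> 'p \<Rightarrow> 'g group_cstar \<Rightarrow> 'g group_cstar" where
  "ads_\<alpha> \<theta> p = (THE f. unital_star_hom f \<and> inj f \<and> (\<forall>g. f (cstar_delta g) = cstar_delta (\<theta> p g)))"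

definition ads_L ::
    "('p \<Rightarrow> 'g::group_add \<Rightarrow> 'g) \<Rightarrow> 'p \<Rightarrow> 'g group_cstar \<Rightarrow> 'g group_cstar" where
  "ads_L \<theta> p = (THE f. unital_positive_linear f \<and>
     (\<forall>g. f (cstar_delta g) = (if g \<in> range (\<theta> p) then cstar_delta (inv (\<theta> p) g) else 0)))"

definition ads_premodule ::
    "('p \<Rightarrow> 'g::group_add \<Rightarrow> 'g) \<Rightarrow> 'p \<Rightarrow> ('g group_cstar, 'g group_cstar) hbimod" where
  "ads_premodule \<theta> p =
     \<lparr>hcarr = UNIV, hzero = 0, hadd = (+), hscale = (*\<^sub>C),
      hract = (\<lambda>a b. a * ads_\<alpha> \<theta> p b),
      hinn = (\<lambda>a b. ads_L \<theta> p (star a * b)),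
      hlact = (*)\<rparr>"

definition ads_module ::
    "('p \<Rightarrow> 'g::group_add \<Rightarrow> 'g) \<Rightarrow> 'p \<Rightarrow> ('g group_cstar, (nat \<Rightarrow> 'g group_cstar) set) hbimod"
  where
  "ads_module \<theta> p = hcompletion (ads_premodule \<theta> p)"

definition ads_\<pi> ::
    "('p \<Rightarrow> 'g::group_add \<Rightarrow> 'g) \<Rightarrow> 'p \<Rightarrow> 'g group_cstar \<Rightarrow> (nat \<Rightarrow> 'g group_cstar) set" where
  "ads_\<pi> \<theta> p = hembed (ads_premodule \<theta> p)"

end

theory Submission
  imports Defs
begin



text \<open>
  The product of \<open>x \<in> M\<^sub>p\<close> and \<open>y \<in> M\<^sub>q\<close> is induced by \<open>(a, b) \<mapsto> a \<alpha>\<^sub>p(b)\<close> on the algebra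
  \<open>A = C\<^sup>*(G)\<close>. Everything rests on one identity (\<open>pre_mult_inn\<close>),
  \<open>\<langle>a \<alpha>\<^sub>p(b), a' \<alpha>\<^sub>p(b')\<rangle>\<^sub>p\<^sub>q = L\<^sub>q(L\<^sub>p(\<alpha>\<^sub>p(b\<^sup>*) a\<^sup>* a' \<alpha>\<^sub>p(b'))) = \<langle>b, \<langle>a, a'\<rangle>\<^sub>p b'\<rangle>\<^sub>q\<close>,
  in which \<open>L\<^sub>p\<^sub>q = L\<^sub>q L\<^sub>p\<close> and the transfer property \<open>L\<^sub>p(x \<alpha>\<^sub>p(b)) = L\<^sub>p(x) b\<close> are used. Its right-hand
  side is the inner product of elementary tensors, so \<open>x \<otimes> y \<mapsto> x y\<close> is isometric; its range is dense because
  \<open>a = a \<alpha>\<^sub>p(1)\<close>, and an isometry with dense range extends to an isomorphism of the completions.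
  Associativity and the module laws hold on \<open>A\<close> and pass to classes of Cauchy sequences. The
  multiplication is unique because the classes of group elements span a dense subspace of every fibre.

  Most of the work is to have \<open>L\<^sub>p\<close>, \<open>\<alpha>\<^sub>p\<close> and the completions at all. Positivity is
  handled through positive functionals: an element is of the form \<open>b\<^sup>* b\<close> iff every positive functional is
  nonnegative on it (\<open>cpos_iff\<close>). This makes the positive elements a closed cone and yields the
  Cauchy-Schwarz inequality, hence completions of semi-inner product modules
  (\<open>comp_hilbert_bimodule\<close>).

  For \<open>L\<^sub>p\<close> the cosets of \<open>\<theta>\<^sub>p(G)\<close> decompose \<open>L\<^sub>p(f\<^sup>* f)\<close> into a sum of squares, one of which is
  \<open>L\<^sub>p(f)\<^sup>* L\<^sub>p(f)\<close> (\<open>tr_schwarz\<close>). A unital map on the group algebra with this Schwarz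
  inequality is contractive for the universal norm (\<open>schwarz_contractive\<close>): composed with a positive functional
  it is a positive functional on the group algebra, whose GNS representation is among those
  that define the norm. Contractive maps extend to \<open>A\<close>, and two bounded linear maps that agree on group
  elements are equal, from which the algebraic identities for \<open>L\<^sub>p\<close> and \<open>\<alpha>\<^sub>p\<close> follow.
\<close>

section \<open>Positivity in C*-algebras\<close>

subclass (in cstar_algebra_1) banach ..

context
  fixes x :: "'a::cstar_algebra_1"
begin

lemma scaleC_1 [simp]: "1 *\<^sub>C x = x"
  using scaleC_of_real[of 1 x] by simp

lemma scaleC_zero_left [simp]: "0 *\<^sub>C x = 0"
  using scaleC_of_real[of 0 x] by simp

lemma scaleC_minus_one: "(-1) *\<^sub>C x = - x"
  using scaleC_of_real[of "-1" x] by simp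

end

lemma scaleC_zero_right [simp]: "c *\<^sub>C (0::'a::cstar_algebra_1) = 0"
  using scaleC_add_right[of c "0::'a" 0] by simp

lemma scaleC_sum_right: "c *\<^sub>C sum f A = (\<Sum>i\<in>A. c *\<^sub>C (f i :: 'a::cstar_algebra_1))"
  by (induction A rule: infinite_finite_induct) (simp_all add: scaleC_add_right)

lemma bounded_linear_scaleC: "bounded_linear ((*\<^sub>C) c :: 'a::cstar_algebra_1 \<Rightarrow> 'a)"
  by (rule bounded_linear_intro[where K = "cmod c"])
    (simp_all add: scaleC_add_right norm_scaleC scaleC_scaleC mult.commute flip: scaleC_of_real)

lemma star_zero [simp]: "star (0::'a::cstar_algebra_1) = 0"
  using star_add[of "0::'a" 0] by simp

lemma star_minus: "star (- x) = - star (x::'a::cstar_algebra_1)"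
  using star_add[of x "- x"] by (simp add: eq_neg_iff_add_eq_0 add.commute)

lemma star_diff: "star (x - y) = star x - star (y::'a::cstar_algebra_1)"
  using star_add[of x "- y"] by (simp add: star_minus)

lemma star_one [simp]: "star (1::'a::cstar_algebra_1) = 1"
  by (metis mult.right_neutral star_mult star_star)

lemma star_scaleR: "star (r *\<^sub>R x) = r *\<^sub>R star (x::'a::cstar_algebra_1)"
  using star_scaleC[of "complex_of_real r" x] by (simp add: scaleC_of_real)

lemma star_sum: "star (sum f A) = (\<Sum>i\<in>A. star (f i :: 'a::cstar_algebra_1))"
  by (induction A rule: infinite_finite_induct) (simp_all add: star_add)

lemma star_power: "star (x ^ n) = star (x::'a::cstar_algebra_1) ^ n"
  by (induction n) (simp_all add: star_mult power_commutes)

lemma norm_star [simp]: "norm (star x) = norm (x::'a::cstar_algebra_1)"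
proof -
  have *: "norm y \<le> norm (star y)" for y :: 'a
  proof (cases "y = 0")
    case False
    have "norm y * norm y \<le> norm (star y) * norm y"
      using cstar_identity[of y] norm_mult_ineq[of "star y" y] by (simp add: power2_eq_square)
    then show ?thesis using False by simp
  qed simp
  show ?thesis using *[of x] *[of "star x"] by (simp add: star_star)
qed

lemma bounded_linear_star: "bounded_linear (star :: 'a::cstar_algebra_1 \<Rightarrow> 'a)"
  by (rule bounded_linear_intro[where K = 1]) (simp_all add: star_add star_scaleR)

text \<open>The Taylor coefficients of \<open>sqrt (1 - t)\<close>.\<close>

definition sqrt_coeff :: "nat \<Rightarrow> real" where
  "sqrt_coeff n = (1/2 gchoose n) * (-1) ^ n"

lemma sqrt_coeff_0: "sqrt_coeff 0 = 1"
  by (simp add: sqrt_coeff_def)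

lemma sqrt_coeff_Suc: "sqrt_coeff (Suc n) = sqrt_coeff n * (real n - 1/2) / (real n + 1)"
proof -
  have "(1/2 gchoose Suc n) * (real n + 1) = (1/2 - real n) * (1/2 gchoose n :: real)"
    using gbinomial_mult_1[of "1/2::real" n] by (simp add: algebra_simps)
  then have *: "(1/2 gchoose Suc n :: real) = (1/2 - real n) * (1/2 gchoose n) / (real n + 1)"
    by (simp add: field_simps)
  show ?thesis unfolding sqrt_coeff_def * by (simp add: algebra_simps)
qed

lemma sqrt_coeff_nonpos: "sqrt_coeff (Suc n) \<le> 0"
proof (induction n)
  case 0
  then show ?case by (simp add: sqrt_coeff_Suc sqrt_coeff_0)
next
  case (Suc n)
  have "sqrt_coeff (Suc n) * (real (Suc n) - 1/2) \<le> 0"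
    using Suc by (intro mult_nonpos_nonneg) auto
  then show ?case
    using sqrt_coeff_Suc[of "Suc n"] by (simp add: divide_nonpos_pos)
qed

lemma sqrt_coeff_sums: "\<bar>r\<bar> < 1 \<Longrightarrow> (\<lambda>n. sqrt_coeff n * r ^ n) sums sqrt (1 - r)"
  using gen_binomial_real[of "- r" "1/2"]
  by (simp add: sqrt_coeff_def powr_half_sqrt power_minus[of r] mult.assoc)

text \<open>All coefficients but the first have the same sign, so that their partial sums
  are bounded by the value of the series as its argument increases to 1; this gives absolute
  convergence on the boundary of the disc of convergence.\<close>

lemma sqrt_coeff_abs_summable: "summable (\<lambda>n. \<bar>sqrt_coeff n\<bar>)"
proof -
  have partial: "(\<Sum>n<N. \<bar>sqrt_coeff (Suc n)\<bar> * r ^ Suc n) \<le> 1" if r: "0 < r" "r < 1" for N and r :: real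
  proof -
    have "(\<lambda>n. sqrt_coeff (Suc n) * r ^ Suc n) sums (sqrt (1 - r) - 1)"
      using sqrt_coeff_sums[of r] r by (subst sums_Suc_iff) (simp add: sqrt_coeff_0)
    then have "(\<lambda>n. - (sqrt_coeff (Suc n) * r ^ Suc n)) sums - (sqrt (1 - r) - 1)"
      by (rule sums_minus)
    moreover have "- (sqrt_coeff (Suc n) * r ^ Suc n) = \<bar>sqrt_coeff (Suc n)\<bar> * r ^ Suc n" for n
      using sqrt_coeff_nonpos[of n] by simp
    ultimately have s: "(\<lambda>n. \<bar>sqrt_coeff (Suc n)\<bar> * r ^ Suc n) sums (1 - sqrt (1 - r))"
      by simp
    have "(\<Sum>n<N. \<bar>sqrt_coeff (Suc n)\<bar> * r ^ Suc n) \<le> suminf (\<lambda>n. \<bar>sqrt_coeff (Suc n)\<bar> * r ^ Suc n)"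
      using s r by (intro sum_le_suminf) (auto simp: sums_iff)
    also have "\<dots> \<le> 1" using s r by (simp add: sums_iff)
    finally show ?thesis .
  qed
  have le: "(\<Sum>n<N. \<bar>sqrt_coeff (Suc n)\<bar> * (1 - inverse (real (Suc (Suc k)))) ^ Suc n) \<le> 1" for N k
    using inverse_less_1_iff[of "real (Suc (Suc k))"]
    by (intro partial) (simp_all add: field_simps)
  have lim: "(\<lambda>k. \<Sum>n<N. \<bar>sqrt_coeff (Suc n)\<bar> * (1 - inverse (real (Suc (Suc k)))) ^ Suc n)
      \<longlonglongrightarrow> (\<Sum>n<N. \<bar>sqrt_coeff (Suc n)\<bar> * (1 - 0) ^ Suc n)" for N
    by (intro tendsto_intros LIMSEQ_Suc[OF LIMSEQ_inverse_real_of_nat])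
  have "(\<Sum>n<N. \<bar>sqrt_coeff (Suc n)\<bar>) \<le> 1" for N
    using LIMSEQ_le_const2[OF lim] le by simp
  then have "summable (\<lambda>n. \<bar>sqrt_coeff (Suc n)\<bar>)"
    by (intro bounded_imp_summable[of _ 1]) (auto simp del: sum.lessThan_Suc simp flip: lessThan_Suc_atMost)
  then show ?thesis by (subst (asm) summable_Suc_iff)
qed

lemma sqrt_coeff_conv:
  "(\<Sum>i\<le>n. sqrt_coeff i * sqrt_coeff (n - i)) = (if n = 0 then 1 else if n = 1 then -1 else 0)"
proof -
  have "(\<Sum>i\<le>n. sqrt_coeff i * sqrt_coeff (n - i)) =
      (\<Sum>i\<le>n. (1/2 gchoose i) * (1/2 gchoose (n - i)) * (-1) ^ n)"
    by (intro sum.cong) (auto simp: sqrt_coeff_def simp flip: power_add)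
  also have "\<dots> = (real 1 gchoose n) * (-1) ^ n"
    using gbinomial_Vandermonde[of "1/2::real" "1/2" n]
    by (simp add: atLeast0AtMost flip: sum_distrib_right)
  also have "(real 1 gchoose n) = real (1 choose n)"
    by (rule binomial_gbinomial[symmetric])
  finally show ?thesis
    by (cases n rule: nat.exhaust; cases "n - 1") auto
qed

text \<open>Absolute summability of the coefficients lets the power series of the square root converge on the
  whole closed unit ball, and its Cauchy square collapses to \<open>1 - x\<close>.\<close>

lemma cpos_one_minus:
  fixes x :: "'a::cstar_algebra_1"
  assumes sa: "star x = x" and x: "norm x \<le> 1"
  shows "cpos (1 - x)"
proof -
  define a where "a n = sqrt_coeff n *\<^sub>R x ^ n" for n
  define b where "b = suminf a"
  have "norm (x ^ n) \<le> 1" for n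
    using norm_power_ineq[of x n] power_le_one[OF norm_ge_zero x, of n] by linarith
  then have "norm (a n) \<le> \<bar>sqrt_coeff n\<bar>" for n
    by (simp add: a_def mult_left_le)
  then have s: "summable (\<lambda>n. norm (a n))"
    by (intro summable_comparison_test'[OF sqrt_coeff_abs_summable, of 0]) simp
  then have "summable a" by (rule summable_norm_cancel)
  then have "star b = suminf (\<lambda>n. star (a n))"
    unfolding b_def by (rule bounded_linear.suminf[OF bounded_linear_star])
  then have star_b: "star b = b"
    by (simp add: a_def[abs_def] star_scaleR star_power sa b_def)
  have "(\<Sum>i\<le>n. a i * a (n - i)) = (\<Sum>i\<le>n. (sqrt_coeff i * sqrt_coeff (n - i)) *\<^sub>R x ^ n)" for n
    by (intro sum.cong) (auto simp: a_def simp flip: power_add)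
  then have "(\<Sum>i\<le>n. a i * a (n - i)) = (if n = 0 then 1 else if n = 1 then - x else 0)" for n
    by (simp add: sqrt_coeff_conv flip: scaleR_sum_left)
  then have "(\<lambda>n. if n = 0 then 1 else if n = 1 then - x else 0) sums (b * b)"
    using Cauchy_product_sums[OF s s] by (simp add: b_def)
  moreover have "(\<lambda>n::nat. if n = 0 then 1 else if n = 1 then - x else 0) sums (\<Sum>n\<in>{0,1::nat}. if n = 0 then 1 else if n = 1 then - x else 0)"
    by (rule sums_finite) (auto split: if_splits)
  ultimately have "b * b = 1 - x"
    using sums_unique2 by fastforce
  then have "1 - x = star b * b" by (simp add: star_b)
  then show ?thesis unfolding cpos_def by (rule exI)
qed


subsection \<open>Positive functionals\<close>

definition (in cstar_algebra_1) positive_functional :: "('a \<Rightarrow> complex) \<Rightarrow> bool" where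
  "positive_functional \<phi> \<longleftrightarrow> (\<forall>x y. \<phi> (x + y) = \<phi> x + \<phi> y) \<and> (\<forall>c x. \<phi> (c *\<^sub>C x) = c * \<phi> x) \<and>
     (\<forall>x. \<phi> (star x * x) \<in> \<real>\<^sub>\<ge>\<^sub>0)"

lemma positive_functional_of_conj:
  assumes "positive_functional \<phi>"
  shows "positive_functional (\<lambda>x. \<phi> (star b * x * b))"
  unfolding positive_functional_def
proof (intro conjI allI)
  fix x
  have "star b * (star x * x) * b = star (x * b) * (x * b)"
    by (simp add: star_mult mult.assoc)
  then show "\<phi> (star b * (star x * x) * b) \<in> \<real>\<^sub>\<ge>\<^sub>0"
    using assms by (simp add: positive_functional_def)
qed (use assms in \<open>simp_all add: positive_functional_def distrib_left distrib_right
      mult_scaleC_left mult_scaleC_right\<close>)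

context
  fixes \<phi> :: "'a::cstar_algebra_1 \<Rightarrow> complex"
  assumes pf: "positive_functional \<phi>"
begin

lemma pf_add: "\<phi> (x + y) = \<phi> x + \<phi> y"
  using pf by (simp add: positive_functional_def)

lemma pf_scale: "\<phi> (c *\<^sub>C x) = c * \<phi> x"
  using pf by (simp add: positive_functional_def)

lemma pf_scaleR: "\<phi> (r *\<^sub>R x) = complex_of_real r * \<phi> x"
  using pf_scale[of "complex_of_real r" x] by (simp add: scaleC_of_real)

lemma pf_zero: "\<phi> 0 = 0"
  using pf_scale[of 0 0] by simp

lemma pf_minus: "\<phi> (- x) = - \<phi> x"
  using pf_scale[of "-1" x] by (simp add: scaleC_minus_one)

lemma pf_diff: "\<phi> (x - y) = \<phi> x - \<phi> y"
  using pf_add[of x "- y"] by (simp add: pf_minus)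

lemma pf_cpos: "cpos x \<Longrightarrow> \<phi> x \<in> \<real>\<^sub>\<ge>\<^sub>0"
  using pf unfolding positive_functional_def cpos_def by blast

lemma pf_one: "\<phi> 1 \<in> \<real>\<^sub>\<ge>\<^sub>0"
  by (rule pf_cpos) (auto simp: cpos_def intro!: exI[of _ 1])

text \<open>After scaling to norm at most 1 the element \<open>1 - x\<close> is of the form \<open>b\<^sup>* b\<close>, on which \<open>\<phi>\<close> is nonnegative.\<close>

lemma pf_le_norm:
  assumes "star x = x" "norm x \<le> B"
  shows "Re (\<phi> x) \<le> B * Re (\<phi> 1)" "- (B * Re (\<phi> 1)) \<le> Re (\<phi> x)" "Im (\<phi> x) = 0"
proof -
  have *: "Re (\<phi> y) \<le> B * Re (\<phi> 1) \<and> Im (\<phi> y) = 0" if y: "star y = y" "norm y \<le> B" for y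
  proof (cases "B = 0")
    case True
    then show ?thesis using y pf_zero by simp
  next
    case False
    then have B: "B > 0" using y norm_ge_zero[of y] by linarith
    have "cpos (1 - (1 / B) *\<^sub>R y)"
      using y B by (intro cpos_one_minus) (simp_all add: star_scaleR field_simps)
    from pf_cpos[OF this] have "Re (\<phi> y) \<le> B * Re (\<phi> 1)" "Im (\<phi> y) = 0"
      using B pf_one by (simp_all add: pf_diff pf_scaleR complex_nonneg_Reals_iff field_simps)
    then show ?thesis by simp
  qed
  show "Re (\<phi> x) \<le> B * Re (\<phi> 1)" "Im (\<phi> x) = 0" using *[OF assms] by auto
  show "- (B * Re (\<phi> 1)) \<le> Re (\<phi> x)"
    using *[of "- x"] assms by (simp add: star_minus pf_minus)
qed

end

text \<open>That positive functionals determine the norm is a theorem about every C*-algebra, related to that of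
  Gelfand and Naimark. As the axiom of a class it is verified for the two algebras that occur below: the
  complex numbers, where it is trivial, and the full group C*-algebra, whose norm is by definition a
  supremum over representations.\<close>

class cstar_states = cstar_algebra_1 +
  assumes norm_le_by_states: "0 \<le> B \<Longrightarrow>
    (\<And>\<phi>. positive_functional \<phi> \<Longrightarrow> Re (\<phi> (star a * a)) \<le> B * Re (\<phi> 1)) \<Longrightarrow> (norm a)\<^sup>2 \<le> B"

instance complex :: cstar_states
proof
  fix B :: real and a :: complex
  assume *: "\<And>\<phi> :: complex \<Rightarrow> complex. positive_functional \<phi> \<Longrightarrow> Re (\<phi> (star a * a)) \<le> B * Re (\<phi> 1)"
  have "positive_functional (\<lambda>z::complex. z)"
    by (auto simp: positive_functional_def star_complex_def scaleC_complex_def complex_nonneg_Reals_iff)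
  from *[OF this] show "(norm a)\<^sup>2 \<le> B"
    by (simp add: star_complex_def cmod_power2 flip: power2_eq_square)
qed

text \<open>For self-adjoint elements the norm is the numerical radius. As the functional
  \<open>\<phi>(b\<^sup>* _ b)\<close> is again positive, the hypothesis bounds \<open>\<phi>((1 \<plusminus> t h) h (1 \<plusminus> t h))\<close> by \<open>B \<phi>((1 \<plusminus> t h)\<^sup>2)\<close>;
  subtracting the two expansions gives \<open>4 t \<phi>(h\<^sup>2) \<le> B (2 \<phi>(1) + 2 t\<^sup>2 \<phi>(h\<^sup>2))\<close>, and \<open>t = 1/B\<close> is the best choice.\<close>

lemma norm_le_numerical_radius:
  fixes h :: "'a::cstar_states"
  assumes h: "star h = h"
    and le: "\<And>\<phi>. positive_functional \<phi> \<Longrightarrow> \<bar>Re (\<phi> h)\<bar> \<le> B * Re (\<phi> 1)" and B: "B > 0"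
  shows "norm h \<le> B"
proof -
  have "Re (\<phi> (star h * h)) \<le> B\<^sup>2 * Re (\<phi> 1)" if pf: "positive_functional \<phi>" for \<phi>
  proof -
    define k where "k = (1 / B) *\<^sub>R h"
    have k: "star k = k" by (simp add: k_def star_scaleR h)
    have hk: "h * k = k * h"
      by (simp add: k_def)
    note lin = pf_add[OF pf] pf_diff[OF pf]
    have "\<bar>Re (\<phi> (star (1 + k) * h * (1 + k)))\<bar> \<le> B * Re (\<phi> (star (1 + k) * 1 * (1 + k)))"
      by (rule le[OF positive_functional_of_conj[OF pf]])
    moreover have "\<bar>Re (\<phi> (star (1 - k) * h * (1 - k)))\<bar> \<le> B * Re (\<phi> (star (1 - k) * 1 * (1 - k)))"
      by (rule le[OF positive_functional_of_conj[OF pf]])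
    ultimately have "4 * Re (\<phi> (h * k)) \<le> B * (2 * Re (\<phi> 1) + 2 * Re (\<phi> (k * k)))"
      by (simp add: star_add star_diff k algebra_simps lin hk)
    moreover have "\<phi> (h * k) = complex_of_real (1 / B) * \<phi> (h * h)"
      "\<phi> (k * k) = complex_of_real (1 / B^2) * \<phi> (h * h)"
      by (simp_all add: k_def pf_scaleR[OF pf] power2_eq_square)
    ultimately have "4 * (Re (\<phi> (h * h)) / B) \<le> B * (2 * Re (\<phi> 1) + 2 * (Re (\<phi> (h * h)) / B\<^sup>2))"
      by (simp add: Re_divide_of_real flip: of_real_power)
    then show ?thesis
      using B by (simp add: h field_simps power2_eq_square)
  qed
  then have "(norm h)\<^sup>2 \<le> B\<^sup>2"
    using B by (intro norm_le_by_states) auto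
  then show ?thesis by (rule power2_le_imp_le) (use B in simp)
qed

lemma eq_zero_by_states:
  fixes h :: "'a::cstar_states"
  assumes "star h = h" "\<And>\<phi>. positive_functional \<phi> \<Longrightarrow> Re (\<phi> h) = 0"
  shows "h = 0"
proof -
  have "norm h \<le> e" if "e > 0" for e
  proof (rule norm_le_numerical_radius[OF assms(1) _ that])
    fix \<phi> :: "'a \<Rightarrow> complex" assume "positive_functional \<phi>"
    then show "\<bar>Re (\<phi> h)\<bar> \<le> e * Re (\<phi> 1)"
      using assms(2) pf_one[of \<phi>] that by (simp add: complex_nonneg_Reals_iff)
  qed
  \<comment> \<open>The bound by the numerical radius is available for positive radii only.\<close>
  then have "norm h \<le> 0" using field_le_epsilon[of "norm h" 0] by simp
  then show ?thesis by simp
qed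

lemma pf_star_cnj:
  fixes \<phi> :: "'a::cstar_algebra_1 \<Rightarrow> complex"
  assumes pf: "positive_functional \<phi>"
  shows "\<phi> (star x) = cnj (\<phi> x)"
proof -
  \<comment> \<open>applied to \<open>x\<close> and to \<open>\<i> x\<close>\<close>
  have "Im (\<phi> (y + star y)) = 0" for y
    by (rule pf_le_norm(3)[OF pf _ order_refl]) (simp add: star_add star_star add.commute)
  from this[of x] this[of "\<i> *\<^sub>C x"] show ?thesis
    by (simp add: pf_add[OF pf] pf_scale[OF pf] star_scaleC complex_eq_iff)
qed

text \<open>If the functionals are nonnegative on \<open>a\<close> and \<open>N \<ge> \<parallel>a\<parallel>\<close>, then the numerical radius of \<open>h = 1 - a/N\<close> is at
  most 1. So is its norm, and \<open>1 - h\<close> has a square root. In this form positivity is visibly a closed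
  condition that is stable under sums.\<close>

lemma cpos_iff:
  fixes a :: "'a::cstar_states"
  shows "cpos a \<longleftrightarrow> (\<forall>\<phi>. positive_functional \<phi> \<longrightarrow> \<phi> a \<in> \<real>\<^sub>\<ge>\<^sub>0)"
proof
  assume pos: "\<forall>\<phi>. positive_functional \<phi> \<longrightarrow> \<phi> a \<in> \<real>\<^sub>\<ge>\<^sub>0"
  \<comment> \<open>The functionals are real on \<open>a\<close>, hence vanish on the self-adjoint element \<open>\<i> (a - a\<^sup>*)\<close>.\<close>
  have "\<i> *\<^sub>C a + star (\<i> *\<^sub>C a) = 0"
  proof (rule eq_zero_by_states)
    show "Re (\<phi> (\<i> *\<^sub>C a + star (\<i> *\<^sub>C a))) = 0" if "positive_functional \<phi>" for \<phi>
      using pos[rule_format, OF that]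
      by (simp add: pf_scale[OF that] pf_add[OF that] pf_star_cnj[OF that] complex_nonneg_Reals_iff)
  qed (simp add: star_add star_star add.commute)
  then have "(- \<i>) *\<^sub>C (\<i> *\<^sub>C a + (- \<i>) *\<^sub>C star a) = 0"
    by (simp add: star_scaleC)
  then have "a - star a = 0"
    by (simp add: scaleC_add_right scaleC_scaleC scaleC_minus_one)
  then have sa: "star a = a" by simp
  define N where "N = norm a + 1"
  have N: "N > 0" "norm a \<le> N" by (simp_all add: N_def add_nonneg_pos)
  define h where "h = 1 - (1 / N) *\<^sub>R a"
  have h: "star h = h" by (simp add: h_def star_diff star_scaleR sa)
  have "norm h \<le> 1"
  proof (rule norm_le_numerical_radius[OF h])
    fix \<phi> :: "'a \<Rightarrow> complex" assume pf: "positive_functional \<phi>"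
    have "0 \<le> Re (\<phi> a)" "Re (\<phi> a) \<le> N * Re (\<phi> 1)" "0 \<le> Re (\<phi> 1)"
      using pos[rule_format, OF pf] pf_le_norm(1)[OF pf sa N(2)] pf_one[OF pf]
      by (simp_all add: complex_nonneg_Reals_iff)
    then have "0 \<le> Re (\<phi> a) / N" "Re (\<phi> a) / N \<le> Re (\<phi> 1)"
      using N by (auto simp: field_simps)
    moreover have "Re (\<phi> h) = Re (\<phi> 1) - Re (\<phi> a) / N"
      by (simp add: h_def pf_diff[OF pf] pf_scaleR[OF pf])
    ultimately show "\<bar>Re (\<phi> h)\<bar> \<le> 1 * Re (\<phi> 1)" by simp
  qed simp
  then have "cpos (1 - h)" by (rule cpos_one_minus[OF h])
  then obtain b where "(1 / N) *\<^sub>R a = star b * b" by (auto simp: h_def cpos_def)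
  then have "N *\<^sub>R (1 / N) *\<^sub>R a = N *\<^sub>R (star b * b)" by (rule arg_cong)
  then have "a = star (sqrt N *\<^sub>R b) * (sqrt N *\<^sub>R b)"
    using N by (simp add: star_scaleR)
  then show "cpos a" unfolding cpos_def by blast
next
  assume a: "cpos a"
  show "\<forall>\<phi>. positive_functional \<phi> \<longrightarrow> \<phi> a \<in> \<real>\<^sub>\<ge>\<^sub>0"
  proof (intro allI impI)
    fix \<phi> :: "'a \<Rightarrow> complex" assume pf: "positive_functional \<phi>"
    show "\<phi> a \<in> \<real>\<^sub>\<ge>\<^sub>0" by (rule pf_cpos[OF pf a])
  qed
qed

lemma cpos_star_mult [simp]: "cpos (star b * b)"
  unfolding cpos_def by (rule exI) (rule refl)

lemma cpos_zero [simp]: "cpos (0::'a::cstar_algebra_1)"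
  unfolding cpos_def by (rule exI[of _ 0]) simp

lemma cpos_selfadjoint: "cpos a \<Longrightarrow> star a = (a::'a::cstar_algebra_1)"
  unfolding cpos_def by (elim exE) (simp add: star_mult star_star)

lemma cpos_add:
  fixes a b :: "'a::cstar_states"
  assumes "cpos a" "cpos b"
  shows "cpos (a + b)"
  unfolding cpos_iff
proof (intro allI impI)
  fix \<phi> :: "'a \<Rightarrow> complex" assume pf: "positive_functional \<phi>"
  show "\<phi> (a + b) \<in> \<real>\<^sub>\<ge>\<^sub>0"
    unfolding pf_add[OF pf] by (intro nonneg_Reals_add_I pf_cpos[OF pf] assms)
qed

lemma cpos_sum: "(\<And>i. i \<in> A \<Longrightarrow> cpos (f i :: 'a::cstar_states)) \<Longrightarrow> cpos (sum f A)"
proof (induction A rule: infinite_finite_induct)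
  case (insert x F)
  have "cpos (f x + sum f F)"
    by (rule cpos_add) (use insert in simp_all)
  then show ?case using insert by simp
qed simp_all

lemma cpos_scaleR:
  assumes "cpos a" "r \<ge> 0"
  shows "cpos (r *\<^sub>R a :: 'a::cstar_algebra_1)"
proof -
  obtain b where "a = star b * b" using assms(1) unfolding cpos_def by blast
  then have "r *\<^sub>R a = star (sqrt r *\<^sub>R b) * (sqrt r *\<^sub>R b)"
    using assms(2) by (simp add: star_scaleR)
  then show ?thesis unfolding cpos_def by blast
qed

lemma cpos_conj: "cpos a \<Longrightarrow> cpos (star b * a * b :: 'a::cstar_algebra_1)"
  unfolding cpos_def
proof (elim exE)
  fix c assume "a = star c * c"
  then have "star b * a * b = star (c * b) * (c * b)" by (simp add: star_mult mult.assoc)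
  then show "\<exists>d. star b * a * b = star d * d" by (rule exI)
qed

lemma cpos_norm_minus: 
  fixes a :: "'a::cstar_states"
  assumes "star a = a" "norm a \<le> B"
  shows "cpos (B *\<^sub>R 1 - a)" "cpos (B *\<^sub>R 1 + a)"
proof -
  have *: "cpos (B *\<^sub>R 1 - a)" if a: "star a = a" "norm a \<le> B" for a :: 'a
    unfolding cpos_iff
  proof (intro allI impI)
    fix \<phi> :: "'a \<Rightarrow> complex" assume pf: "positive_functional \<phi>"
    then show "\<phi> (B *\<^sub>R 1 - a) \<in> \<real>\<^sub>\<ge>\<^sub>0"
      using pf_le_norm[OF pf a] pf_one[OF pf]
      by (simp add: pf_diff[OF pf] pf_scaleR[OF pf] complex_nonneg_Reals_iff)
  qed
  show "cpos (B *\<^sub>R 1 - a)" "cpos (B *\<^sub>R 1 + a)"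
    using *[OF assms] *[of "- a"] assms by (simp_all add: star_minus)
qed

lemma cpos_norm_sq_minus:
  fixes a :: "'a::cstar_states"
  shows "cpos ((norm a)\<^sup>2 *\<^sub>R 1 - star a * a)"
  by (rule cpos_norm_minus) (simp_all add: star_mult star_star cstar_identity)

text \<open>On positive elements the norm is the numerical radius, which is monotone.\<close>

lemma cpos_norm_mono:
  fixes a b :: "'a::cstar_states"
  assumes a: "cpos a" and ab: "cpos (b - a)"
  shows "norm a \<le> norm b"
proof -
  have sb: "star b = b"
    using cpos_selfadjoint[OF a] cpos_selfadjoint[OF ab] by (simp add: star_diff)
  have "norm a \<le> norm b + e" if "e > 0" for e
  proof (rule norm_le_numerical_radius[OF cpos_selfadjoint[OF a]])
    fix \<phi> :: "'a \<Rightarrow> complex" assume pf: "positive_functional \<phi>"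
    have "norm b \<le> norm b + e" using that by simp
    from pf_le_norm(1)[OF pf sb this] pf_cpos[OF pf a] pf_cpos[OF pf ab]
    show "\<bar>Re (\<phi> a)\<bar> \<le> (norm b + e) * Re (\<phi> 1)"
      by (simp add: pf_diff[OF pf] complex_nonneg_Reals_iff)
  qed (use that in \<open>simp add: add_nonneg_pos\<close>)
  then show ?thesis by (rule field_le_epsilon)
qed

text \<open>The real and imaginary parts of \<open>\<phi>(x)\<close> are values at self-adjoint elements, where \<open>\<phi>(1)\<close> controls \<open>\<phi>\<close>.\<close>

lemma pf_bounded:
  fixes \<phi> :: "'a::cstar_algebra_1 \<Rightarrow> complex"
  assumes pf: "positive_functional \<phi>"
  shows "bounded_linear \<phi>"
proof (rule bounded_linear_intro)
  show "\<phi> (x + y) = \<phi> x + \<phi> y" "\<phi> (r *\<^sub>R x) = r *\<^sub>R \<phi> x" for x y r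
    by (simp_all add: pf_add[OF pf] pf_scaleR[OF pf] scaleR_conv_of_real[of _ "\<phi> _"])
  fix x :: 'a
  define y where "y = x + star x"
  define z where "z = \<i> *\<^sub>C x + star (\<i> *\<^sub>C x)"
  have y: "star y = y" "norm y \<le> 2 * norm x" 
    using norm_triangle_ineq[of x "star x"] by (simp_all add: y_def star_add star_star add.commute)
  have z: "star z = z" "norm z \<le> 2 * norm x"
    using norm_triangle_ineq[of "\<i> *\<^sub>C x" "star (\<i> *\<^sub>C x)"]
    by (simp_all add: z_def star_add star_star add.commute norm_scaleC)
  have "\<bar>Re (\<phi> x)\<bar> \<le> norm x * Re (\<phi> 1)"
    using pf_le_norm[OF pf y] by (simp add: y_def pf_add[OF pf] pf_star_cnj[OF pf])
  moreover have "\<bar>Im (\<phi> x)\<bar> \<le> norm x * Re (\<phi> 1)"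
    using pf_le_norm[OF pf z] by (simp add: z_def pf_add[OF pf] pf_star_cnj[OF pf] pf_scale[OF pf])
  ultimately show "norm (\<phi> x) \<le> norm x * (2 * Re (\<phi> 1))"
    using cmod_le[of "\<phi> x"] by simp
qed

lemma cpos_limit:
  fixes a :: "nat \<Rightarrow> 'a::cstar_states"
  assumes "a \<longlonglongrightarrow> l" "\<And>n. cpos (a n)"
  shows "cpos l"
  unfolding cpos_iff
proof (intro allI impI)
  fix \<phi> :: "'a \<Rightarrow> complex" assume pf: "positive_functional \<phi>"
  have "(\<lambda>n. \<phi> (a n)) \<longlonglongrightarrow> \<phi> l"
    by (rule bounded_linear.tendsto[OF pf_bounded[OF pf] assms(1)])
  then show "\<phi> l \<in> \<real>\<^sub>\<ge>\<^sub>0"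
    by (rule closed_sequentially[OF closed_nonneg_Reals_complex pf_cpos[OF pf assms(2)]])
qed



section \<open>Hilbert modules as seminormed spaces\<close>

abbreviation hdist :: "('a::real_normed_vector, 'x, 'z) hmod_scheme \<Rightarrow> 'x \<Rightarrow> 'x \<Rightarrow> real" where
  "hdist X x y \<equiv> hnorm X (hdiff X x y)"

lemma hnorm_ge_zero [simp]: "0 \<le> hnorm X x"
  by (simp add: hnorm_def)

lemma hnorm_power2: "(hnorm X x)\<^sup>2 = norm (hinn X x x)"
  by (simp add: hnorm_def)

lemma hnorm_eqI: "hinn X x x = hinn Y y y \<Longrightarrow> hnorm X x = hnorm Y y"
  by (simp add: hnorm_def)

locale states_pre_hilbert_module = pre_hilbert_module X
  for X :: "('a::cstar_states, 'x, 'z) hmod_scheme"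
begin

lemmas closed = zero_closed add_closed scale_closed ract_closed diff_closed

lemma inn_diff_right:
  "\<lbrakk>x \<in> hcarr X; y \<in> hcarr X; z \<in> hcarr X\<rbrakk> \<Longrightarrow> hinn X x (hdiff X y z) = hinn X x y - hinn X x z"
  by (simp add: hdiff_def inn_add inn_scale closed scaleC_minus_one)

lemma inn_diff_left:
  "\<lbrakk>x \<in> hcarr X; y \<in> hcarr X; z \<in> hcarr X\<rbrakk> \<Longrightarrow> hinn X (hdiff X x y) z = hinn X x z - hinn X y z"
  by (simp add: hdiff_def inn_add_left inn_scale_left closed scaleC_minus_one)

lemma inn_ract_left:
  "\<lbrakk>x \<in> hcarr X; y \<in> hcarr X\<rbrakk> \<Longrightarrow> hinn X (hract X x a) y = star a * hinn X x y"
  by (metis inn_ract inn_star ract_closed star_mult)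

lemmas inn_expand = inn_add inn_add_left inn_diff_right inn_diff_left inn_ract inn_ract_left closed

text \<open>The Cauchy-Schwarz inequality in the C*-algebra. With \<open>w = \<langle>x, y\<rangle>\<close> it is obtained by expanding
  \<open>\<langle>x w/N - y, x w/N - y\<rangle>\<close>, where the first term is estimated by \<open>\<langle>x, x\<rangle> \<le> N\<close>.\<close>

lemma cauchy_schwarz_cpos:
  assumes x: "x \<in> hcarr X" and y: "y \<in> hcarr X" and N: "N > 0" "norm (hinn X x x) \<le> N"
  shows "cpos (hinn X y y - (1 / N) *\<^sub>R (star (hinn X x y) * hinn X x y))"
proof -
  define w where "w = hinn X x y"
  define a where "a = (1 / N) *\<^sub>R w"
  have a: "star a * w = (1 / N) *\<^sub>R (star w * w)" "star w * a = (1 / N) *\<^sub>R (star w * w)"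
    "N *\<^sub>R (star a * a) = (1 / N) *\<^sub>R (star w * w)"
    using N by (simp_all add: a_def star_scaleR)
  have "hinn X y x = star w" using inn_star[OF x y] by (simp add: w_def)
  then have "hinn X (hdiff X (hract X x a) y) (hdiff X (hract X x a) y) =
      star a * hinn X x x * a - (1 / N) *\<^sub>R (star w * w) - (1 / N) *\<^sub>R (star w * w) + hinn X y y"
    using x y by (simp add: inn_expand left_diff_distrib mult.assoc a flip: w_def)
  then have "cpos (star a * hinn X x x * a - (1 / N) *\<^sub>R (star w * w) - (1 / N) *\<^sub>R (star w * w) + hinn X y y)"
    using x y by (metis inn_pos diff_closed ract_closed)
  moreover have "cpos (star a * (N *\<^sub>R 1 - hinn X x x) * a)"
    by (rule cpos_conj, rule cpos_norm_minus[OF inn_star[OF x x] N(2)])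
  then have "cpos ((1 / N) *\<^sub>R (star w * w) - star a * hinn X x x * a)"
    by (simp add: algebra_simps a)
  ultimately have "cpos (hinn X y y - (1 / N) *\<^sub>R (star w * w))"
    by (auto dest: cpos_add)
  then show ?thesis by (simp add: w_def)
qed

lemma cauchy_schwarz_norm:
  assumes x: "x \<in> hcarr X" and y: "y \<in> hcarr X"
  shows "norm (hinn X x y) \<le> hnorm X x * hnorm X y"
proof -
  \<comment> \<open>The bound \<open>N\<close> has to be positive, although \<open>\<langle>x, x\<rangle>\<close> may vanish.\<close>
  have le: "(norm (hinn X x y))\<^sup>2 \<le> ((hnorm X x)\<^sup>2 + inverse (real (Suc n))) * (hnorm X y)\<^sup>2" for n
  proof -
    define N where "N = (hnorm X x)\<^sup>2 + inverse (real (Suc n))"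
    have N: "N > 0" by (simp add: N_def add_nonneg_pos)
    have "norm ((1 / N) *\<^sub>R (star (hinn X x y) * hinn X x y)) \<le> norm (hinn X y y)"
    proof (rule cpos_norm_mono)
      show "cpos (hinn X y y - (1 / N) *\<^sub>R (star (hinn X x y) * hinn X x y))"
        by (rule cauchy_schwarz_cpos[OF x y N]) (simp add: N_def hnorm_power2)
    qed (use N in \<open>simp add: cpos_scaleR\<close>)
    then show ?thesis
      using N unfolding N_def[symmetric] by (simp add: cstar_identity hnorm_power2 field_simps)
  qed
  have "(\<lambda>n. ((hnorm X x)\<^sup>2 + inverse (real (Suc n))) * (hnorm X y)\<^sup>2) \<longlonglongrightarrow> ((hnorm X x)\<^sup>2 + 0) * (hnorm X y)\<^sup>2"
    by (intro tendsto_intros LIMSEQ_inverse_real_of_nat)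
  then have "(norm (hinn X x y))\<^sup>2 \<le> ((hnorm X x)\<^sup>2 + 0) * (hnorm X y)\<^sup>2"
    by (rule LIMSEQ_le_const) (use le in blast)
  then have "(norm (hinn X x y))\<^sup>2 \<le> (hnorm X x * hnorm X y)\<^sup>2"
    by (simp add: power_mult_distrib)
  then show ?thesis by (rule power2_le_imp_le) simp
qed

lemma hnorm_add_le:
  assumes x: "x \<in> hcarr X" and y: "y \<in> hcarr X"
  shows "hnorm X (hadd X x y) \<le> hnorm X x + hnorm X y"
proof (rule power2_le_imp_le)
  have "(hnorm X (hadd X x y))\<^sup>2 = norm ((hinn X x x + hinn X y x) + (hinn X x y + hinn X y y))"
    using x y by (simp add: hnorm_power2 inn_expand)
  also have "\<dots> \<le> (norm (hinn X x x) + norm (hinn X y x)) + (norm (hinn X x y) + norm (hinn X y y))"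
    by (intro norm_triangle_le add_mono norm_triangle_ineq)
  also have "\<dots> \<le> (hnorm X x + hnorm X y)\<^sup>2"
    using cauchy_schwarz_norm[OF x y] cauchy_schwarz_norm[OF y x]
    by (simp add: power2_sum algebra_simps flip: hnorm_power2)
  finally show "(hnorm X (hadd X x y))\<^sup>2 \<le> (hnorm X x + hnorm X y)\<^sup>2" .
qed simp

lemma hnorm_hscale: "x \<in> hcarr X \<Longrightarrow> hnorm X (hscale X c x) = cmod c * hnorm X x"
  by (simp add: hnorm_def inn_scale inn_scale_left closed norm_scaleC real_sqrt_mult)

lemma hnorm_hract_le:
  assumes "x \<in> hcarr X"
  shows "hnorm X (hract X x a) \<le> norm a * hnorm X x"
proof (rule power2_le_imp_le)
  have "(hnorm X (hract X x a))\<^sup>2 = norm (star a * hinn X x x * a)"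
    using assms by (simp add: hnorm_power2 inn_expand mult.assoc)
  also have "\<dots> \<le> norm (star a) * norm (hinn X x x) * norm a"
    by (meson norm_mult_ineq order_trans mult_right_mono norm_ge_zero)
  finally show "(hnorm X (hract X x a))\<^sup>2 \<le> (norm a * hnorm X x)\<^sup>2"
    by (simp add: power_mult_distrib hnorm_power2 power2_eq_square[of "norm a"] mult_ac)
qed simp

text \<open>The vectors of a semi-inner product module need not be determined by their distances, but the
  distances are computed from inner products, in which all vector space identities hold.\<close>

lemma hdist_self [simp]: "x \<in> hcarr X \<Longrightarrow> hdist X x x = 0"
  by (simp add: hnorm_def inn_expand)

lemma hdist_commute: "\<lbrakk>x \<in> hcarr X; y \<in> hcarr X\<rbrakk> \<Longrightarrow> hdist X x y = hdist X y x"
  by (rule hnorm_eqI) (simp add: inn_expand)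

lemma hdist_triangle:
  assumes "x \<in> hcarr X" "y \<in> hcarr X" "z \<in> hcarr X"
  shows "hdist X x z \<le> hdist X x y + hdist X y z"
proof -
  have "hdist X x z = hnorm X (hadd X (hdiff X x y) (hdiff X y z))"
    by (rule hnorm_eqI) (use assms in \<open>simp add: inn_expand\<close>)
  also have "\<dots> \<le> hdist X x y + hdist X y z"
    using assms by (intro hnorm_add_le diff_closed)
  finally show ?thesis .
qed

lemma hdist_hadd_le:
  assumes "x \<in> hcarr X" "x' \<in> hcarr X" "y \<in> hcarr X" "y' \<in> hcarr X"
  shows "hdist X (hadd X x y) (hadd X x' y') \<le> hdist X x x' + hdist X y y'"
proof -
  have "hdist X (hadd X x y) (hadd X x' y') = hnorm X (hadd X (hdiff X x x') (hdiff X y y'))"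
    by (rule hnorm_eqI) (use assms in \<open>simp add: inn_expand\<close>)
  also have "\<dots> \<le> hdist X x x' + hdist X y y'"
    using assms by (intro hnorm_add_le diff_closed)
  finally show ?thesis .
qed

lemma hdiff_hscale: "\<lbrakk>x \<in> hcarr X; x' \<in> hcarr X\<rbrakk> \<Longrightarrow>
    hdiff X (hscale X c x) (hscale X c x') = hscale X c (hdiff X x x')"
  by (simp add: hdiff_def scale_add_right scale_scale closed)

lemma hdiff_hract: "\<lbrakk>x \<in> hcarr X; x' \<in> hcarr X\<rbrakk> \<Longrightarrow>
    hdiff X (hract X x a) (hract X x' a) = hract X (hdiff X x x') a"
  by (simp add: hdiff_def ract_add_left ract_scale_left closed)

lemma hdist_hscale: "\<lbrakk>x \<in> hcarr X; x' \<in> hcarr X\<rbrakk> \<Longrightarrow>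
    hdist X (hscale X c x) (hscale X c x') = cmod c * hdist X x x'"
  by (simp add: hdiff_hscale hnorm_hscale closed)

lemma hdist_hract_le: "\<lbrakk>x \<in> hcarr X; x' \<in> hcarr X\<rbrakk> \<Longrightarrow>
    hdist X (hract X x a) (hract X x' a) \<le> norm a * hdist X x x'"
  by (simp add: hdiff_hract hnorm_hract_le closed)

lemma hnorm_diff_le:
  assumes "x \<in> hcarr X" "y \<in> hcarr X"
  shows "\<bar>hnorm X x - hnorm X y\<bar> \<le> hdist X x y"
proof -
  have *: "hnorm X x \<le> hdist X x y + hnorm X y" if "x \<in> hcarr X" "y \<in> hcarr X" for x y
  proof -
    have "hnorm X x = hnorm X (hadd X (hdiff X x y) y)"
      by (rule hnorm_eqI) (use that in \<open>simp add: inn_expand\<close>)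
    also have "\<dots> \<le> hdist X x y + hnorm X y"
      using that by (intro hnorm_add_le diff_closed)
    finally show ?thesis .
  qed
  show ?thesis
    using *[OF assms] *[OF assms(2,1)] hdist_commute[OF assms] by simp
qed

lemma inn_diff_norm_le:
  assumes "x \<in> hcarr X" "x' \<in> hcarr X" "y \<in> hcarr X" "y' \<in> hcarr X"
  shows "norm (hinn X x y - hinn X x' y') \<le> hnorm X x * hdist X y y' + hdist X x x' * hnorm X y'"
proof -
  have "hinn X x y - hinn X x' y' = hinn X x (hdiff X y y') + hinn X (hdiff X x x') y'"
    using assms by (simp add: inn_expand)
  also have "norm \<dots> \<le> hnorm X x * hdist X y y' + hdist X x x' * hnorm X y'"
    using assms by (intro norm_triangle_le add_mono cauchy_schwarz_norm diff_closed)
  finally show ?thesis .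
qed

end

lemma (in hilbert_module) eq_if_hdist_zero:
  assumes x: "x \<in> hcarr X" and y: "y \<in> hcarr X" and 0: "hdist X x y = 0"
  shows "x = y"
proof -
  have "hdiff X x y = hzero X"
    using 0 x y by (intro inn_definite diff_closed) (simp_all add: hnorm_def)
  then have z: "hadd X x (hscale X (-1) y) = hzero X" by (simp add: hdiff_def)
  have zy: "hadd X (hscale X (-1) y) y = hzero X"
    using add_commute[of "hscale X (-1) y" y] diff_self[OF y] y by (simp add: hdiff_def scale_closed)
  have "hadd X (hadd X x (hscale X (-1) y)) y = hadd X x (hadd X (hscale X (-1) y) y)"
    using x y by (intro add_assoc scale_closed)
  then have "hadd X (hzero X) y = x" using x z zy add_zero by simp
  then show ?thesis using add_commute[OF zero_closed y] add_zero[OF y] by simp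
qed


section \<open>Completion of semi-inner product bimodules\<close>

text \<open>Linearity of the operators in the left action is stated separately because, before the null vectors are
  divided out, adjointability yields it only up to null vectors.\<close>

locale pre_hilbert_bimodule = states_pre_hilbert_module X
  for X :: "('a::cstar_states, 'x, 'z) hbimod_scheme" +
  assumes lact_adjoint: "adjoint_pair X (hlact X a) (hlact X (star a))"
    and lact_add: "x \<in> hcarr X \<Longrightarrow> hlact X (a + b) x = hadd X (hlact X a x) (hlact X b x)"
    and lact_scale: "x \<in> hcarr X \<Longrightarrow> hlact X (c *\<^sub>C a) x = hscale X c (hlact X a x)"
    and lact_mult: "x \<in> hcarr X \<Longrightarrow> hlact X (a * b) x = hlact X a (hlact X b x)"
    and lact_one: "x \<in> hcarr X \<Longrightarrow> hlact X 1 x = x"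
    and lact_add_right: "\<lbrakk>x \<in> hcarr X; y \<in> hcarr X\<rbrakk> \<Longrightarrow>
          hlact X a (hadd X x y) = hadd X (hlact X a x) (hlact X a y)"
    and lact_scale_right: "x \<in> hcarr X \<Longrightarrow> hlact X a (hscale X c x) = hscale X c (hlact X a x)"
begin

lemma lact_closed: "x \<in> hcarr X \<Longrightarrow> hlact X a x \<in> hcarr X"
  using lact_adjoint by (auto simp: adjoint_pair_def)

lemma lact_inn: "x \<in> hcarr X \<Longrightarrow> y \<in> hcarr X \<Longrightarrow> hinn X (hlact X a x) y = hinn X x (hlact X (star a) y)"
  using lact_adjoint[of a] by (auto simp: adjoint_pair_def)

lemma hdiff_lact: "\<lbrakk>x \<in> hcarr X; y \<in> hcarr X\<rbrakk> \<Longrightarrow>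
    hdiff X (hlact X a x) (hlact X a y) = hlact X a (hdiff X x y)"
  by (simp add: hdiff_def lact_add_right lact_scale_right closed)

lemma lact_diff: "x \<in> hcarr X \<Longrightarrow> hlact X (a - b) x = hdiff X (hlact X a x) (hlact X b x)"
  using lact_add[of x a "- b"] lact_scale[of x "-1" b] by (simp add: hdiff_def scaleC_minus_one)

text \<open>The positive element \<open>\<parallel>a\<parallel>\<^sup>2 - a\<^sup>* a\<close> is of the form \<open>c\<^sup>* c\<close>, and
  \<open>\<langle>c x, c x\<rangle> = \<parallel>a\<parallel>\<^sup>2 \<langle>x, x\<rangle> - \<langle>a x, a x\<rangle>\<close>.\<close>

lemma hnorm_lact_le:
  assumes x: "x \<in> hcarr X"
  shows "hnorm X (hlact X a x) \<le> norm a * hnorm X x"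
proof -
  obtain c where c: "(norm a)\<^sup>2 *\<^sub>R 1 - star a * a = star c * c"
    using cpos_norm_sq_minus[of a] unfolding cpos_def by blast
  have *: "hinn X (hlact X b x) (hlact X b x) = hinn X x (hlact X (star b * b) x)" for b
    using x by (simp add: lact_inn lact_closed lact_mult)
  have "hinn X (hlact X c x) (hlact X c x) =
      (norm a)\<^sup>2 *\<^sub>R hinn X x x - hinn X (hlact X a x) (hlact X a x)"
    using x lact_scale[OF x, of "complex_of_real ((norm a)\<^sup>2)" 1]
      inn_scale[OF x x, of "complex_of_real ((norm a)\<^sup>2)"]
    unfolding * c[symmetric] scaleC_of_real by (simp add: lact_diff inn_expand lact_closed lact_one)
  then have "cpos ((norm a)\<^sup>2 *\<^sub>R hinn X x x - hinn X (hlact X a x) (hlact X a x))"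
    using inn_pos[OF lact_closed[OF x]] by metis
  then have "norm (hinn X (hlact X a x) (hlact X a x)) \<le> norm ((norm a)\<^sup>2 *\<^sub>R hinn X x x)"
    by (rule cpos_norm_mono[OF inn_pos[OF lact_closed[OF x]]])
  then have "(hnorm X (hlact X a x))\<^sup>2 \<le> (norm a * hnorm X x)\<^sup>2"
    by (simp add: hnorm_power2 power_mult_distrib)
  then show ?thesis by (rule power2_le_imp_le) simp
qed

end


subsection \<open>Cauchy sequences\<close>

lemma hCauchy_mem: "hCauchy V s \<Longrightarrow> s n \<in> hcarr V"
  by (simp add: hCauchy_def)

text \<open>With two dominating sequences, which may come from other modules, this makes Cauchy sequences out of
  Cauchy sequences under all operations in one or two variables.\<close>

lemma double_null_compare:
  fixes a b c :: "nat \<Rightarrow> nat \<Rightarrow> real"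
  assumes a: "\<forall>e>0. \<exists>N. \<forall>m\<ge>N. \<forall>n\<ge>N. a m n < e" and b: "\<forall>e>0. \<exists>N. \<forall>m\<ge>N. \<forall>n\<ge>N. b m n < e"
    and pos: "\<And>m n. 0 \<le> a m n" "\<And>m n. 0 \<le> b m n"
    and le: "\<And>m n. c m n \<le> K * (a m n + b m n)"
  shows "\<forall>e>0. \<exists>N. \<forall>m\<ge>N. \<forall>n\<ge>N. c m n < e"
proof (intro allI impI)
  fix e :: real assume "e > 0"
  define L where "L = \<bar>K\<bar> + 1"
  have L: "L > 0" "K \<le> L" by (simp_all add: L_def)
  have e: "e / (2 * L) > 0" using L \<open>e > 0\<close> by simp
  obtain N1 where N1: "\<forall>m\<ge>N1. \<forall>n\<ge>N1. a m n < e / (2 * L)" using a e by blast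
  obtain N2 where N2: "\<forall>m\<ge>N2. \<forall>n\<ge>N2. b m n < e / (2 * L)" using b e by blast
  have "c m n < e" if "m \<ge> max N1 N2" "n \<ge> max N1 N2" for m n
  proof -
    have "c m n \<le> L * (a m n + b m n)"
      using le[of m n] mult_right_mono[OF L(2), of "a m n + b m n"] pos[of m n] by linarith
    moreover have "a m n + b m n < e / L"
    proof -
      have "a m n < e / (2 * L)" "b m n < e / (2 * L)" using N1 N2 that by simp_all
      then show ?thesis by (simp add: field_simps)
    qed
    then have "L * (a m n + b m n) < L * (e / L)" using L by (intro mult_strict_left_mono) simp_all
    ultimately show ?thesis using L by simp
  qed
  then show "\<exists>N. \<forall>m\<ge>N. \<forall>n\<ge>N. c m n < e" by blast
qed

lemma hCauchy_compare:
  assumes s: "hCauchy V s" and t: "hCauchy W t" and u: "\<And>n. u n \<in> hcarr U"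
    and le: "\<And>m n. hdist U (u m) (u n) \<le> K * (hdist V (s m) (s n) + hdist W (t m) (t n))"
  shows "hCauchy U u"
  unfolding hCauchy_def
proof (intro conjI)
  show "\<forall>e>0. \<exists>N. \<forall>m\<ge>N. \<forall>n\<ge>N. hdist U (u m) (u n) < e"
    by (rule double_null_compare[where a = "\<lambda>m n. hdist V (s m) (s n)" and b = "\<lambda>m n. hdist W (t m) (t n)"])
      (use s t le in \<open>auto simp: hCauchy_def\<close>)
qed (use u in simp)

lemma Cauchy_compare:
  fixes u :: "nat \<Rightarrow> 'b::real_normed_vector"
  assumes s: "hCauchy V s" and t: "hCauchy W t"
    and le: "\<And>m n. norm (u m - u n) \<le> K * (hdist V (s m) (s n) + hdist W (t m) (t n))"
  shows "Cauchy u"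
  unfolding Cauchy_def dist_norm
  by (rule double_null_compare[where a = "\<lambda>m n. hdist V (s m) (s n)" and b = "\<lambda>m n. hdist W (t m) (t n)"])
    (use s t le in \<open>auto simp: hCauchy_def\<close>)

lemma null_compare:
  fixes s t u :: "nat \<Rightarrow> real"
  assumes "s \<longlonglongrightarrow> 0" "t \<longlonglongrightarrow> 0" "\<And>n. 0 \<le> u n" "\<And>n. u n \<le> K * (s n + t n)"
  shows "u \<longlonglongrightarrow> 0"
proof (rule tendsto_sandwich[OF _ _ tendsto_const])
  show "(\<lambda>n. K * (s n + t n)) \<longlonglongrightarrow> 0"
    using tendsto_mult_left[OF tendsto_add[OF assms(1,2)], of K] by simp
qed (use assms in auto)

lemma hrep_mem: "s \<in> hclass V s \<Longrightarrow> hrep (hclass V s) \<in> hclass V s"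
  unfolding hrep_def by (rule someI[of "\<lambda>t. t \<in> hclass V s"])

context states_pre_hilbert_module
begin

lemma hCauchy_const: "x \<in> hcarr X \<Longrightarrow> hCauchy X (\<lambda>n. x)"
  by (simp add: hCauchy_def)

lemma hCauchy_hnorm_convergent:
  assumes "hCauchy X s"
  shows "convergent (\<lambda>n. hnorm X (s n))"
proof -
  have "Cauchy (\<lambda>n. hnorm X (s n))"
    by (rule Cauchy_compare[OF assms assms, where K = "1/2"])
      (use hnorm_diff_le[OF hCauchy_mem[OF assms] hCauchy_mem[OF assms]] in simp)
  then show ?thesis by (rule Cauchy_convergent)
qed

lemma hCauchy_hnorm_bounded:
  assumes "hCauchy X s"
  obtains B where "B > 0" "\<And>n. hnorm X (s n) \<le> B"
proof -
  have "Bseq (\<lambda>n. hnorm X (s n))"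
    by (rule convergent_imp_Bseq[OF hCauchy_hnorm_convergent[OF assms]])
  then obtain B where "B > 0" "\<And>n. norm (hnorm X (s n)) \<le> B" unfolding Bseq_def by blast
  then show thesis using that by simp
qed

lemma hCauchy_hadd: "hCauchy X s \<Longrightarrow> hCauchy X t \<Longrightarrow> hCauchy X (\<lambda>n. hadd X (s n) (t n))"
  by (rule hCauchy_compare[of X s X t _ _ 1]) (simp_all add: hCauchy_mem closed hdist_hadd_le)

lemma hCauchy_hscale: "hCauchy X s \<Longrightarrow> hCauchy X (\<lambda>n. hscale X c (s n))"
  by (rule hCauchy_compare[of X s X s _ _ "cmod c"])
    (simp_all add: hCauchy_mem closed hdist_hscale distrib_left)

lemma hCauchy_hract: "hCauchy X s \<Longrightarrow> hCauchy X (\<lambda>n. hract X (s n) a)"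
  by (rule hCauchy_compare[of X s X s _ _ "norm a / 2"])
    (simp_all add: hCauchy_mem closed hdist_hract_le)

lemma hCauchy_hdiff: "hCauchy X s \<Longrightarrow> hCauchy X t \<Longrightarrow> hCauchy X (\<lambda>n. hdiff X (s n) (t n))"
  unfolding hdiff_def by (intro hCauchy_hadd hCauchy_hscale)

lemma hCauchy_inn_convergent:
  assumes s: "hCauchy X s" and t: "hCauchy X t"
  shows "convergent (\<lambda>n. hinn X (s n) (t n))"
proof -
  obtain B where B: "B > 0" "\<And>n. hnorm X (s n) \<le> B" using hCauchy_hnorm_bounded[OF s] by blast
  obtain C where C: "C > 0" "\<And>n. hnorm X (t n) \<le> C" using hCauchy_hnorm_bounded[OF t] by blast
  have "Cauchy (\<lambda>n. hinn X (s n) (t n))"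
  proof (rule Cauchy_compare[OF s t])
    fix m n
    have "norm (hinn X (s m) (t m) - hinn X (s n) (t n)) \<le>
        hnorm X (s m) * hdist X (t m) (t n) + hdist X (s m) (s n) * hnorm X (t n)"
      by (intro inn_diff_norm_le hCauchy_mem s t)
    also have "\<dots> \<le> (B + C) * hdist X (t m) (t n) + hdist X (s m) (s n) * (B + C)"
      using B C by (intro add_mono mult_left_mono mult_right_mono)
        (auto intro: order_trans[OF B(2)] order_trans[OF C(2)])
    finally show "norm (hinn X (s m) (t m) - hinn X (s n) (t n)) \<le>
        (B + C) * (hdist X (s m) (s n) + hdist X (t m) (t n))"
      by (simp add: algebra_simps)
  qed
  then show ?thesis by (rule Cauchy_convergent)
qed

lemma inn_null:
  assumes s: "hCauchy X s" and t: "hCauchy X t" and s': "hCauchy X s'" and t': "hCauchy X t'"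
    and 0: "(\<lambda>n. hdist X (s n) (s' n)) \<longlonglongrightarrow> 0" "(\<lambda>n. hdist X (t n) (t' n)) \<longlonglongrightarrow> 0"
  shows "(\<lambda>n. hinn X (s n) (t n) - hinn X (s' n) (t' n)) \<longlonglongrightarrow> 0"
proof -
  obtain B where B: "B > 0" "\<And>n. hnorm X (s n) \<le> B" using hCauchy_hnorm_bounded[OF s] by blast
  obtain C where C: "C > 0" "\<And>n. hnorm X (t' n) \<le> C" using hCauchy_hnorm_bounded[OF t'] by blast
  have "(\<lambda>n. norm (hinn X (s n) (t n) - hinn X (s' n) (t' n))) \<longlonglongrightarrow> 0"
  proof (rule null_compare[OF 0])
    fix n
    have "norm (hinn X (s n) (t n) - hinn X (s' n) (t' n)) \<le>
        hnorm X (s n) * hdist X (t n) (t' n) + hdist X (s n) (s' n) * hnorm X (t' n)"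
      by (intro inn_diff_norm_le hCauchy_mem s t s' t')
    also have "\<dots> \<le> (B + C) * hdist X (t n) (t' n) + hdist X (s n) (s' n) * (B + C)"
      using B C by (intro add_mono mult_left_mono mult_right_mono)
        (auto intro: order_trans[OF B(2)] order_trans[OF C(2)])
    finally show "norm (hinn X (s n) (t n) - hinn X (s' n) (t' n)) \<le>
        (B + C) * (hdist X (s n) (s' n) + hdist X (t n) (t' n))"
      by (simp add: algebra_simps)
  qed simp
  then show ?thesis by (simp add: tendsto_norm_zero_iff)
qed

lemma hclass_self: "hCauchy X s \<Longrightarrow> s \<in> hclass X s"
  by (simp add: hclass_def hCauchy_mem)

lemma hclass_eq_iff:
  assumes s: "hCauchy X s" and t: "hCauchy X t"
  shows "hclass X s = hclass X t \<longleftrightarrow> (\<lambda>n. hdist X (s n) (t n)) \<longlonglongrightarrow> 0"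
proof
  assume "hclass X s = hclass X t"
  then show "(\<lambda>n. hdist X (s n) (t n)) \<longlonglongrightarrow> 0"
    using hclass_self[OF s] by (simp add: hclass_def)
next
  have sub: "hclass X s \<subseteq> hclass X t"
    if s: "hCauchy X s" and t: "hCauchy X t" and 0: "(\<lambda>n. hdist X (s n) (t n)) \<longlonglongrightarrow> 0" for s t
  proof
    fix u assume "u \<in> hclass X s"
    then have u: "hCauchy X u" "(\<lambda>n. hdist X (u n) (s n)) \<longlonglongrightarrow> 0" by (auto simp: hclass_def)
    have "(\<lambda>n. hdist X (u n) (t n)) \<longlonglongrightarrow> 0"
      by (rule null_compare[OF u(2) 0, where K = 1])
        (simp_all add: hdist_triangle hCauchy_mem[OF s] hCauchy_mem[OF t] hCauchy_mem[OF u(1)])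
    then show "u \<in> hclass X t" using u by (simp add: hclass_def)
  qed
  assume 0: "(\<lambda>n. hdist X (s n) (t n)) \<longlonglongrightarrow> 0"
  then have "(\<lambda>n. hdist X (t n) (s n)) \<longlonglongrightarrow> 0"
    by (simp add: hdist_commute hCauchy_mem[OF s] hCauchy_mem[OF t])
  then show "hclass X s = hclass X t" using sub[OF s t 0] sub[OF t s] by blast
qed

lemma hrep_hclass:
  assumes "hCauchy X s"
  shows "hCauchy X (hrep (hclass X s))" "(\<lambda>n. hdist X (hrep (hclass X s) n) (s n)) \<longlonglongrightarrow> 0"
  using hrep_mem[OF hclass_self[OF assms]] by (auto simp: hclass_def)

end



subsection \<open>The completion\<close>

locale completable_bimodule = pre_hilbert_bimodule V
  for V :: "('a::cstar_states, 'x) hbimod"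
begin

abbreviation C :: "('a, (nat \<Rightarrow> 'x) set) hbimod" where "C \<equiv> hcompletion V"

lemma hCauchy_lact: "hCauchy V s \<Longrightarrow> hCauchy V (\<lambda>n. hlact V a (s n))"
  by (rule hCauchy_compare[of V s V s _ _ "norm a / 2"])
    (simp_all add: hCauchy_mem lact_closed hdiff_lact hnorm_lact_le closed)

lemma comp_carrI: "hCauchy V s \<Longrightarrow> hclass V s \<in> hcarr C"
  by (simp add: hcompletion_def)

lemma comp_cases:
  assumes "S \<in> hcarr C"
  obtains s where "hCauchy V s" "S = hclass V s"
  using assms by (auto simp: hcompletion_def)

lemma comp_zero: "hzero C = hclass V (\<lambda>n. hzero V)"
  by (simp add: hcompletion_def)

text \<open>An operation on sequences that is Lipschitz for the distances descends to classes; the chosen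
  representatives may then be replaced by any others.\<close>

lemma hclass_rep_op:
  assumes s: "hCauchy V s"
    and F: "\<And>x. x \<in> hcarr V \<Longrightarrow> F x \<in> hcarr V"
    and le: "\<And>x y. x \<in> hcarr V \<Longrightarrow> y \<in> hcarr V \<Longrightarrow> hdist V (F x) (F y) \<le> K * hdist V x y"
  shows "hCauchy V (\<lambda>n. F (s n))" "hclass V (\<lambda>n. F (hrep (hclass V s) n)) = hclass V (\<lambda>n. F (s n))"
proof -
  have *: "hCauchy V (\<lambda>n. F (s n))" if s: "hCauchy V s" for s
    by (rule hCauchy_compare[of V s V s _ _ "K / 2"])
      (simp_all add: s hCauchy_mem[OF s] F le)
  note r = hrep_hclass[OF s]
  show "hCauchy V (\<lambda>n. F (s n))" by (rule *[OF s])
  have "(\<lambda>n. hdist V (F (hrep (hclass V s) n)) (F (s n))) \<longlonglongrightarrow> 0"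
    by (rule null_compare[OF r(2) r(2), where K = "K / 2"])
      (simp_all add: le hCauchy_mem[OF s] hCauchy_mem[OF r(1)])
  then show "hclass V (\<lambda>n. F (hrep (hclass V s) n)) = hclass V (\<lambda>n. F (s n))"
    by (subst hclass_eq_iff[OF *[OF r(1)] *[OF s]])
qed

lemma comp_add:
  assumes s: "hCauchy V s" and t: "hCauchy V t"
  shows "hadd C (hclass V s) (hclass V t) = hclass V (\<lambda>n. hadd V (s n) (t n))"
proof -
  note r = hrep_hclass[OF s] and q = hrep_hclass[OF t]
  have "(\<lambda>n. hdist V (hadd V (hrep (hclass V s) n) (hrep (hclass V t) n)) (hadd V (s n) (t n))) \<longlonglongrightarrow> 0"
    by (rule null_compare[OF r(2) q(2), where K = 1])
      (simp_all add: hdist_hadd_le hCauchy_mem[OF s] hCauchy_mem[OF t] hCauchy_mem[OF r(1)] hCauchy_mem[OF q(1)])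
  then show ?thesis
    by (simp add: hcompletion_def hclass_eq_iff hCauchy_hadd r q s t)
qed

lemma comp_scale: "hCauchy V s \<Longrightarrow> hscale C c (hclass V s) = hclass V (\<lambda>n. hscale V c (s n))"
  unfolding hcompletion_def
  by simp (rule hclass_rep_op(2)[where K = "cmod c"]; simp add: closed hdist_hscale)

lemma comp_ract: "hCauchy V s \<Longrightarrow> hract C (hclass V s) a = hclass V (\<lambda>n. hract V (s n) a)"
  unfolding hcompletion_def
  by simp (rule hclass_rep_op(2)[where K = "norm a" and F = "\<lambda>x. hract V x a"]; simp add: closed hdist_hract_le)

lemma comp_lact: "hCauchy V s \<Longrightarrow> hlact C a (hclass V s) = hclass V (\<lambda>n. hlact V a (s n))"
  unfolding hcompletion_def
  by simp (rule hclass_rep_op(2)[where K = "norm a"]; simp add: lact_closed hdiff_lact hnorm_lact_le closed)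

lemma comp_diff: "hCauchy V s \<Longrightarrow> hCauchy V t \<Longrightarrow>
    hdiff C (hclass V s) (hclass V t) = hclass V (\<lambda>n. hdiff V (s n) (t n))"
  by (simp add: hdiff_def comp_scale comp_add hCauchy_hscale)

lemma comp_inn:
  assumes s: "hCauchy V s" and t: "hCauchy V t"
  shows "(\<lambda>n. hinn V (s n) (t n)) \<longlonglongrightarrow> hinn C (hclass V s) (hclass V t)"
proof -
  note r = hrep_hclass[OF s] and q = hrep_hclass[OF t]
  have "(\<lambda>n. hinn V (hrep (hclass V s) n) (hrep (hclass V t) n)) \<longlonglongrightarrow> hinn C (hclass V s) (hclass V t)"
    using hCauchy_inn_convergent[OF r(1) q(1)] by (simp add: hcompletion_def convergent_LIMSEQ_iff)
  from tendsto_diff[OF this inn_null[OF r(1) q(1) s t r(2) q(2)]] show ?thesis by simp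
qed

lemma comp_hnorm: "hCauchy V s \<Longrightarrow> (\<lambda>n. hnorm V (s n)) \<longlonglongrightarrow> hnorm C (hclass V s)"
  unfolding hnorm_def by (intro tendsto_intros comp_inn)

lemma comp_hdist: "hCauchy V s \<Longrightarrow> hCauchy V t \<Longrightarrow>
    (\<lambda>n. hdist V (s n) (t n)) \<longlonglongrightarrow> hdist C (hclass V s) (hclass V t)"
  by (simp add: comp_diff comp_hnorm hCauchy_hdiff)

lemma comp_inn_eqI:
  assumes "hCauchy V s" "hCauchy V t" "(\<lambda>n. hinn V (s n) (t n)) \<longlonglongrightarrow> l"
  shows "hinn C (hclass V s) (hclass V t) = l"
  by (rule LIMSEQ_unique[OF comp_inn[OF assms(1,2)] assms(3)])

lemmas comp_simps = comp_add comp_scale comp_ract comp_lact comp_zero comp_diff comp_carrI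
  hCauchy_hadd hCauchy_hscale hCauchy_hract hCauchy_lact hCauchy_hdiff hCauchy_const hCauchy_mem

lemma comp_pre_hilbert_module: "pre_hilbert_module C"
proof
  fix S T U :: "(nat \<Rightarrow> 'x) set" and a b :: 'a and c d :: complex
  show "hzero C \<in> hcarr C" by (simp add: comp_simps closed)
  assume "S \<in> hcarr C"
  then obtain s where s: "hCauchy V s" and S: "S = hclass V s" by (rule comp_cases)
  note [simp] = s S comp_simps closed
  show "hscale C c S \<in> hcarr C" "hract C S a \<in> hcarr C"
    "hscale C c (hscale C d S) = hscale C (c * d) S" "hscale C 1 S = S"
    "hscale C (c + d) S = hadd C (hscale C c S) (hscale C d S)"
    "hract C S (a + b) = hadd C (hract C S a) (hract C S b)"
    "hract C S (a * b) = hract C (hract C S a) b"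
    "hract C (hscale C c S) a = hscale C c (hract C S a)"
    "hract C S (c *\<^sub>C a) = hscale C c (hract C S a)"
    "hdiff C S S = hzero C" "hadd C S (hzero C) = S"
    by (simp_all add: scale_scale scale_one scale_add_left ract_add_right ract_mult ract_scale_left
        ract_scale_right diff_self add_zero)
  show "cpos (hinn C S S)"
    using cpos_limit[OF comp_inn[OF s s]] inn_pos by simp
  assume "T \<in> hcarr C"
  then obtain t where t: "hCauchy V t" and T: "T = hclass V t" by (rule comp_cases)
  note [simp] = t T
  show "hadd C S T \<in> hcarr C" by simp
  show "hadd C S T = hadd C T S" by (simp add: add_commute)
  show "hscale C c (hadd C S T) = hadd C (hscale C c S) (hscale C c T)"
    by (simp add: scale_add_right)
  show "hract C (hadd C S T) a = hadd C (hract C S a) (hract C T a)"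
    by (simp add: ract_add_left)
  show "hinn C S (hscale C c T) = c *\<^sub>C hinn C S T"
    using bounded_linear.tendsto[OF bounded_linear_scaleC comp_inn[OF s t]]
    by (simp, intro comp_inn_eqI) (simp_all add: inn_scale)
  show "hinn C S (hract C T a) = hinn C S T * a"
    using tendsto_mult_right[OF comp_inn[OF s t], of a]
    by (simp, intro comp_inn_eqI) (simp_all add: inn_ract)
  show "star (hinn C S T) = hinn C T S"
    using bounded_linear.tendsto[OF bounded_linear_star comp_inn[OF s t]]
    by (simp, intro comp_inn_eqI[symmetric]) (simp_all add: inn_star)
  assume "U \<in> hcarr C"
  then obtain u where u: "hCauchy V u" and U: "U = hclass V u" by (rule comp_cases)
  note [simp] = u U
  show "hadd C (hadd C S T) U = hadd C S (hadd C T U)" by (simp add: add_assoc)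
  show "hinn C S (hadd C T U) = hinn C S T + hinn C S U"
    using tendsto_add[OF comp_inn[OF s t] comp_inn[OF s u]]
    by (simp, intro comp_inn_eqI) (simp_all add: inn_add)
qed

sublocale comp: states_pre_hilbert_module C
  unfolding states_pre_hilbert_module_def by (rule comp_pre_hilbert_module)

lemma comp_embed: "hembed V x = hclass V (\<lambda>n. x)"
  by (simp add: hembed_def)

text \<open>The approximants are the terms of a representing sequence.\<close>

lemma comp_dense:
  assumes S: "S \<in> hcarr C" and e: "e > 0"
  shows "\<exists>x\<in>hcarr V. hdist C S (hembed V x) < e"
proof -
  obtain s where s: "hCauchy V s" and S: "S = hclass V s" using S by (rule comp_cases)
  obtain N where N: "\<forall>m\<ge>N. \<forall>n\<ge>N. hdist V (s m) (s n) < e / 2"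
    using s e unfolding hCauchy_def by (meson half_gt_zero)
  have sN: "s N \<in> hcarr V" by (rule hCauchy_mem[OF s])
  have "hdist C S (hembed V (s N)) \<le> e / 2"
    unfolding S comp_embed
    by (rule LIMSEQ_le_const2[OF comp_hdist[OF s hCauchy_const[OF sN]]])
      (use N in \<open>auto intro!: exI[of _ N] less_imp_le\<close>)
  then show ?thesis using sN e by (intro bexI[of _ "s N"]) auto
qed

text \<open>A Cauchy sequence in the completion is approximated term by term, with errors tending to 0, by a
  sequence of vectors of \<open>V\<close>; that sequence is Cauchy and its class is the limit.\<close>

lemma comp_complete:
  assumes F: "hCauchy C F"
  shows "\<exists>S\<in>hcarr C. (\<lambda>n. hdist C (F n) S) \<longlonglongrightarrow> 0"
proof -
  have "\<exists>x\<in>hcarr V. hdist C (F n) (hembed V x) < inverse (real (Suc n))" for n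
    by (rule comp_dense[OF hCauchy_mem[OF F]]) simp
  then obtain s where sV: "\<And>n. s n \<in> hcarr V"
    and s: "\<And>n. hdist C (F n) (hembed V (s n)) < inverse (real (Suc n))" by metis
  have eV: "hembed V x \<in> hcarr C" if "x \<in> hcarr V" for x
    using that by (simp add: comp_embed comp_simps)
  have e_dist: "hdist C (hembed V x) (hembed V y) = hdist V x y" if "x \<in> hcarr V" "y \<in> hcarr V" for x y
    using comp_hdist[OF hCauchy_const[OF that(1)] hCauchy_const[OF that(2)]]
    by (simp add: comp_embed LIMSEQ_const_iff)
  have lim: "(\<lambda>n. hdist C (F n) (hembed V (s n))) \<longlonglongrightarrow> 0"
    by (rule tendsto_sandwich[OF _ _ tendsto_const LIMSEQ_inverse_real_of_nat])
      (auto intro!: always_eventually less_imp_le[OF s] simp del: of_nat_Suc)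
  have c: "hCauchy V s"
    unfolding hCauchy_def
  proof (intro conjI allI impI sV)
    fix e :: real assume "e > 0"
    then have e: "e / 3 > 0" by simp
    obtain N1 where N1: "\<forall>m\<ge>N1. \<forall>n\<ge>N1. hdist C (F m) (F n) < e / 3"
      using F e unfolding hCauchy_def by blast
    obtain N2 where N2: "\<forall>n\<ge>N2. hdist C (F n) (hembed V (s n)) < e / 3"
      using order_tendstoD(2)[OF lim e] unfolding eventually_sequentially by blast
    have "hdist V (s m) (s n) < e" if "m \<ge> max N1 N2" "n \<ge> max N1 N2" for m n
    proof -
      have "hdist C (hembed V (s m)) (hembed V (s n)) \<le>
          hdist C (hembed V (s m)) (F m) + (hdist C (F m) (F n) + hdist C (F n) (hembed V (s n)))"
        by (intro order_trans[OF comp.hdist_triangle[of _ "F m"]] add_left_mono comp.hdist_triangle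
            eV sV hCauchy_mem[OF F])
      also have "hdist C (hembed V (s m)) (F m) = hdist C (F m) (hembed V (s m))"
        by (intro comp.hdist_commute eV sV hCauchy_mem[OF F])
      also have "hdist C (F m) (hembed V (s m)) + (hdist C (F m) (F n) + hdist C (F n) (hembed V (s n))) < e"
        using N1[rule_format, of m n] N2[rule_format, of m] N2[rule_format, of n] that by simp
      finally show ?thesis by (simp add: e_dist sV)
    qed
    then show "\<exists>N. \<forall>m\<ge>N. \<forall>n\<ge>N. hdist V (s m) (s n) < e" by blast
  qed
  have lim2: "(\<lambda>n. hdist C (hembed V (s n)) (hclass V s)) \<longlonglongrightarrow> 0"
  proof (rule LIMSEQ_I)
    fix e :: real assume "e > 0"
    then obtain N where N: "\<forall>m\<ge>N. \<forall>n\<ge>N. hdist V (s m) (s n) < e / 2"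
      using c unfolding hCauchy_def by (meson half_gt_zero)
    have "hdist C (hembed V (s m)) (hclass V s) \<le> e / 2" if "m \<ge> N" for m
      unfolding comp_embed
      by (rule LIMSEQ_le_const2[OF comp_hdist[OF hCauchy_const[OF sV] c]])
        (use N that in \<open>auto intro!: exI[of _ N] less_imp_le\<close>)
    then show "\<exists>N. \<forall>m\<ge>N. norm (hdist C (hembed V (s m)) (hclass V s) - 0) < e"
      using \<open>e > 0\<close> by (intro exI[of _ N]) fastforce
  qed
  have "(\<lambda>n. hdist C (F n) (hclass V s)) \<longlonglongrightarrow> 0"
    by (rule null_compare[OF lim lim2, where K = 1])
      (simp_all add: comp.hdist_triangle eV sV hCauchy_mem[OF F] comp_carrI c)
  then show ?thesis using comp_carrI[OF c] by blast
qed

lemma comp_hilbert_module: "hilbert_module C"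
proof (intro hilbert_module.intro comp_pre_hilbert_module hilbert_module_axioms.intro comp_complete)
  fix S assume "S \<in> hcarr C" and 0: "hinn C S S = 0"
  then obtain s where s: "hCauchy V s" and S: "S = hclass V s" by (auto elim: comp_cases)
  have "hnorm C S = 0" using 0 by (simp add: hnorm_def)
  then have "(\<lambda>n. hnorm V (s n)) \<longlonglongrightarrow> 0" using comp_hnorm[OF s] by (simp add: S)
  moreover have "hdist V (s n) (hzero V) = hnorm V (s n)" for n
    by (rule hnorm_eqI) (simp add: inn_expand inn_zero hCauchy_mem[OF s] inn_diff_left inn_diff_right
        inn_star[OF _ zero_closed, symmetric] zero_closed)
  ultimately show "S = hzero C"
    by (simp add: S comp_zero hclass_eq_iff s hCauchy_const zero_closed)
qed

lemma comp_lact_adjoint: "adjoint_pair C (hlact C a) (hlact C (star a))"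
  unfolding adjoint_pair_def
proof (intro conjI ballI)
  fix S T assume "S \<in> hcarr C" "T \<in> hcarr C"
  then obtain s t where s: "hCauchy V s" "S = hclass V s" and t: "hCauchy V t" "T = hclass V t"
    by (auto elim!: comp_cases)
  have "(\<lambda>n. hinn V (hlact V a (s n)) (t n)) \<longlonglongrightarrow> hinn C S (hlact C (star a) T)"
    using comp_inn[OF s(1) hCauchy_lact[OF t(1)], of "star a"] s t
    by (simp add: comp_lact lact_inn hCauchy_mem)
  then show "hinn C (hlact C a S) T = hinn C S (hlact C (star a) T)"
    using s t by (simp add: comp_inn_eqI comp_lact hCauchy_lact)
qed (auto elim!: comp_cases simp: comp_simps)

lemma comp_lact_props:
  assumes "S \<in> hcarr C" "T \<in> hcarr C"
  shows "hlact C (a + b) S = hadd C (hlact C a S) (hlact C b S)"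
    "hlact C (c *\<^sub>C a) S = hscale C c (hlact C a S)"
    "hlact C (a * b) S = hlact C a (hlact C b S)"
    "hlact C 1 S = S"
    "hlact C a (hadd C S T) = hadd C (hlact C a S) (hlact C a T)"
    "hlact C a (hscale C c S) = hscale C c (hlact C a S)"
proof -
  obtain s t where s: "hCauchy V s" "S = hclass V s" and t: "hCauchy V t" "T = hclass V t"
    using assms by (auto elim!: comp_cases)
  show "hlact C (a + b) S = hadd C (hlact C a S) (hlact C b S)"
    "hlact C (c *\<^sub>C a) S = hscale C c (hlact C a S)"
    "hlact C (a * b) S = hlact C a (hlact C b S)"
    "hlact C 1 S = S"
    "hlact C a (hadd C S T) = hadd C (hlact C a S) (hlact C a T)"
    "hlact C a (hscale C c S) = hscale C c (hlact C a S)"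
    using s t by (simp_all add: comp_simps lact_add lact_scale lact_mult lact_one lact_add_right
        lact_scale_right)
qed

lemma comp_hilbert_bimodule: "hilbert_bimodule C"
  by (intro hilbert_bimodule.intro comp_hilbert_module hilbert_bimodule_axioms.intro
      comp_lact_adjoint comp_lact_props)

lemma comp_pre_hilbert_bimodule: "pre_hilbert_bimodule C"
  by (intro pre_hilbert_bimodule.intro states_pre_hilbert_module.intro comp_pre_hilbert_module
      pre_hilbert_bimodule_axioms.intro comp_lact_adjoint comp_lact_props)

end


subsection \<open>Completions of isometric images\<close>

locale states_hilbert_module = states_pre_hilbert_module X + hilbert_module X
  for X :: "('a::cstar_states, 'x, 'z) hmod_scheme"
begin

definition hlim :: "(nat \<Rightarrow> 'x) \<Rightarrow> 'x" where
  "hlim s = (SOME x. x \<in> hcarr X \<and> (\<lambda>n. hdist X (s n) x) \<longlonglongrightarrow> 0)"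

lemma hlim:
  assumes "hCauchy X s"
  shows "hlim s \<in> hcarr X" "(\<lambda>n. hdist X (s n) (hlim s)) \<longlonglongrightarrow> 0"
proof -
  have "hlim s \<in> hcarr X \<and> (\<lambda>n. hdist X (s n) (hlim s)) \<longlonglongrightarrow> 0"
    unfolding hlim_def by (rule someI_ex) (use complete[OF assms] in blast)
  then show "hlim s \<in> hcarr X" "(\<lambda>n. hdist X (s n) (hlim s)) \<longlonglongrightarrow> 0" by auto
qed

lemma hlim_unique:
  assumes s: "\<And>n. s n \<in> hcarr X" and x: "x \<in> hcarr X" "(\<lambda>n. hdist X (s n) x) \<longlonglongrightarrow> 0"
    and y: "y \<in> hcarr X" "(\<lambda>n. hdist X (s n) y) \<longlonglongrightarrow> 0"
  shows "x = y"
proof (rule eq_if_hdist_zero[OF x(1) y(1)])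
  have "(\<lambda>n. hdist X x (s n)) \<longlonglongrightarrow> 0" using x(2) hdist_commute[OF s x(1)] by simp
  then have "(\<lambda>n::nat. hdist X x y) \<longlonglongrightarrow> 0"
    by (rule null_compare[OF _ y(2), where K = 1]) (simp_all add: hdist_triangle s x(1) y(1))
  then show "hdist X x y = 0" by (simp add: LIMSEQ_const_iff)
qed

lemma hlim_eqI:
  assumes "hCauchy X s" "x \<in> hcarr X" "(\<lambda>n. hdist X (s n) x) \<longlonglongrightarrow> 0"
  shows "hlim s = x"
  by (rule hlim_unique[OF hCauchy_mem[OF assms(1)] hlim[OF assms(1)] assms(2,3)])

lemma hlim_eq_hlim:
  assumes s: "hCauchy X s" and t: "hCauchy X t" and 0: "(\<lambda>n. hdist X (s n) (t n)) \<longlonglongrightarrow> 0"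
  shows "hlim s = hlim t"
proof (rule hlim_eqI[OF s hlim(1)[OF t]])
  show "(\<lambda>n. hdist X (s n) (hlim t)) \<longlonglongrightarrow> 0"
    by (rule null_compare[OF 0 hlim(2)[OF t], where K = 1])
      (simp_all add: hdist_triangle hCauchy_mem[OF s] hCauchy_mem[OF t] hlim(1)[OF t])
qed

end

text \<open>If \<open>V\<close> is mapped isometrically onto a dense subset of a Hilbert bimodule \<open>W\<close>, then its completion is
  isomorphic to \<open>W\<close>. All laws come from \<open>W\<close>; in the free vector space underlying a tensor product, the
  intended \<open>V\<close>, the module laws hold up to null vectors only.\<close>

locale isometric_image = states_hilbert_module W + pre_hilbert_bimodule W
  for W :: "('a::cstar_states, 'y) hbimod" +
  fixes V :: "('a, 'x) hbimod" and T0 :: "'x \<Rightarrow> 'y"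
  assumes V_add: "\<lbrakk>u \<in> hcarr V; v \<in> hcarr V\<rbrakk> \<Longrightarrow> hadd V u v \<in> hcarr V"
    and V_scale: "u \<in> hcarr V \<Longrightarrow> hscale V c u \<in> hcarr V"
    and V_ract: "u \<in> hcarr V \<Longrightarrow> hract V u a \<in> hcarr V"
    and V_lact: "u \<in> hcarr V \<Longrightarrow> hlact V a u \<in> hcarr V"
    and T0_closed: "u \<in> hcarr V \<Longrightarrow> T0 u \<in> hcarr W"
    and T0_add: "\<lbrakk>u \<in> hcarr V; v \<in> hcarr V\<rbrakk> \<Longrightarrow> T0 (hadd V u v) = hadd W (T0 u) (T0 v)"
    and T0_scale: "u \<in> hcarr V \<Longrightarrow> T0 (hscale V c u) = hscale W c (T0 u)"
    and T0_ract: "u \<in> hcarr V \<Longrightarrow> T0 (hract V u a) = hract W (T0 u) a"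
    and T0_lact: "u \<in> hcarr V \<Longrightarrow> T0 (hlact V a u) = hlact W a (T0 u)"
    and T0_inn: "\<lbrakk>u \<in> hcarr V; v \<in> hcarr V\<rbrakk> \<Longrightarrow> hinn W (T0 u) (T0 v) = hinn V u v"
    and T0_dense: "\<lbrakk>w \<in> hcarr W; e > 0\<rbrakk> \<Longrightarrow> \<exists>u\<in>hcarr V. hdist W (T0 u) w < e"
begin

lemma V_hdist: "u \<in> hcarr V \<Longrightarrow> v \<in> hcarr V \<Longrightarrow> hdist V u v = hdist W (T0 u) (T0 v)"
  by (rule hnorm_eqI, simp only: hdiff_def)
    (simp add: V_add V_scale T0_add T0_scale flip: T0_inn)

lemma V_hCauchy: "hCauchy V s \<longleftrightarrow> (\<forall>n. s n \<in> hcarr V) \<and> hCauchy W (\<lambda>n. T0 (s n))"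
  using V_hdist unfolding hCauchy_def by (auto simp: T0_closed)

lemma V_hclass: "hCauchy V s \<Longrightarrow>
    hclass V s = {t. hCauchy V t \<and> (\<lambda>n. hdist W (T0 (t n)) (T0 (s n))) \<longlonglongrightarrow> 0}"
  using V_hdist unfolding hclass_def by (auto simp: hCauchy_mem)

lemma V_hrep:
  assumes s: "hCauchy V s"
  shows "hCauchy V (hrep (hclass V s))"
    "(\<lambda>n. hdist W (T0 (hrep (hclass V s) n)) (T0 (s n))) \<longlonglongrightarrow> 0"
proof -
  have "s \<in> hclass V s"
    using s by (simp add: V_hclass hCauchy_mem[OF s] T0_closed)
  then have "hrep (hclass V s) \<in> hclass V s" by (rule hrep_mem)
  then show "hCauchy V (hrep (hclass V s))"
    "(\<lambda>n. hdist W (T0 (hrep (hclass V s) n)) (T0 (s n))) \<longlonglongrightarrow> 0"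
    using V_hclass[OF s] by auto
qed

definition ext_map :: "(nat \<Rightarrow> 'x) set \<Rightarrow> 'y" where
  "ext_map S = hlim (\<lambda>n. T0 (hrep S n))"

lemma ext_map_hclass:
  assumes s: "hCauchy V s"
  shows "ext_map (hclass V s) = hlim (\<lambda>n. T0 (s n))"
  unfolding ext_map_def using V_hrep[OF s] s by (intro hlim_eq_hlim) (simp_all add: V_hCauchy)

lemma ext_map_hclassI:
  assumes "hCauchy V s" "w \<in> hcarr W" "(\<lambda>n. hdist W (T0 (s n)) w) \<longlonglongrightarrow> 0"
  shows "ext_map (hclass V s) = w"
  using assms by (simp add: ext_map_hclass hlim_eqI V_hCauchy)

lemma ext_map_rep:
  assumes "S \<in> hcarr (hcompletion V)"
  shows "hCauchy V (hrep S)" "ext_map S \<in> hcarr W" "(\<lambda>n. hdist W (T0 (hrep S n)) (ext_map S)) \<longlonglongrightarrow> 0"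
proof -
  show c: "hCauchy V (hrep S)" using assms V_hrep(1) by (auto simp: hcompletion_def)
  then show "ext_map S \<in> hcarr W" "(\<lambda>n. hdist W (T0 (hrep S n)) (ext_map S)) \<longlonglongrightarrow> 0"
    unfolding ext_map_def by (auto simp: V_hCauchy intro: hlim)
qed

text \<open>The counterpart of \<open>hclass_rep_op\<close> for operations that are intertwined by \<open>T0\<close>.\<close>

lemma ext_map_op:
  assumes S: "S \<in> hcarr (hcompletion V)"
    and FV: "\<And>u. u \<in> hcarr V \<Longrightarrow> F u \<in> hcarr V" and GW: "\<And>x. x \<in> hcarr W \<Longrightarrow> G x \<in> hcarr W"
    and FG: "\<And>u. u \<in> hcarr V \<Longrightarrow> T0 (F u) = G (T0 u)"
    and le: "\<And>x y. x \<in> hcarr W \<Longrightarrow> y \<in> hcarr W \<Longrightarrow> hdist W (G x) (G y) \<le> K * hdist W x y"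
  shows "ext_map (hclass V (\<lambda>n. F (hrep S n))) = G (ext_map S)"
proof (rule ext_map_hclassI)
  note r = ext_map_rep[OF S]
  have w: "T0 (hrep S n) \<in> hcarr W" for n by (rule T0_closed[OF hCauchy_mem[OF r(1)]])
  have "hCauchy W (\<lambda>n. G (T0 (hrep S n)))"
    by (rule hCauchy_compare[of W "\<lambda>n. T0 (hrep S n)" W "\<lambda>n. T0 (hrep S n)" _ _ "K / 2"])
      (use r(1) in \<open>auto simp: V_hCauchy w GW le\<close>)
  then show "hCauchy V (\<lambda>n. F (hrep S n))"
    by (simp add: V_hCauchy FV FG hCauchy_mem[OF r(1)])
  show "G (ext_map S) \<in> hcarr W" by (rule GW[OF r(2)])
  show "(\<lambda>n. hdist W (T0 (F (hrep S n))) (G (ext_map S))) \<longlonglongrightarrow> 0"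
    by (rule null_compare[OF r(3) r(3), where K = "K / 2"])
      (simp_all add: FG hCauchy_mem[OF r(1)] le w r(2))
qed

text \<open>Two classes with the same limit in \<open>W\<close> have equivalent image sequences, hence coincide, because \<open>T0\<close>
  preserves distances; every vector of \<open>W\<close> is a limit of image vectors, whose preimages then form a
  Cauchy sequence.\<close>

lemma ext_map_iso: "bimod_iso (hcompletion V) W ext_map"
  unfolding bimod_iso_def
proof (intro conjI ballI allI)
  show "bij_betw ext_map (hcarr (hcompletion V)) (hcarr W)"
  proof (rule bij_betw_imageI[OF inj_onI])
    fix S U assume SU: "S \<in> hcarr (hcompletion V)" "U \<in> hcarr (hcompletion V)" and eq: "ext_map S = ext_map U"
    obtain s where s: "hCauchy V s" "S = hclass V s" using SU(1) by (auto simp: hcompletion_def)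
    obtain u where u: "hCauchy V u" "U = hclass V u" using SU(2) by (auto simp: hcompletion_def)
    have c: "hCauchy W (\<lambda>n. T0 (s n))" "hCauchy W (\<lambda>n. T0 (u n))" using s u by (auto simp: V_hCauchy)
    have eq: "hlim (\<lambda>n. T0 (s n)) = hlim (\<lambda>n. T0 (u n))" using eq s u by (simp add: ext_map_hclass)
    have "hclass W (\<lambda>n. T0 (s n)) = hclass W (\<lambda>n. hlim (\<lambda>n. T0 (s n)))"
      by (subst hclass_eq_iff) (simp_all add: c hlim hCauchy_const)
    moreover have "hclass W (\<lambda>n. T0 (u n)) = hclass W (\<lambda>n. hlim (\<lambda>n. T0 (s n)))"
      unfolding eq by (subst hclass_eq_iff) (simp_all add: c hlim hCauchy_const)
    ultimately have su: "hclass W (\<lambda>n. T0 (s n)) = hclass W (\<lambda>n. T0 (u n))" by simp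
    have "hclass V v = {t. hCauchy V t \<and> (\<lambda>n. T0 (t n)) \<in> hclass W (\<lambda>n. T0 (v n))}" if "hCauchy V v" for v
      using V_hclass[OF that] by (auto simp: hclass_def V_hCauchy)
    then show "S = U" using s u su by simp
  next
    have onto: "w \<in> ext_map ` hcarr (hcompletion V)" if w: "w \<in> hcarr W" for w
    proof -
      have "\<exists>u\<in>hcarr V. hdist W (T0 u) w < inverse (real (Suc n))" for n
        by (rule T0_dense[OF w]) simp
      then obtain s where sV: "\<And>n. s n \<in> hcarr V"
        and s: "\<And>n. hdist W (T0 (s n)) w < inverse (real (Suc n))" by metis
      have lim: "(\<lambda>n. hdist W (T0 (s n)) w) \<longlonglongrightarrow> 0"
        by (rule tendsto_sandwich[OF _ _ tendsto_const LIMSEQ_inverse_real_of_nat])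
          (auto intro!: always_eventually less_imp_le[OF s] simp del: of_nat_Suc)
      have "hCauchy W (\<lambda>n. T0 (s n))"
        unfolding hCauchy_def
      proof (intro conjI allI impI T0_closed sV)
        fix e :: real assume "e > 0"
        then obtain N where N: "\<forall>n\<ge>N. hdist W (T0 (s n)) w < e / 2"
          using order_tendstoD(2)[OF lim, of "e / 2"] unfolding eventually_sequentially by auto
        have "hdist W (T0 (s m)) (T0 (s n)) < e" if "m \<ge> N" "n \<ge> N" for m n
        proof -
          have "hdist W (T0 (s m)) (T0 (s n)) \<le> hdist W (T0 (s m)) w + hdist W w (T0 (s n))"
            by (intro hdist_triangle T0_closed sV w)
          then show ?thesis
            using N[rule_format, OF that(1)] N[rule_format, OF that(2)]
              hdist_commute[OF w T0_closed[OF sV], of n] by simp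
        qed
        then show "\<exists>N. \<forall>m\<ge>N. \<forall>n\<ge>N. hdist W (T0 (s m)) (T0 (s n)) < e" by blast
      qed
      then have c: "hCauchy V s" by (simp add: V_hCauchy sV)
      then have "ext_map (hclass V s) = w" by (rule ext_map_hclassI[OF _ w lim])
      then show "w \<in> ext_map ` hcarr (hcompletion V)" using c by (auto simp: hcompletion_def)
    qed
    then show "ext_map ` hcarr (hcompletion V) = hcarr W" using ext_map_rep(2) by blast
  qed
next
  fix S c assume S: "S \<in> hcarr (hcompletion V)"
  show "ext_map (hscale (hcompletion V) c S) = hscale W c (ext_map S)"
    unfolding hcompletion_def
    by (simp, rule ext_map_op[OF S, where K = "cmod c"]) (simp_all add: V_scale T0_scale closed hdist_hscale)
next
  fix S a assume S: "S \<in> hcarr (hcompletion V)"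
  show "ext_map (hract (hcompletion V) S a) = hract W (ext_map S) a"
    unfolding hcompletion_def
    by (simp, rule ext_map_op[OF S, where K = "norm a" and G = "\<lambda>x. hract W x a" and F = "\<lambda>x. hract V x a"])
      (simp_all add: V_ract T0_ract closed hdist_hract_le)
  show "ext_map (hlact (hcompletion V) a S) = hlact W a (ext_map S)"
    unfolding hcompletion_def
    by (simp, rule ext_map_op[OF S, where K = "norm a"])
      (simp_all add: V_lact T0_lact lact_closed hdiff_lact hnorm_lact_le closed)
next
  fix S U assume S: "S \<in> hcarr (hcompletion V)" and U: "U \<in> hcarr (hcompletion V)"
  note r = ext_map_rep[OF S] and q = ext_map_rep[OF U]
  have c: "hCauchy W (\<lambda>n. T0 (hrep S n))" "hCauchy W (\<lambda>n. T0 (hrep U n))"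
    using r(1) q(1) by (auto simp: V_hCauchy)
  note m = hCauchy_mem[OF r(1)] hCauchy_mem[OF q(1)] hCauchy_mem[OF c(1)] hCauchy_mem[OF c(2)]
  have "ext_map (hclass V (\<lambda>n. hadd V (hrep S n) (hrep U n))) = hadd W (ext_map S) (ext_map U)"
  proof (rule ext_map_hclassI)
    show "hCauchy V (\<lambda>n. hadd V (hrep S n) (hrep U n))"
      using hCauchy_hadd[OF c] by (simp add: V_hCauchy m V_add T0_add)
    show "hadd W (ext_map S) (ext_map U) \<in> hcarr W" by (intro closed r q)
    show "(\<lambda>n. hdist W (T0 (hadd V (hrep S n) (hrep U n))) (hadd W (ext_map S) (ext_map U))) \<longlonglongrightarrow> 0"
      by (rule null_compare[OF r(3) q(3), where K = 1]) (simp_all add: T0_add m hdist_hadd_le r q)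
  qed
  then show "ext_map (hadd (hcompletion V) S U) = hadd W (ext_map S) (ext_map U)" by (simp add: hcompletion_def)
  have "(\<lambda>n. hinn W (T0 (hrep S n)) (T0 (hrep U n)) - hinn W (ext_map S) (ext_map U)) \<longlonglongrightarrow> 0"
    by (rule inn_null[OF c hCauchy_const hCauchy_const]) (simp_all add: r q)
  then have "(\<lambda>n. hinn V (hrep S n) (hrep U n)) \<longlonglongrightarrow> hinn W (ext_map S) (ext_map U)"
    by (simp add: T0_inn m LIM_zero_iff)
  then show "hinn W (ext_map S) (ext_map U) = hinn (hcompletion V) S U"
    by (simp add: hcompletion_def limI)
qed

lemma ext_map_hembed: "u \<in> hcarr V \<Longrightarrow> ext_map (hembed V u) = T0 u"
  unfolding hembed_def
  by (rule ext_map_hclassI) (simp_all add: V_hCauchy T0_closed hCauchy_const)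

end



section \<open>The full group C*-algebra\<close>

subsection \<open>Linear combinations\<close>

definition lincomb :: "('k \<Rightarrow> 'b::cstar_algebra_1) \<Rightarrow> ('k \<Rightarrow>\<^sub>0 complex) \<Rightarrow> 'b" where
  "lincomb e f = (\<Sum>k\<in>Poly_Mapping.keys f. Poly_Mapping.lookup f k *\<^sub>C e k)"

lemma lincomb_superset:
  assumes "finite A" "Poly_Mapping.keys f \<subseteq> A"
  shows "lincomb e f = (\<Sum>k\<in>A. Poly_Mapping.lookup f k *\<^sub>C e k)"
  unfolding lincomb_def using assms by (intro sum.mono_neutral_left) (auto simp: in_keys_iff)

lemma lincomb_add: "lincomb e (f + h) = lincomb e f + lincomb e h"
proof -
  let ?A = "Poly_Mapping.keys f \<union> Poly_Mapping.keys h"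
  have "lincomb e (f + h) = (\<Sum>k\<in>?A. Poly_Mapping.lookup (f + h) k *\<^sub>C e k)"
    by (rule lincomb_superset) (use Poly_Mapping.keys_add[of f h] in auto)
  then show ?thesis
    using lincomb_superset[of ?A f e] lincomb_superset[of ?A h e]
    by (simp add: lookup_add scaleC_add_left sum.distrib)
qed

lemma lookup_map_times: "Poly_Mapping.lookup (Poly_Mapping.map ((*) c) f) k = c * Poly_Mapping.lookup f k"
  for c :: complex
  by (simp add: Poly_Mapping.map.rep_eq when_def)

lemma keys_map_times: "Poly_Mapping.keys (Poly_Mapping.map ((*) c) f) \<subseteq> Poly_Mapping.keys f"
  for c :: complex
  by (auto simp: in_keys_iff lookup_map_times)

lemma lincomb_scale: "lincomb e (Poly_Mapping.map ((*) c) f) = c *\<^sub>C lincomb e f"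
  using lincomb_superset[OF finite_keys keys_map_times, of e c f]
  by (simp add: lookup_map_times lincomb_def scaleC_sum_right scaleC_scaleC)

lemma lincomb_single: "lincomb e (Poly_Mapping.single k c) = c *\<^sub>C e k"
  using lincomb_superset[of "{k}" "Poly_Mapping.single k c" e] by simp

lemma lincomb_zero [simp]: "lincomb e 0 = 0"
  by (simp add: lincomb_def)


subsection \<open>Density of the group algebra\<close>

lemma embed_add: "group_algebra_embed (f + h) = group_algebra_embed f + group_algebra_embed h"
  by (simp add: group_algebra_embed_def plus_group_cstar.abs_eq)

lemma embed_diff: "group_algebra_embed (f - h) = group_algebra_embed f - group_algebra_embed h"
  by (simp add: group_algebra_embed_def minus_group_cstar.abs_eq)

lemma embed_mult: "group_algebra_embed (f * h) = group_algebra_embed f * group_algebra_embed h"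
  by (simp add: group_algebra_embed_def times_group_cstar.abs_eq)

lemma embed_star: "group_algebra_embed (gstar f) = star (group_algebra_embed f)"
  by (simp add: group_algebra_embed_def star_group_cstar.abs_eq)

lemma embed_scale: "group_algebra_embed (Poly_Mapping.map ((*) c) f) = c *\<^sub>C group_algebra_embed f"
  by (simp add: group_algebra_embed_def scaleC_group_cstar.abs_eq)

lemma embed_one: "group_algebra_embed 1 = 1"
  by (simp add: group_algebra_embed_def one_group_cstar_def)

lemma norm_embed: "norm (group_algebra_embed f) = unorm f"
  by (simp add: group_algebra_embed_def norm_group_cstar.abs_eq)

lemma embed_eq_lincomb: "group_algebra_embed f = lincomb cstar_delta f"
proof (induction f rule: poly_mapping_single_induct)
  case (single g c)
  have "Poly_Mapping.single g c = Poly_Mapping.map ((*) c) (Poly_Mapping.single g 1)"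
    by (rule poly_mapping_eqI) (simp add: lookup_map_times lookup_single when_def)
  then have "group_algebra_embed (Poly_Mapping.single g c) = c *\<^sub>C group_algebra_embed (Poly_Mapping.single g 1)"
    by (metis embed_scale)
  then show ?case by (simp add: lincomb_single cstar_delta_def)
qed (simp add: embed_add lincomb_add)

lemma embed_dense:
  fixes x :: "'g::group_add group_cstar"
  obtains f where "(\<lambda>n. group_algebra_embed (f n)) \<longlonglongrightarrow> x"
proof -
  obtain s where s: "x = abs_group_cstar s" "gCauchy s"
    by (induction x rule: group_cstar.abs_induct) (auto simp: geq_refl)
  have "(\<lambda>n. group_algebra_embed (s n)) \<longlonglongrightarrow> x"
  proof (rule LIMSEQ_I)
    fix e :: real assume "e > 0"
    then obtain N where N: "\<forall>m\<ge>N. \<forall>n\<ge>N. unorm (s m - s n) < e / 2"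
      using s(2) unfolding gCauchy_def by (meson half_gt_zero)
    have "norm (group_algebra_embed (s n) - x) < e" if "n \<ge> N" for n
    proof -
      have "norm (group_algebra_embed (s n) - x) = lim (\<lambda>m. unorm (s n - s m))"
        using s by (simp add: group_algebra_embed_def minus_group_cstar.abs_eq norm_group_cstar.abs_eq)
      also have "\<dots> \<le> e / 2"
        by (rule LIMSEQ_le_const2[OF gCauchy_convergent])
          (use s N that in \<open>auto intro!: exI[of _ N] less_imp_le\<close>)
      finally show ?thesis using \<open>e > 0\<close> by simp
    qed
    then show "\<exists>N. \<forall>n\<ge>N. norm (group_algebra_embed (s n) - x) < e" by blast
  qed
  then show thesis by (rule that)
qed

lemma bounded_linear_embed_eqI:
  fixes S T :: "'g::group_add group_cstar \<Rightarrow> 'b::real_normed_vector"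
  assumes "bounded_linear S" "bounded_linear T"
    and eq: "\<And>f. S (group_algebra_embed f) = T (group_algebra_embed f)"
  shows "S x = T x"
proof -
  obtain f where f: "(\<lambda>n. group_algebra_embed (f n)) \<longlonglongrightarrow> x" by (rule embed_dense)
  from bounded_linear.tendsto[OF assms(1) f] bounded_linear.tendsto[OF assms(2) f]
  show ?thesis unfolding eq by (rule LIMSEQ_unique)
qed

definition bounded_clinear :: "('a::cstar_algebra_1 \<Rightarrow> 'b::cstar_algebra_1) \<Rightarrow> bool" where
  "bounded_clinear T \<longleftrightarrow> bounded_linear T \<and> (\<forall>c x. T (c *\<^sub>C x) = c *\<^sub>C T x)"

lemma bounded_clinear_lincomb:
  assumes "bounded_clinear T"
  shows "T (lincomb e f) = lincomb (\<lambda>k. T (e k)) f"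
proof -
  interpret bounded_linear T using assms by (simp add: bounded_clinear_def)
  show ?thesis using assms by (simp add: lincomb_def sum bounded_clinear_def)
qed

lemma delta_eqI:
  fixes S T :: "'g::group_add group_cstar \<Rightarrow> 'b::cstar_algebra_1"
  assumes S: "bounded_clinear S" and T: "bounded_clinear T"
    and eq: "\<And>g. S (cstar_delta g) = T (cstar_delta g)"
  shows "S x = T x"
proof (rule bounded_linear_embed_eqI)
  show "bounded_linear S" "bounded_linear T" using S T by (simp_all add: bounded_clinear_def)
  show "S (group_algebra_embed f) = T (group_algebra_embed f)" for f
    by (simp add: embed_eq_lincomb bounded_clinear_lincomb[OF S] bounded_clinear_lincomb[OF T] eq)
qed

text \<open>The extension at \<open>x\<close> is the limit of \<open>T0\<close> along any sequence in the group algebra that converges to \<open>x\<close>;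
  boundedness makes it independent of the sequence.\<close>

lemma extend_bounded_clinear:
  fixes T0 :: "('g::group_add \<Rightarrow>\<^sub>0 complex) \<Rightarrow> 'b::cstar_algebra_1"
  assumes add: "\<And>f h. T0 (f + h) = T0 f + T0 h"
    and scale: "\<And>c f. T0 (Poly_Mapping.map ((*) c) f) = c *\<^sub>C T0 f"
    and bound: "\<And>f. norm (T0 f) \<le> K * unorm f" and K: "K \<ge> 0"
  obtains T :: "'g group_cstar \<Rightarrow> 'b" where "bounded_clinear T"
    "\<And>f. T (group_algebra_embed f) = T0 f" "\<And>x. norm (T x) \<le> K * norm x"
proof -
  have diff: "T0 (f - h) = T0 f - T0 h" for f h
    using add[of "f - h" h] by simp
  have "\<exists>f. (\<lambda>n. group_algebra_embed (f n)) \<longlonglongrightarrow> x" for x :: "'g group_cstar"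
    using embed_dense[of x] by blast
  then obtain F where F: "\<And>x :: 'g group_cstar. (\<lambda>n. group_algebra_embed (F x n)) \<longlonglongrightarrow> x" by metis
  define T where "T x = lim (\<lambda>n. T0 (F x n))" for x
  have T: "(\<lambda>n. T0 (f n)) \<longlonglongrightarrow> T x" if f: "(\<lambda>n. group_algebra_embed (f n)) \<longlonglongrightarrow> x" for f x
  proof -
    have "Cauchy (\<lambda>n. T0 (F x n))"
      unfolding Cauchy_def
    proof (intro allI impI)
      fix e :: real assume "e > 0"
      then have e: "e / (K + 1) > 0" using K by simp
      obtain N where N: "\<forall>m\<ge>N. \<forall>n\<ge>N. norm (group_algebra_embed (F x m) - group_algebra_embed (F x n)) < e / (K + 1)"
        using CauchyD[OF LIMSEQ_imp_Cauchy[OF F] e] by blast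
      have "dist (T0 (F x m)) (T0 (F x n)) < e" if "m \<ge> N" "n \<ge> N" for m n
      proof -
        have "dist (T0 (F x m)) (T0 (F x n)) \<le> K * unorm (F x m - F x n)"
          using bound[of "F x m - F x n"] by (simp add: dist_norm diff)
        also have "\<dots> \<le> (K + 1) * unorm (F x m - F x n)"
          by (intro mult_right_mono unorm_nonneg) simp
        also have "\<dots> < (K + 1) * (e / (K + 1))"
          using N that K by (intro mult_strict_left_mono) (auto simp: norm_embed simp flip: embed_diff)
        finally show ?thesis using K by simp
      qed
      then show "\<exists>N. \<forall>m\<ge>N. \<forall>n\<ge>N. dist (T0 (F x m)) (T0 (F x n)) < e" by blast
    qed
    then have 1: "(\<lambda>n. T0 (F x n)) \<longlonglongrightarrow> T x"
      by (simp add: T_def Cauchy_convergent_iff convergent_LIMSEQ_iff)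
    have "(\<lambda>n. T0 (f n - F x n)) \<longlonglongrightarrow> 0"
    proof (rule Lim_null_comparison[OF always_eventually])
      show "\<forall>n. norm (T0 (f n - F x n)) \<le> K * norm (group_algebra_embed (f n) - group_algebra_embed (F x n))"
        using bound by (simp add: norm_embed flip: embed_diff)
      show "(\<lambda>n. K * norm (group_algebra_embed (f n) - group_algebra_embed (F x n))) \<longlonglongrightarrow> 0"
        using tendsto_mult_left[OF tendsto_norm[OF tendsto_diff[OF f F[of x]]], of K] by simp
    qed
    from tendsto_add[OF this 1] show ?thesis by (simp add: diff)
  qed
  have Tn: "norm (T x) \<le> K * norm x" for x
  proof (rule LIMSEQ_le)
    show "(\<lambda>n. norm (T0 (F x n))) \<longlonglongrightarrow> norm (T x)" by (intro tendsto_norm T F)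
    show "(\<lambda>n. K * norm (group_algebra_embed (F x n))) \<longlonglongrightarrow> K * norm x"
      by (intro tendsto_intros F)
  qed (use bound in \<open>simp add: norm_embed\<close>)
  have Tadd: "T (x + y) = T x + T y" for x y
  proof (rule LIMSEQ_unique)
    have "(\<lambda>n. group_algebra_embed (F x n + F y n)) \<longlonglongrightarrow> x + y"
      unfolding embed_add by (intro tendsto_add F)
    then show "(\<lambda>n. T0 (F x n + F y n)) \<longlonglongrightarrow> T (x + y)" by (rule T)
    show "(\<lambda>n. T0 (F x n + F y n)) \<longlonglongrightarrow> T x + T y"
      unfolding add by (intro tendsto_add T F)
  qed
  have Tscale: "T (c *\<^sub>C x) = c *\<^sub>C T x" for c x
  proof (rule LIMSEQ_unique)
    have "(\<lambda>n. group_algebra_embed (Poly_Mapping.map ((*) c) (F x n))) \<longlonglongrightarrow> c *\<^sub>C x"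
      unfolding embed_scale by (intro bounded_linear.tendsto[OF bounded_linear_scaleC] F)
    then show "(\<lambda>n. T0 (Poly_Mapping.map ((*) c) (F x n))) \<longlonglongrightarrow> T (c *\<^sub>C x)" by (rule T)
    show "(\<lambda>n. T0 (Poly_Mapping.map ((*) c) (F x n))) \<longlonglongrightarrow> c *\<^sub>C T x"
      unfolding scale by (intro bounded_linear.tendsto[OF bounded_linear_scaleC] T F)
  qed
  have "bounded_linear T"
    using Tn Tscale[of "complex_of_real r" for r]
    by (intro bounded_linear_intro[where K = K]) (simp_all add: Tadd scaleC_of_real mult.commute)
  then have "bounded_clinear T" by (simp add: bounded_clinear_def Tscale)
  moreover have "T (group_algebra_embed f) = T0 f" for f
    using T[of "\<lambda>n. f"] by (simp add: LIMSEQ_const_iff)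
  ultimately show thesis using Tn that by blast
qed


subsection \<open>Positive functionals determine the norm\<close>

text \<open>The vector functionals of representations of the group algebra extend to positive functionals
  on the completion, and by definition the universal norm is the supremum over them.\<close>

lemma vector_functional:
  fixes H :: "(complex, (nat \<Rightarrow> ('g::group_add \<Rightarrow>\<^sub>0 complex)) set) hmod"
  assumes r: "star_rep H \<rho>" and x: "x \<in> hcarr H"
  obtains \<phi> :: "'g group_cstar \<Rightarrow> complex" where "positive_functional \<phi>"
    "\<And>f. \<phi> (group_algebra_embed f) = hinn H x (\<rho> f x)" "\<And>y. cmod (\<phi> y) \<le> (hnorm H x)\<^sup>2 * norm y"
proof -
  interpret star_rep H \<rho> by (rule r)
  obtain \<phi> :: "'g group_cstar \<Rightarrow> complex" where \<phi>: "bounded_clinear \<phi>"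
    "\<And>f. \<phi> (group_algebra_embed f) = hinn H x (\<rho> f x)" "\<And>y. norm (\<phi> y) \<le> (hnorm H x)\<^sup>2 * norm y"
  proof (rule extend_bounded_clinear[of "\<lambda>f. hinn H x (\<rho> f x)" "(hnorm H x)\<^sup>2"])
    fix f :: "'g \<Rightarrow>\<^sub>0 complex"
    have "cmod (hinn H x (\<rho> f x)) \<le> hnorm H x * hnorm H (\<rho> f x)"
      by (intro cauchy_schwarz x rep_closed)
    also have "\<dots> \<le> hnorm H x * (unorm f * hnorm H x)"
      by (intro mult_left_mono unorm_bound[OF r x] hnorm_nonneg)
    finally show "norm (hinn H x (\<rho> f x)) \<le> (hnorm H x)\<^sup>2 * unorm f"
      by (simp add: power2_eq_square mult_ac)
  qed (auto simp: rep_add rep_scale x inn_add inn_scale rep_closed)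
  interpret \<phi>: bounded_linear \<phi> using \<phi>(1) by (simp add: bounded_clinear_def)
  have "positive_functional \<phi>"
    unfolding positive_functional_def
  proof (intro conjI allI)
    show "\<phi> (c *\<^sub>C y) = c * \<phi> y" for c y
      using \<phi>(1) by (simp add: bounded_clinear_def scaleC_complex_def)
    fix y :: "'g group_cstar"
    obtain f where f: "(\<lambda>n. group_algebra_embed (f n)) \<longlonglongrightarrow> y" by (rule embed_dense)
    have "(\<lambda>n. \<phi> (group_algebra_embed (gstar (f n) * f n))) \<longlonglongrightarrow> \<phi> (star y * y)"
      unfolding embed_mult embed_star
      by (intro \<phi>.tendsto tendsto_mult bounded_linear.tendsto[OF bounded_linear_star] f)
    moreover have "\<phi> (group_algebra_embed (gstar (f n) * f n)) \<in> \<real>\<^sub>\<ge>\<^sub>0" for n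
      using rep_hnorm_sq[OF x, of "f n", symmetric] by (simp add: \<phi>(2) del: of_real_power)
    ultimately show "\<phi> (star y * y) \<in> \<real>\<^sub>\<ge>\<^sub>0"
      by (rule closed_sequentially[OF closed_nonneg_Reals_complex, rotated])
  qed (rule \<phi>.add)
  then show thesis by (rule that[OF _ \<phi>(2,3)])
qed

instance group_cstar :: (group_add) cstar_states
proof
  fix B :: real and a :: "'a group_cstar"
  assume B: "0 \<le> B"
    and le: "\<And>\<phi> :: 'a group_cstar \<Rightarrow> complex. positive_functional \<phi> \<Longrightarrow>
      Re (\<phi> (star a * a)) \<le> B * Re (\<phi> 1)"
  obtain f where f: "(\<lambda>n. group_algebra_embed (f n)) \<longlonglongrightarrow> a" by (rule embed_dense)
  \<comment> \<open>The hypothesis concerns \<open>a\<close>; for its approximants it holds up to the error \<open>e n\<close>.\<close>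
  define e where "e n = norm (star (group_algebra_embed (f n)) * group_algebra_embed (f n) - star a * a)" for n
  have "(unorm (f n))\<^sup>2 \<le> B + e n" for n
  proof -
    have "unorm (f n) \<le> sqrt (B + e n)"
    proof (rule unorm_least)
      show "0 \<le> sqrt (B + e n)" using B by (simp add: e_def)
      fix H :: "(complex, (nat \<Rightarrow> ('a \<Rightarrow>\<^sub>0 complex)) set) hmod" and \<rho> :: "('a \<Rightarrow>\<^sub>0 complex) \<Rightarrow> _" and x
      assume r: "star_rep H \<rho>" and x: "x \<in> hcarr H"
      interpret star_rep H \<rho> by (rule r)
      obtain \<phi> :: "'a group_cstar \<Rightarrow> complex" where \<phi>: "positive_functional \<phi>"
        "\<And>f. \<phi> (group_algebra_embed f) = hinn H x (\<rho> f x)" "\<And>y. cmod (\<phi> y) \<le> (hnorm H x)\<^sup>2 * norm y"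
        using vector_functional[OF r x] by blast
      define y where "y = group_algebra_embed (f n)"
      have 1: "\<phi> 1 = complex_of_real ((hnorm H x)\<^sup>2)"
        using \<phi>(2)[of 1] x by (simp add: embed_one rep_one inn_self_real)
      have "\<phi> (star y * y) = complex_of_real ((hnorm H (\<rho> (f n) x))\<^sup>2)"
        using rep_hnorm_sq[OF x, of "f n"] \<phi>(2)[of "gstar (f n) * f n"]
        by (simp add: y_def embed_mult embed_star)
      then have "(hnorm H (\<rho> (f n) x))\<^sup>2 = Re (\<phi> (star y * y))" by simp
      also have "\<dots> = Re (\<phi> (star a * a)) + Re (\<phi> (star y * y - star a * a))"
        by (simp add: pf_diff[OF \<phi>(1)])
      also have "\<dots> \<le> B * (hnorm H x)\<^sup>2 + (hnorm H x)\<^sup>2 * e n"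
      proof (rule add_mono)
        show "Re (\<phi> (star a * a)) \<le> B * (hnorm H x)\<^sup>2" using le[OF \<phi>(1)] by (simp add: 1)
        show "Re (\<phi> (star y * y - star a * a)) \<le> (hnorm H x)\<^sup>2 * e n"
          using complex_Re_le_cmod \<phi>(3)[of "star y * y - star a * a"] unfolding e_def y_def
          by (rule order_trans)
      qed
      also have "\<dots> = (sqrt (B + e n) * hnorm H x)\<^sup>2"
        using B by (simp add: power_mult_distrib e_def algebra_simps)
      finally show "hnorm H (\<rho> (f n) x) \<le> sqrt (B + e n) * hnorm H x"
        by (rule power2_le_imp_le) (use B in \<open>simp add: e_def\<close>)
    qed
    then have "(unorm (f n))\<^sup>2 \<le> (sqrt (B + e n))\<^sup>2"
      by (intro power_mono unorm_nonneg)
    then show ?thesis using B by (simp add: e_def)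
  qed
  moreover have "(\<lambda>n. (unorm (f n))\<^sup>2) \<longlonglongrightarrow> (norm a)\<^sup>2"
    unfolding norm_embed[symmetric] by (intro tendsto_intros f)
  moreover have "(\<lambda>n. B + e n) \<longlonglongrightarrow> B + norm (star a * a - star a * a)"
    unfolding e_def by (intro tendsto_intros bounded_linear.tendsto[OF bounded_linear_star] f)
  ultimately have "(norm a)\<^sup>2 \<le> B + norm (star a * a - star a * a)"
    by (intro LIMSEQ_le[of "\<lambda>n. (unorm (f n))\<^sup>2" _ "\<lambda>n. B + e n"]) auto
  then show "(norm a)\<^sup>2 \<le> B" by simp
qed



section \<open>Positive functionals on the group algebra\<close>

lemma hilbert_module_truncate:
  assumes "hilbert_module H"
  shows "hilbert_module (hmod.truncate H)"
  using assms unfolding hilbert_module_def pre_hilbert_module_def hilbert_module_axioms_def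
    hCauchy_def hnorm_def hdiff_def hmod.truncate_def hmod.select_convs .

text \<open>The construction of Gelfand, Naimark and Segal: left multiplication represents the group algebra
  on the completion with respect to \<open>\<langle>f, h\<rangle> = \<psi>(f\<^sup>* h)\<close>, and the unit is a vector whose length is the
  square root of \<open>\<psi>(1)\<close>. Group elements act by isometries, so that multiplications are bounded.\<close>

locale group_algebra_functional =
  fixes \<psi> :: "('g::group_add \<Rightarrow>\<^sub>0 complex) \<Rightarrow> complex"
  assumes \<psi>_add: "\<psi> (f + h) = \<psi> f + \<psi> h"
    and \<psi>_scale: "\<psi> (Poly_Mapping.map ((*) c) f) = c * \<psi> f"
    and \<psi>_pos: "\<psi> (gstar f * f) \<in> \<real>\<^sub>\<ge>\<^sub>0"
begin

abbreviation gmul :: "complex \<Rightarrow> ('g \<Rightarrow>\<^sub>0 complex) \<Rightarrow> ('g \<Rightarrow>\<^sub>0 complex)" where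
  "gmul c \<equiv> Poly_Mapping.map ((*) c)"

lemma gmul_mult_left: "gmul c f * h = gmul c (f * h)"
  by (simp add: gmap_eq mult.assoc)

lemma gmul_add: "gmul c (f + h) = gmul c f + gmul c h"
  by (simp add: gmap_eq distrib_left)

lemma gmul_add_left: "gmul (c + d) f = gmul c f + gmul d f"
  by (simp add: gmap_eq single_add distrib_right)

lemma gmul_minus_one: "gmul (-1) f = - f"
  by (simp add: gmap_eq single_uminus)

lemma \<psi>_gstar: "\<psi> (gstar f) = cnj (\<psi> f)"
proof -
  have re: "Im (\<psi> (gstar h * h)) = 0" for h
    using \<psi>_pos by (simp add: complex_nonneg_Reals_iff)
  have *: "Im (\<psi> (h + gstar h)) = 0" for h
  proof -
    have "gstar (h + 1) * (h + 1) = gstar h * h + (h + gstar h) + gstar 1 * 1"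
      by (simp add: gstar_add gstar_one algebra_simps)
    then have "\<psi> (gstar (h + 1) * (h + 1)) = \<psi> (gstar h * h) + \<psi> (h + gstar h) + \<psi> (gstar 1 * 1)"
      by (simp add: \<psi>_add)
    then show ?thesis using re[of "h + 1"] re[of h] re[of 1] by simp
  qed
  from *[of f] *[of "gmul \<i> f"] show ?thesis
    by (simp add: \<psi>_add \<psi>_scale gstar_gmap complex_eq_iff)
qed

definition gns :: "(complex, 'g \<Rightarrow>\<^sub>0 complex) hbimod" where
  "gns = \<lparr>hcarr = UNIV, hzero = 0, hadd = (+), hscale = gmul, hract = (\<lambda>u c. gmul c u),
     hinn = (\<lambda>f h. \<psi> (gstar f * h)), hlact = gmul\<rparr>"

lemma gns_simps [simp]: "hcarr gns = UNIV" "hzero gns = 0" "hadd gns = (+)" "hscale gns = gmul"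
    "hract gns u c = gmul c u" "hinn gns f h = \<psi> (gstar f * h)" "hlact gns = gmul"
    "hdiff gns f h = f - h"
  by (simp_all add: gns_def hdiff_def gmul_minus_one)

sublocale V: completable_bimodule gns
proof
  show "cpos (hinn gns f f)" for f
  proof -
    obtain r where r: "r \<ge> 0" "\<psi> (gstar f * f) = complex_of_real r"
      using \<psi>_pos[of f] by (auto elim: nonneg_Reals_cases)
    then have "hinn gns f f = star (complex_of_real (sqrt r)) * complex_of_real (sqrt r)"
      by (simp add: star_complex_def flip: of_real_mult)
    then show ?thesis unfolding cpos_def by blast
  qed
  show "star (hinn gns f h) = hinn gns h f" for f h
    using \<psi>_gstar[of "gstar f * h"] by (simp add: star_complex_def gstar_mult gstar_gstar)
qed (simp_all add: adjoint_pair_def star_complex_def scaleC_complex_def \<psi>_add \<psi>_scale gmul_add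
    gmul_add_left gmap_gmap gmap_one distrib_left gmap_mult_right gmul_mult_left gstar_gmap algebra_simps)

lemma mult_bounded: "\<exists>K\<ge>0. \<forall>x. hnorm gns (f * x) \<le> K * hnorm gns x"
proof (induction f rule: poly_mapping_single_induct)
  case (single g c)
  have "hnorm gns (Poly_Mapping.single g c * x) = cmod c * hnorm gns x" for x
  proof -
    have "gstar (Poly_Mapping.single g c * x) * (Poly_Mapping.single g c * x) =
        gstar x * (Poly_Mapping.single 0 (cnj c * c) * x)"
      by (simp add: gstar_mult gstar_single mult_single flip: mult.assoc)
        (simp add: mult_single mult.assoc)
    also have "\<dots> = gmul (cnj c * c) (gstar x * x)"
      by (simp add: gmap_mult_right flip: gmap_eq)
    finally show ?thesis by (simp add: hnorm_def \<psi>_scale norm_mult real_sqrt_mult)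
  qed
  then show ?case by (intro exI[of _ "cmod c"]) simp
next
  case (sum f1 f2)
  then obtain K1 K2 where K: "K1 \<ge> 0" "K2 \<ge> 0"
    "\<And>x. hnorm gns (f1 * x) \<le> K1 * hnorm gns x" "\<And>x. hnorm gns (f2 * x) \<le> K2 * hnorm gns x"
    by blast
  have "hnorm gns ((f1 + f2) * x) \<le> (K1 + K2) * hnorm gns x" for x
    using V.hnorm_add_le[of "f1 * x" "f2 * x"] K(3,4)[of x] by (simp add: distrib_right)
  then show ?case using K by (intro exI[of _ "K1 + K2"]) simp
qed

definition lrep :: "('g \<Rightarrow>\<^sub>0 complex) \<Rightarrow> (nat \<Rightarrow> 'g \<Rightarrow>\<^sub>0 complex) set \<Rightarrow> (nat \<Rightarrow> 'g \<Rightarrow>\<^sub>0 complex) set" where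
  "lrep f S = hclass gns (\<lambda>n. f * hrep S n)"

lemma lrep:
  assumes s: "hCauchy gns s"
  shows "hCauchy gns (\<lambda>n. f * s n)" "lrep f (hclass gns s) = hclass gns (\<lambda>n. f * s n)"
proof -
  obtain K where K: "\<And>x. hnorm gns (f * x) \<le> K * hnorm gns x" using mult_bounded[of f] by blast
  have "hdist gns (f * x) (f * y) \<le> K * hdist gns x y" for x y
    using K[of "x - y"] by (simp add: right_diff_distrib)
  then show "hCauchy gns (\<lambda>n. f * s n)" "lrep f (hclass gns s) = hclass gns (\<lambda>n. f * s n)"
    unfolding lrep_def by (auto intro!: V.hclass_rep_op[OF s])
qed

abbreviation H :: "(complex, (nat \<Rightarrow> 'g \<Rightarrow>\<^sub>0 complex) set) hmod" where
  "H \<equiv> hmod.truncate V.C"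

lemma H_simps: "hcarr H = hcarr V.C" "hadd H = hadd V.C" "hscale H = hscale V.C" "hinn H = hinn V.C"
    "hnorm H = hnorm V.C"
  by (simp_all add: hmod.truncate_def hnorm_def fun_eq_iff)

lemma lrep_star_rep: "star_rep H lrep"
proof (rule star_rep.intro[OF hilbert_module_truncate[OF V.comp_hilbert_module] star_rep_axioms.intro])
  show "adjoint_pair H (lrep f) (lrep (gstar f))" for f
    unfolding adjoint_pair_def H_simps
  proof (intro conjI ballI)
    fix S T assume "S \<in> hcarr V.C" "T \<in> hcarr V.C"
    then obtain s t where s: "hCauchy gns s" "S = hclass gns s" and t: "hCauchy gns t" "T = hclass gns t"
      by (auto elim!: V.comp_cases)
    have "(\<lambda>n. hinn gns (f * s n) (t n)) \<longlonglongrightarrow> hinn V.C S (lrep (gstar f) T)"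
      using V.comp_inn[OF s(1) lrep(1)[OF t(1), of "gstar f"]] s t
      by (simp add: lrep gstar_mult mult.assoc)
    then show "hinn V.C (lrep f S) T = hinn V.C S (lrep (gstar f) T)"
      using s t by (simp add: lrep V.comp_inn_eqI)
  qed (auto elim!: V.comp_cases simp: lrep V.comp_carrI)
  fix S f h c assume "S \<in> hcarr H"
  then obtain s where s: "hCauchy gns s" "S = hclass gns s"
    unfolding H_simps by (auto elim!: V.comp_cases)
  show "lrep (f + h) S = hadd H (lrep f S) (lrep h S)"
    "lrep (gmul c f) S = hscale H c (lrep f S)"
    "lrep (f * h) S = lrep f (lrep h S)" "lrep 1 S = S"
    using s by (simp_all add: H_simps lrep V.comp_add V.comp_scale distrib_right gmul_mult_left mult.assoc)
qed

lemma \<psi>_le_unorm: "Re (\<psi> (gstar f * f)) \<le> (unorm f)\<^sup>2 * Re (\<psi> 1)"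
proof -
  have c: "hCauchy gns (\<lambda>n. h)" for h by (rule V.hCauchy_const) simp
  have n: "hnorm V.C (hclass gns (\<lambda>n. h)) = hnorm gns h" for h
    using V.comp_hnorm[OF c[of h]] by (simp add: LIMSEQ_const_iff)
  have p: "(hnorm gns h)\<^sup>2 = Re (\<psi> (gstar h * h))" for h
    using \<psi>_pos[of h] by (auto simp: hnorm_power2 elim: nonneg_Reals_cases)
  have "hnorm H (lrep f (hclass gns (\<lambda>n. 1))) \<le> unorm f * hnorm H (hclass gns (\<lambda>n. 1))"
    by (rule unorm_bound[OF lrep_star_rep]) (simp add: H_simps V.comp_carrI c)
  then have "hnorm gns f \<le> unorm f * hnorm gns 1"
    by (simp add: H_simps lrep c n)
  then have "(hnorm gns f)\<^sup>2 \<le> (unorm f * hnorm gns 1)\<^sup>2"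
    by (intro power_mono) simp_all
  then show ?thesis by (simp add: power_mult_distrib p gstar_one)
qed

end

text \<open>For a positive functional \<open>\<phi>\<close> the Schwarz inequality makes \<open>\<phi> \<circ> T\<close> positive on the group algebra and bounds
  \<open>\<phi>(T(f)\<^sup>* T(f))\<close> by \<open>\<phi>(T(f\<^sup>* f))\<close>, to which the estimate from the GNS representation applies.
  This covers *-homomorphisms as well as conditional expectations.\<close>

lemma schwarz_contractive:
  fixes T :: "('g::group_add \<Rightarrow>\<^sub>0 complex) \<Rightarrow> 'b::cstar_states"
  assumes add: "\<And>f h. T (f + h) = T f + T h"
    and scale: "\<And>c f. T (Poly_Mapping.map ((*) c) f) = c *\<^sub>C T f"
    and one: "T 1 = 1" and schwarz: "\<And>f. cpos (T (gstar f * f) - star (T f) * T f)"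
  shows "norm (T f) \<le> unorm f"
proof -
  have "Re (\<phi> (star (T f) * T f)) \<le> (unorm f)\<^sup>2 * Re (\<phi> 1)" if pf: "positive_functional \<phi>" for \<phi>
  proof -
    have "cpos (T (gstar h * h))" for h
      using cpos_add[OF schwarz[of h] cpos_star_mult[of "T h"]] by simp
    then interpret group_algebra_functional "\<lambda>h. \<phi> (T h)"
      by unfold_locales (simp_all add: add scale pf_add[OF pf] pf_scale[OF pf] pf_cpos[OF pf])
    have "Re (\<phi> (star (T f) * T f)) \<le> Re (\<phi> (T (gstar f * f)))"
      using pf_cpos[OF pf schwarz[of f]] by (simp add: pf_diff[OF pf] complex_nonneg_Reals_iff)
    also have "\<dots> \<le> (unorm f)\<^sup>2 * Re (\<phi> 1)" using \<psi>_le_unorm[of f] by (simp add: one)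
    finally show ?thesis .
  qed
  then have "(norm (T f))\<^sup>2 \<le> (unorm f)\<^sup>2" by (intro norm_le_by_states) simp_all
  then show ?thesis by (rule power2_le_imp_le) (rule unorm_nonneg)
qed


section \<open>Endomorphisms and transfer operators\<close>

lemma bounded_clinear_compose:
  "bounded_clinear S \<Longrightarrow> bounded_clinear T \<Longrightarrow> bounded_clinear (\<lambda>x. S (T x))"
  by (simp add: bounded_clinear_def bounded_linear_compose)

lemma bounded_clinear_mult_left: "bounded_clinear T \<Longrightarrow> bounded_clinear (\<lambda>x. T x * a)"
  by (simp add: bounded_clinear_def bounded_linear_compose[OF bounded_linear_mult_left] mult_scaleC_left)

lemma bounded_clinear_mult_right: "bounded_clinear T \<Longrightarrow> bounded_clinear (\<lambda>x. a * T x)"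
  by (simp add: bounded_clinear_def bounded_linear_compose[OF bounded_linear_mult_right] mult_scaleC_right)

lemma bounded_clinear_star: "bounded_clinear T \<Longrightarrow> bounded_clinear (\<lambda>x. star (T (star x)))"
  by (simp add: bounded_clinear_def star_scaleC
      bounded_linear_compose[OF bounded_linear_star bounded_linear_compose[OF _ bounded_linear_star]])

lemma bounded_clinear_ident: "bounded_clinear (\<lambda>x. x)"
  by (simp add: bounded_clinear_def bounded_linear_ident)

lemmas bounded_clinear_intros = bounded_clinear_mult_left bounded_clinear_mult_right
  bounded_clinear_ident

text \<open>Positivity of \<open>\<parallel>y\<parallel> \<plusminus> y\<close> is preserved, so that \<open>f\<close> is contractive on self-adjoint elements. Together with
  \<open>delta_eqI\<close> this determines such maps on the full group C*-algebra by their values on group elements.\<close>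

lemma unital_positive_linear_bounded:
  fixes f :: "'a::cstar_states \<Rightarrow> 'b::cstar_states"
  assumes f: "unital_positive_linear f"
  shows "bounded_clinear f"
proof -
  have add: "f (x + y) = f x + f y" and scale: "f (c *\<^sub>C x) = c *\<^sub>C f x"
    and pos: "cpos x \<Longrightarrow> cpos (f x)" and one: "f 1 = 1" for x y c
    using f by (auto simp: unital_positive_linear_def)
  have scaleR: "f (r *\<^sub>R x) = r *\<^sub>R f x" for r x
    using scale[of "complex_of_real r" x] by (simp add: scaleC_of_real)
  have minus: "f (- x) = - f x" for x
    using scale[of "-1" x] by (simp add: scaleC_minus_one)
  have sa: "norm (f y) \<le> norm y" if y: "star y = y" for y
  proof (cases "y = 0")
    case True
    then show ?thesis using scale[of 0 0] by simp
  next
    case False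
    have p: "cpos (norm y *\<^sub>R 1 + f y)" "cpos (norm y *\<^sub>R 1 - f y)"
      using pos[OF cpos_norm_minus(2)[OF y order_refl]] pos[OF cpos_norm_minus(1)[OF y order_refl]]
      by (simp_all add: add scaleR one minus diff_conv_add_uminus del: add_uminus_conv_diff)
    show ?thesis
    proof (rule norm_le_numerical_radius)
      show "star (f y) = f y" using cpos_selfadjoint[OF p(1)] by (simp add: star_add star_scaleR)
      fix \<phi> :: "'b \<Rightarrow> complex" assume pf: "positive_functional \<phi>"
      show "\<bar>Re (\<phi> (f y))\<bar> \<le> norm y * Re (\<phi> 1)"
        using pf_cpos[OF pf p(1)] pf_cpos[OF pf p(2)]
        unfolding pf_add[OF pf] pf_diff[OF pf] pf_scaleR[OF pf] complex_nonneg_Reals_iff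
        by (simp add: abs_le_iff)
    qed (use False in simp)
  qed
  have "norm (f x) \<le> norm x * 2" for x
  proof -
    define y where "y = x + star x"
    define z where "z = \<i> *\<^sub>C x + star (\<i> *\<^sub>C x)"
    have y: "star y = y" "norm y \<le> 2 * norm x"
      using norm_triangle_ineq[of x "star x"] by (simp_all add: y_def star_add star_star add.commute)
    have z: "star z = z" "norm z \<le> 2 * norm x"
      using norm_triangle_ineq[of "\<i> *\<^sub>C x" "star (\<i> *\<^sub>C x)"]
      by (simp_all add: z_def star_add star_star add.commute norm_scaleC)
    have "2 *\<^sub>R x = y + (- \<i>) *\<^sub>C z"
      by (simp add: y_def z_def scaleC_add_right scaleC_scaleC star_scaleC scaleC_minus_one scaleR_2)
    then have "f (2 *\<^sub>R x) = f (y + (- \<i>) *\<^sub>C z)" by simp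
    then have "2 *\<^sub>R f x = f y + (- \<i>) *\<^sub>C f z"
      by (simp only: add scale scaleR)
    then have "norm (2 *\<^sub>R f x) \<le> norm (f y) + norm ((- \<i>) *\<^sub>C f z)"
      by (simp only: norm_triangle_ineq)
    then show ?thesis using sa[OF y(1)] sa[OF z(1)] y(2) z(2) by (simp add: norm_scaleC)
  qed
  then have "bounded_linear f"
    by (intro bounded_linear_intro[where K = 2]) (simp_all add: add scaleR)
  then show ?thesis by (simp add: bounded_clinear_def scale)
qed

lemma unital_star_hom_positive: "unital_star_hom f \<Longrightarrow> unital_positive_linear f"
  unfolding unital_star_hom_def unital_positive_linear_def
  by (auto simp: cpos_def)

lemma delta_add: "cstar_delta (g + h) = cstar_delta g * cstar_delta h"
  by (simp add: cstar_delta_def mult_single flip: embed_mult)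

lemma delta_zero: "cstar_delta 0 = 1"
  by (simp add: cstar_delta_def embed_one)

lemma star_delta: "star (cstar_delta g) = cstar_delta (- g)"
  by (simp add: cstar_delta_def gstar_single flip: embed_star)

lemma embed_single: "group_algebra_embed (Poly_Mapping.single g 1) = cstar_delta g"
  by (simp add: cstar_delta_def)

text \<open>The sesquilinear form \<open>(f, h) \<mapsto> e(f\<^sup>* h)\<close> in terms of its kernel \<open>e(- k + l)\<close>.\<close>

lemma lincomb_gstar_mult:
  fixes e :: "'g::group_add \<Rightarrow> 'b::cstar_algebra_1"
  shows "lincomb e (gstar f * h) = (\<Sum>k\<in>Poly_Mapping.keys f. \<Sum>l\<in>Poly_Mapping.keys h.
     (cnj (Poly_Mapping.lookup f k) * Poly_Mapping.lookup h l) *\<^sub>C e (- k + l))"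
proof -
  have add1: "lincomb (\<lambda>l. a l + b l) h = lincomb a h + lincomb b h" for a b :: "'g \<Rightarrow> 'b" and h
    by (simp add: lincomb_def scaleC_add_right sum.distrib)
  have "lincomb e (gstar f * h) = lincomb (\<lambda>l. star (lincomb (\<lambda>k. star (e (- k + l))) f)) h"
  proof (induction f rule: poly_mapping_single_induct)
    case (single k c)
    show ?case
      by (induction h rule: poly_mapping_single_induct)
        (simp_all add: gstar_single mult_single lincomb_single star_scaleC star_star scaleC_scaleC
          mult.commute distrib_left lincomb_add)
  next
    case (sum f1 f2)
    then show ?case by (simp add: gstar_add distrib_right lincomb_add star_add add1)
  qed
  also have "\<dots> = (\<Sum>l\<in>Poly_Mapping.keys h. \<Sum>k\<in>Poly_Mapping.keys f.
     (cnj (Poly_Mapping.lookup f k) * Poly_Mapping.lookup h l) *\<^sub>C e (- k + l))"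
    by (simp add: lincomb_def star_sum star_scaleC star_star scaleC_sum_right scaleC_scaleC mult.commute)
  also have "\<dots> = (\<Sum>k\<in>Poly_Mapping.keys f. \<Sum>l\<in>Poly_Mapping.keys h.
     (cnj (Poly_Mapping.lookup f k) * Poly_Mapping.lookup h l) *\<^sub>C e (- k + l))"
    by (rule sum.swap)
  finally show ?thesis .
qed

locale group_mono =
  fixes t :: "'g::group_add \<Rightarrow> 'g"
  assumes t_add: "t (g + h) = t g + t h" and t_inj: "inj t"
begin

lemma t_zero: "t 0 = 0"
proof -
  have "- t 0 + (t 0 + t 0) = - t 0 + t 0" using t_add[of 0 0] by simp
  then show ?thesis by (simp flip: add.assoc)
qed

lemma t_minus: "t (- g) = - t g"
  using t_add[of "- g" g] by (simp add: t_zero eq_neg_iff_add_eq_0)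

lemma range_add: "g \<in> range t \<Longrightarrow> h \<in> range t \<Longrightarrow> g + h \<in> range t"
  by (auto simp flip: t_add)

lemma range_minus: "g \<in> range t \<Longrightarrow> - g \<in> range t"
  by (auto simp flip: t_minus)

lemma range_add_iff: "h \<in> range t \<Longrightarrow> h + g \<in> range t \<longleftrightarrow> g \<in> range t"
  using range_add[of "- h" "h + g"] range_add[of h g] range_minus[of h] by (auto simp flip: add.assoc)

lemma range_add_iff_right: "h \<in> range t \<Longrightarrow> g + h \<in> range t \<longleftrightarrow> g \<in> range t"
  using range_add[of "g + h" "- h"] range_add[of g h] range_minus[of h] by (auto simp: add.assoc)

text \<open>The values of the transfer operator on group elements.\<close>

definition tr :: "'g \<Rightarrow> 'g group_cstar" where
  "tr g = (if g \<in> range t then cstar_delta (inv t g) else 0)"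

lemma tr_t: "tr (t m) = cstar_delta m"
  by (simp add: tr_def t_inj)

lemma tr_add: "tr (t m + g) = cstar_delta m * tr g"
proof (cases "g \<in> range t")
  case True
  then obtain n where "g = t n" by blast
  then show ?thesis by (simp add: tr_t delta_add flip: t_add)
next
  case False
  then have "t m + g \<notin> range t" using range_add_iff[of "t m" g] by blast
  then show ?thesis using False by (simp add: tr_def)
qed

lemma tr_add_right: "tr (g + t m) = tr g * cstar_delta m"
proof (cases "g \<in> range t")
  case True
  then obtain n where "g = t n" by blast
  then show ?thesis by (simp add: tr_t delta_add flip: t_add)
next
  case False
  then have "g + t m \<notin> range t" using range_add_iff_right[of "t m" g] by blast
  then show ?thesis using False by (simp add: tr_def)
qed

lemma tr_minus: "tr (- g) = star (tr g)"
proof (cases "g \<in> range t")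
  case True
  then obtain n where "g = t n" by blast
  then show ?thesis by (simp add: tr_t star_delta flip: t_minus)
next
  case False
  then have "- g \<notin> range t" using range_minus[of "- g"] by auto
  then show ?thesis using False by (simp add: tr_def)
qed

text \<open>A transversal of the left cosets of \<open>range t\<close>, chosen such that the subgroup itself is represented
  by \<open>0\<close>.\<close>

definition coset_rep :: "'g \<Rightarrow> 'g" where
  "coset_rep k = (if k \<in> range t then 0 else SOME h. - h + k \<in> range t)"

lemma coset_rep: "- coset_rep k + k \<in> range t"
proof (cases "k \<in> range t")
  case False
  have "- k + k \<in> range t" using t_zero by (metis left_minus rangeI)
  then have "- (SOME h. - h + k \<in> range t) + k \<in> range t" by (rule someI)
  then show ?thesis using False by (simp add: coset_rep_def)
qed (simp add: coset_rep_def)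

lemma coset_rep_eqI:
  assumes "- j + k \<in> range t"
  shows "coset_rep k = coset_rep j"
proof -
  have *: "- h + k \<in> range t \<longleftrightarrow> - h + j \<in> range t" for h
    using range_add_iff_right[OF assms, of "- h + j"] by (simp add: add.assoc)
  then show ?thesis using *[of 0] by (simp add: coset_rep_def)
qed

text \<open>A coset other than that of \<open>k\<close> does not see \<open>k\<close>: this is what makes all but one term of the kernel vanish.\<close>

lemma coset_rep_cancel: "- coset_rep j + k \<in> range t \<Longrightarrow> coset_rep k = coset_rep j"
  using range_add[OF range_minus[OF coset_rep[of j]], of "- coset_rep j + k"]
  by (intro coset_rep_eqI) (simp add: minus_add add.assoc)

text \<open>The kernel of the transfer operator is block diagonal with respect to the cosets, and a product on
  each block.\<close>

lemma tr_kernel: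
  assumes K: "finite K" and k: "k \<in> K"
  shows "tr (- k + l) = (\<Sum>c\<in>insert 0 (coset_rep ` K). star (tr (- c + k)) * tr (- c + l))"
proof -
  have r0: "coset_rep 0 = 0" using t_zero by (metis coset_rep_def rangeI)
  obtain m where m: "- coset_rep k + k = t m" using coset_rep[of k] by blast
  have "tr (- k + l) = tr (t (- m) + (- coset_rep k + l))"
    by (simp add: t_minus minus_add add.assoc flip: m)
  also have "\<dots> = star (tr (- coset_rep k + k)) * tr (- coset_rep k + l)"
    unfolding tr_add by (simp add: m tr_t star_delta)
  also have "\<dots> = (\<Sum>c\<in>{coset_rep k}. star (tr (- c + k)) * tr (- c + l))" by simp
  also have "\<dots> = (\<Sum>c\<in>insert 0 (coset_rep ` K). star (tr (- c + k)) * tr (- c + l))"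
  proof (rule sum.mono_neutral_left)
    show "\<forall>c\<in>insert 0 (coset_rep ` K) - {coset_rep k}. star (tr (- c + k)) * tr (- c + l) = 0"
    proof
      fix c assume c: "c \<in> insert 0 (coset_rep ` K) - {coset_rep k}"
      then obtain j where "c = coset_rep j" using r0[symmetric] by blast
      then have "- c + k \<notin> range t" using c coset_rep_cancel[of j k] by auto
      then show "star (tr (- c + k)) * tr (- c + l) = 0" by (simp add: tr_def)
    qed
  qed (use K k in auto)
  finally show ?thesis .
qed

text \<open>Each block of the kernel contributes a square \<open>v\<^sub>c\<^sup>* v\<^sub>c\<close>, and \<open>v\<^sub>0\<close> is the value of the transfer operator
  at \<open>f\<close> itself.\<close>

lemma tr_schwarz: "cpos (lincomb tr (gstar f * f) - star (lincomb tr f) * lincomb tr f)"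
proof -
  define K where "K = Poly_Mapping.keys f"
  define D where "D = insert 0 (coset_rep ` K)"
  define v where "v c = (\<Sum>k\<in>K. Poly_Mapping.lookup f k *\<^sub>C tr (- c + k))" for c
  have "lincomb tr (gstar f * f) = (\<Sum>k\<in>K. \<Sum>l\<in>K. \<Sum>c\<in>D.
      (cnj (Poly_Mapping.lookup f k) * Poly_Mapping.lookup f l) *\<^sub>C (star (tr (- c + k)) * tr (- c + l)))"
    unfolding lincomb_gstar_mult K_def[symmetric] D_def
    by (intro sum.cong refl, subst tr_kernel) (simp_all add: K_def scaleC_sum_right)
  also have "\<dots> = (\<Sum>k\<in>K. \<Sum>c\<in>D. \<Sum>l\<in>K.
      (cnj (Poly_Mapping.lookup f k) * Poly_Mapping.lookup f l) *\<^sub>C (star (tr (- c + k)) * tr (- c + l)))"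
    by (intro sum.cong refl sum.swap)
  also have "\<dots> = (\<Sum>c\<in>D. \<Sum>k\<in>K. \<Sum>l\<in>K.
      (cnj (Poly_Mapping.lookup f k) * Poly_Mapping.lookup f l) *\<^sub>C (star (tr (- c + k)) * tr (- c + l)))"
    by (rule sum.swap)
  also have "\<dots> = (\<Sum>c\<in>D. star (v c) * v c)"
    by (simp add: v_def star_sum star_scaleC sum_product mult_scaleC_left mult_scaleC_right scaleC_scaleC mult.commute)
  also have "\<dots> = star (v 0) * v 0 + (\<Sum>c\<in>D - {0}. star (v c) * v c)"
    by (rule sum.remove) (simp_all add: D_def K_def)
  finally have "lincomb tr (gstar f * f) - star (v 0) * v 0 = (\<Sum>c\<in>D - {0}. star (v c) * v c)"
    by simp
  moreover have "v 0 = lincomb tr f" by (simp add: v_def lincomb_def K_def)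
  ultimately show ?thesis by (simp add: cpos_sum)
qed

lemma transfer_exists:
  obtains L where "unital_positive_linear L" "\<And>g. L (cstar_delta g) = tr g"
proof -
  have one: "lincomb tr 1 = 1"
    using lincomb_single[of tr 0 1] tr_t[of 0] by (simp add: t_zero delta_zero)
  have "norm (lincomb tr f) \<le> 1 * unorm f" for f
    by (simp add: schwarz_contractive lincomb_add lincomb_scale one tr_schwarz)
  then obtain L where L: "bounded_clinear L" "\<And>f. L (group_algebra_embed f) = lincomb tr f"
    using extend_bounded_clinear[of "lincomb tr" 1] lincomb_add lincomb_scale by (metis zero_le_one)
  interpret bounded_linear L using L(1) by (simp add: bounded_clinear_def)
  have "unital_positive_linear L"
    unfolding unital_positive_linear_def
  proof (intro conjI allI impI)
    show "L (c *\<^sub>C x) = c *\<^sub>C L x" for c x using L(1) by (simp add: bounded_clinear_def)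
    show "L 1 = 1" using L(2)[of 1] by (simp add: embed_one one)
    fix x :: "'g group_cstar" assume "cpos x"
    then obtain b where x: "x = star b * b" by (auto simp: cpos_def)
    obtain f where f: "(\<lambda>n. group_algebra_embed (f n)) \<longlonglongrightarrow> b" by (rule embed_dense)
    have "(\<lambda>n. L (group_algebra_embed (gstar (f n) * f n))) \<longlonglongrightarrow> L x"
      unfolding embed_mult embed_star x
      by (intro tendsto tendsto_mult bounded_linear.tendsto[OF bounded_linear_star] f)
    moreover have "cpos (L (group_algebra_embed (gstar (f n) * f n)))" for n
      using cpos_add[OF tr_schwarz[of "f n"] cpos_star_mult[of "lincomb tr (f n)"]] by (simp add: L(2))
    ultimately show "cpos (L x)" by (rule cpos_limit)
  qed (rule add)
  moreover have "L (cstar_delta g) = tr g" for g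
    by (simp add: L(2) lincomb_single flip: embed_single)
  ultimately show thesis by (rule that)
qed

lemma endo_exists:
  obtains A where "unital_star_hom A" "\<And>g. A (cstar_delta g) = cstar_delta (t g)"
proof -
  define e where "e g = cstar_delta (t g)" for g
  have one: "lincomb e 1 = 1"
    using lincomb_single[of e 0 1] by (simp add: e_def t_zero delta_zero)
  have mult: "lincomb e (f * h) = lincomb e f * lincomb e h" for f h
  proof (induction f rule: poly_mapping_single_induct)
    case (single g c)
    show ?case
      by (induction h rule: poly_mapping_single_induct)
        (simp_all add: lincomb_add lincomb_single mult_single distrib_left e_def t_add delta_add
          mult_scaleC_left mult_scaleC_right scaleC_scaleC mult.commute)
  qed (simp add: lincomb_add distrib_right)
  have star: "lincomb e (gstar f) = star (lincomb e f)" for f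
    by (induction f rule: poly_mapping_single_induct)
      (simp_all add: gstar_add gstar_single lincomb_add lincomb_single star_add star_scaleC e_def
        star_delta t_minus)
  have "norm (lincomb e f) \<le> 1 * unorm f" for f
    by (simp add: schwarz_contractive lincomb_add lincomb_scale one mult star)
  then obtain A where A: "bounded_clinear A" "\<And>f. A (group_algebra_embed f) = lincomb e f"
    using extend_bounded_clinear[of "lincomb e" 1] lincomb_add lincomb_scale by (metis zero_le_one)
  have A_delta: "A (cstar_delta g) = cstar_delta (t g)" for g
    by (simp add: A(2) lincomb_single e_def flip: embed_single)
  have 1: "A (cstar_delta g * y) = A (cstar_delta g) * A y" for g y
    by (rule delta_eqI[of "\<lambda>y. A (cstar_delta g * y)" "\<lambda>y. A (cstar_delta g) * A y"])
      (simp_all add: A_delta t_add delta_add A bounded_clinear_intros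
        bounded_clinear_compose[OF A(1) bounded_clinear_mult_right] flip: delta_add)
  have "unital_star_hom A"
    unfolding unital_star_hom_def
  proof (intro conjI allI)
    show "A (x * y) = A x * A y" for x y
      by (rule delta_eqI[of "\<lambda>x. A (x * y)" "\<lambda>x. A x * A y"])
        (simp_all add: A 1 bounded_clinear_intros bounded_clinear_compose[OF A(1) bounded_clinear_mult_left])
    have "star (A (star x)) = A x" for x
      by (rule delta_eqI) (simp_all add: bounded_clinear_star A star_delta A_delta t_minus)
    then show "A (star x) = star (A x)" for x by (metis star_star)
    show "A 1 = 1" using A(2)[of 1] by (simp add: embed_one one)
    show "A (x + y) = A x + A y" for x y
      using A(1) by (simp add: bounded_clinear_def linear_add bounded_linear.linear)
    show "A (c *\<^sub>C x) = c *\<^sub>C A x" for c x using A(1) by (simp add: bounded_clinear_def)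
  qed
  then show thesis using A_delta by (rule that)
qed

end



subsection \<open>The endomorphisms and transfer operators of an algebraic dynamical system\<close>

context algebraic_dynamical_system
begin

sublocale grp: group_mono "\<theta> p" for p
  by unfold_locales (simp_all add: \<theta>_add \<theta>_inj)

abbreviation "A \<equiv> ads_\<alpha> \<theta>"
abbreviation "L \<equiv> ads_L \<theta>"
abbreviation "V \<equiv> ads_premodule \<theta>"
abbreviation "M \<equiv> ads_module \<theta>"

lemma L_props: "unital_positive_linear (L p)" "L p (cstar_delta g) = grp.tr p g"
proof -
  have "\<exists>!f. unital_positive_linear f \<and>
     (\<forall>g. f (cstar_delta g) = (if g \<in> range (\<theta> p) then cstar_delta (inv (\<theta> p) g) else 0))"
  proof (rule ex_ex1I)
    obtain f where "unital_positive_linear f" "\<And>g. f (cstar_delta g) = grp.tr p g"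
      using grp.transfer_exists[of p] by blast
    then show "\<exists>f. unital_positive_linear f \<and>
      (\<forall>g. f (cstar_delta g) = (if g \<in> range (\<theta> p) then cstar_delta (inv (\<theta> p) g) else 0))"
      by (auto simp: grp.tr_def)
    fix f f' :: "'g group_cstar \<Rightarrow> 'g group_cstar"
    assume "unital_positive_linear f \<and>
      (\<forall>g. f (cstar_delta g) = (if g \<in> range (\<theta> p) then cstar_delta (inv (\<theta> p) g) else 0))"
      "unital_positive_linear f' \<and>
      (\<forall>g. f' (cstar_delta g) = (if g \<in> range (\<theta> p) then cstar_delta (inv (\<theta> p) g) else 0))"
    then have f: "unital_positive_linear f" "unital_positive_linear f'"
      "f (cstar_delta g) = f' (cstar_delta g)" for g by simp_all
    show "f = f'"
      by (rule ext, rule delta_eqI[OF f(1,2)[THEN unital_positive_linear_bounded] f(3)])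
  qed
  from theI'[OF this] show "unital_positive_linear (L p)" "L p (cstar_delta g) = grp.tr p g"
    unfolding ads_L_def by (auto simp: grp.tr_def)
qed

lemma L_bounded: "bounded_clinear (L p)"
  by (rule unital_positive_linear_bounded[OF L_props(1)])

text \<open>The transfer operator is a left inverse, which gives injectivity.\<close>

lemma A_props: "unital_star_hom (A p)" "A p (cstar_delta g) = cstar_delta (\<theta> p g)"
proof -
  have "\<exists>!f. unital_star_hom f \<and> inj f \<and> (\<forall>g. f (cstar_delta g) = cstar_delta (\<theta> p g))"
  proof (rule ex_ex1I)
    obtain f where f: "unital_star_hom f" "\<And>g. f (cstar_delta g) = cstar_delta (\<theta> p g)"
      using grp.endo_exists[of p] by blast
    have fb: "bounded_clinear f"
      by (rule unital_positive_linear_bounded[OF unital_star_hom_positive[OF f(1)]])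
    have "L p (f x) = x" for x
      by (rule delta_eqI[OF bounded_clinear_compose[OF L_bounded fb] bounded_clinear_ident])
        (simp add: f L_props grp.tr_t)
    then have "inj f" by (rule inj_on_inverseI)
    then show "\<exists>f. unital_star_hom f \<and> inj f \<and> (\<forall>g. f (cstar_delta g) = cstar_delta (\<theta> p g))"
      using f by blast
    fix f f' :: "'g group_cstar \<Rightarrow> 'g group_cstar"
    assume "unital_star_hom f \<and> inj f \<and> (\<forall>g. f (cstar_delta g) = cstar_delta (\<theta> p g))"
      "unital_star_hom f' \<and> inj f' \<and> (\<forall>g. f' (cstar_delta g) = cstar_delta (\<theta> p g))"
    then have f: "unital_star_hom f" "unital_star_hom f'"
      "f (cstar_delta g) = f' (cstar_delta g)" for g by simp_all
    show "f = f'"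
      by (rule ext, rule delta_eqI[OF f(1,2)[THEN unital_star_hom_positive,
            THEN unital_positive_linear_bounded] f(3)])
  qed
  from theI'[OF this] show "unital_star_hom (A p)" "A p (cstar_delta g) = cstar_delta (\<theta> p g)"
    unfolding ads_\<alpha>_def by auto
qed

lemma A_bounded: "bounded_clinear (A p)"
  by (intro unital_positive_linear_bounded unital_star_hom_positive A_props)

lemma A_simps: "A p (x + y) = A p x + A p y" "A p (c *\<^sub>C x) = c *\<^sub>C A p x"
    "A p (x * y) = A p x * A p y" "A p (star x) = star (A p x)" "A p 1 = 1"
  using A_props(1)[of p] by (auto simp: unital_star_hom_def)

lemma A_diff: "A p (x - y) = A p x - A p y"
  using A_simps(1)[of p "x - y" y] by simp

lemma L_simps: "L p (x + y) = L p x + L p y" "L p (c *\<^sub>C x) = c *\<^sub>C L p x" "cpos x \<Longrightarrow> cpos (L p x)"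
    "L p 1 = 1"
  using L_props(1)[of p] by (auto simp: unital_positive_linear_def)

lemma L_sum: "L p (sum f F) = (\<Sum>i\<in>F. L p (f i))"
  using L_simps(2)[of p 0 0] by (induction F rule: infinite_finite_induct) (simp_all add: L_simps)

lemma L_scaleR: "L p (r *\<^sub>R x) = r *\<^sub>R L p x"
  using L_simps(2)[of p "complex_of_real r" x] by (simp add: scaleC_of_real)

lemma L_diff: "L p (x - y) = L p x - L p y"
  using L_simps(1)[of p "x - y" y] by simp

lemma L_star: "L p (star x) = star (L p x)"
proof -
  have "star (L p (star x)) = L p x"
    by (rule delta_eqI[OF bounded_clinear_star[OF L_bounded] L_bounded])
      (simp add: star_delta L_props grp.tr_minus star_star)
  then show ?thesis by (metis star_star)
qed

text \<open>The transfer property. Both sides are bounded and linear in \<open>x\<close> and in \<open>b\<close>, which leaves group elements.\<close>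

lemma L_mult_A: "L p (x * A p b) = L p x * b"
proof (rule delta_eqI[OF bounded_clinear_compose[OF L_bounded
        bounded_clinear_mult_left[OF bounded_clinear_ident]] bounded_clinear_mult_left[OF L_bounded]])
  show "L p (cstar_delta g * A p b) = L p (cstar_delta g) * b" for g
  proof (rule delta_eqI[OF bounded_clinear_compose[OF L_bounded
          bounded_clinear_mult_right[OF A_bounded]] bounded_clinear_mult_right[OF bounded_clinear_ident]])
    show "L p (cstar_delta g * A p (cstar_delta h)) = L p (cstar_delta g) * cstar_delta h" for h
      unfolding A_props(2) delta_add[symmetric] L_props(2) by (rule grp.tr_add_right)
  qed
qed

lemma L_A_mult: "L p (A p b * x) = b * L p x"
proof -
  have "L p (A p b * x) = star (L p (star x * A p (star b)))"
    by (simp add: A_simps star_mult star_star flip: L_star)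
  also have "\<dots> = b * L p x" by (simp add: L_mult_A L_star star_mult star_star)
  finally show ?thesis .
qed

lemma A_A: "A p (A q x) = A (p * q) x"
  by (rule delta_eqI[OF bounded_clinear_compose[OF A_bounded A_bounded] A_bounded])
    (simp add: A_props \<theta>_mult)

lemma L_L: "L q (L p x) = L (p * q) x"
proof (rule delta_eqI[OF bounded_clinear_compose[OF L_bounded L_bounded] L_bounded])
  fix g
  have L0: "L q 0 = 0" using L_simps(2)[of q 0 0] by simp
  show "L q (L p (cstar_delta g)) = L (p * q) (cstar_delta g)"
  proof (cases "g \<in> range (\<theta> p)")
    case True
    then obtain m where m: "g = \<theta> p m" by blast
    show ?thesis
    proof (cases "m \<in> range (\<theta> q)")
      case True
      then obtain n where n: "m = \<theta> q n" by blast
      then have "g = \<theta> (p * q) n" by (simp add: m \<theta>_mult)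
      then have "L (p * q) (cstar_delta g) = cstar_delta n" by (simp add: L_props grp.tr_t)
      moreover have "L q (L p (cstar_delta g)) = cstar_delta n" by (simp add: m n L_props grp.tr_t)
      ultimately show ?thesis by simp
    next
      case False
      then have "g \<notin> range (\<theta> (p * q))" using injD[OF \<theta>_inj] by (auto simp: m \<theta>_mult)
      then show ?thesis using False by (simp add: m L_props grp.tr_t) (simp add: grp.tr_def)
    qed
  next
    case False
    then have "g \<notin> range (\<theta> (p * q))" by (auto simp: \<theta>_mult)
    then show ?thesis using False by (simp add: L_props grp.tr_def L0)
  qed
qed

lemma A_one: "A 1 x = x"
  by (rule delta_eqI[OF A_bounded bounded_clinear_ident]) (simp add: A_props \<theta>_one)

lemma L_one: "L 1 x = x"
  using L_mult_A[of 1 1 x] by (simp add: A_one L_simps)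


section \<open>The bimodules of an algebraic dynamical system\<close>

lemma V_simps [simp]: "hcarr (V p) = UNIV" "hzero (V p) = 0" "hadd (V p) = (+)" "hscale (V p) = (*\<^sub>C)"
    "hract (V p) = (\<lambda>a b. a * A p b)" "hinn (V p) = (\<lambda>a b. L p (star a * b))" "hlact (V p) = (*)"
    "hdiff (V p) a b = a - b"
  by (simp_all add: ads_premodule_def hdiff_def scaleC_minus_one)

sublocale pre: completable_bimodule "V p" for p
proof
  show "star (hinn (V p) x y) = hinn (V p) y x" for x y
    by (simp add: star_mult star_star flip: L_star)
  show "hinn (V p) x (hract (V p) y a) = hinn (V p) x y * a" for x y a
    by (simp add: L_mult_A flip: mult.assoc)
qed (simp_all add: A_simps L_simps algebra_simps scaleC_add_right scaleC_add_left scaleC_scaleC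
    mult_scaleC_left mult_scaleC_right adjoint_pair_def star_mult star_star)

lemma pi_def: "ads_\<pi> \<theta> p x = hclass (V p) (\<lambda>n. x)"
  by (simp add: ads_\<pi>_def hembed_def)

text \<open>The reason why the product is isometric: \<open>L\<^sub>p\<close> is applied first, and the outer factors \<open>\<alpha>\<^sub>p(y\<^sup>*)\<close> and \<open>\<alpha>\<^sub>p(y')\<close>
  leave it by the transfer property.\<close>

lemma pre_mult_inn:
  "hinn (V (p * q)) (x * A p y) (x' * A p y') = hinn (V q) y (hinn (V p) x x' * y')"
proof -
  have "L (p * q) (star (x * A p y) * (x' * A p y')) = L q (L p (A p (star y) * (star x * x' * A p y')))"
    by (simp add: L_L A_simps star_mult mult.assoc)
  then show ?thesis by (simp add: L_A_mult L_mult_A)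
qed

lemma pre_mult_norm: "hnorm (V (p * q)) (x * A p y) \<le> hnorm (V p) x * hnorm (V q) y"
proof (rule power2_le_imp_le)
  have "(hnorm (V (p * q)) (x * A p y))\<^sup>2 = norm (hinn (V q) y (hinn (V p) x x * y))"
    unfolding hnorm_power2 pre_mult_inn ..
  also have "\<dots> \<le> hnorm (V q) y * hnorm (V q) (hinn (V p) x x * y)"
    by (rule pre.cauchy_schwarz_norm) simp_all
  also have "\<dots> \<le> hnorm (V q) y * (norm (hinn (V p) x x) * hnorm (V q) y)"
    using pre.hnorm_lact_le[of y q "hinn (V p) x x"] by (intro mult_left_mono) simp_all
  also have "\<dots> = (hnorm (V p) x * hnorm (V q) y)\<^sup>2"
    by (simp only: hnorm_power2[symmetric] power2_eq_square mult_ac)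
  finally show "(hnorm (V (p * q)) (x * A p y))\<^sup>2 \<le> (hnorm (V p) x * hnorm (V q) y)\<^sup>2" .
qed simp

lemma pre_mult_dist: "hdist (V (p * q)) (x * A p y) (x' * A p y') \<le>
    hnorm (V p) x * hdist (V q) y y' + hdist (V p) x x' * hnorm (V q) y'"
proof -
  have "x * A p y - x' * A p y' = x * A p (y - y') + (x - x') * A p y'"
    by (simp add: A_diff algebra_simps)
  then show ?thesis
    using pre.hnorm_add_le[of "x * A p (y - y')" "p * q" "(x - x') * A p y'"]
      pre_mult_norm[of p q x "y - y'"] pre_mult_norm[of p q "x - x'" y'] by simp
qed

subsection \<open>The product of two fibres\<close>

definition fibre_mult :: "'p \<Rightarrow> 'p \<Rightarrow> (nat \<Rightarrow> 'g group_cstar) set \<Rightarrow> (nat \<Rightarrow> 'g group_cstar) set \<Rightarrow>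
    (nat \<Rightarrow> 'g group_cstar) set" where
  "fibre_mult p q S T = hclass (V (p * q)) (\<lambda>n. hrep S n * A p (hrep T n))"

lemma fibre_mult_Cauchy:
  assumes s: "hCauchy (V p) s" and t: "hCauchy (V q) t"
  shows "hCauchy (V (p * q)) (\<lambda>n. s n * A p (t n))"
proof -
  obtain B where B: "B > 0" "\<And>n. hnorm (V p) (s n) \<le> B" using pre.hCauchy_hnorm_bounded[OF s] by blast
  obtain C where C: "C > 0" "\<And>n. hnorm (V q) (t n) \<le> C" using pre.hCauchy_hnorm_bounded[OF t] by blast
  show ?thesis
  proof (rule hCauchy_compare[OF s t])
    fix m n
    have "hnorm (V p) (s m) * hdist (V q) (t m) (t n) + hdist (V p) (s m) (s n) * hnorm (V q) (t n) \<le>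
        (B + C) * hdist (V q) (t m) (t n) + hdist (V p) (s m) (s n) * (B + C)"
      using B C by (intro add_mono mult_left_mono mult_right_mono)
        (auto intro: order_trans[OF B(2)] order_trans[OF C(2)])
    with pre_mult_dist[of p q "s m" "t m" "s n" "t n"]
    show "hdist (V (p * q)) (s m * A p (t m)) (s n * A p (t n)) \<le>
        (B + C) * (hdist (V p) (s m) (s n) + hdist (V q) (t m) (t n))"
      by (simp add: algebra_simps)
  qed simp
qed

lemma fibre_mult_hclass:
  assumes s: "hCauchy (V p) s" and t: "hCauchy (V q) t"
  shows "fibre_mult p q (hclass (V p) s) (hclass (V q) t) = hclass (V (p * q)) (\<lambda>n. s n * A p (t n))"
proof -
  note r = pre.hrep_hclass[OF s] and r' = pre.hrep_hclass[OF t]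
  obtain B where B: "B > 0" "\<And>n. hnorm (V p) (hrep (hclass (V p) s) n) \<le> B"
    using pre.hCauchy_hnorm_bounded[OF r(1)] by blast
  obtain C where C: "C > 0" "\<And>n. hnorm (V q) (t n) \<le> C" using pre.hCauchy_hnorm_bounded[OF t] by blast
  have "(\<lambda>n. hdist (V (p * q)) (hrep (hclass (V p) s) n * A p (hrep (hclass (V q) t) n)) (s n * A p (t n))) \<longlonglongrightarrow> 0"
  proof (rule null_compare[OF r(2) r'(2)])
    fix n
    let ?s = "hrep (hclass (V p) s)" and ?t = "hrep (hclass (V q) t)"
    have "hnorm (V p) (?s n) * hdist (V q) (?t n) (t n) + hdist (V p) (?s n) (s n) * hnorm (V q) (t n) \<le>
        (B + C) * hdist (V q) (?t n) (t n) + hdist (V p) (?s n) (s n) * (B + C)"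
      using B C by (intro add_mono mult_left_mono mult_right_mono)
        (auto intro: order_trans[OF B(2)] order_trans[OF C(2)])
    with pre_mult_dist[of p q "?s n" "?t n" "s n" "t n"]
    show "hdist (V (p * q)) (?s n * A p (?t n)) (s n * A p (t n)) \<le>
        (B + C) * (hdist (V p) (?s n) (s n) + hdist (V q) (?t n) (t n))"
      by (simp add: algebra_simps)
  qed simp
  then show ?thesis
    unfolding fibre_mult_def by (subst pre.hclass_eq_iff) (simp_all add: fibre_mult_Cauchy r r' s t)
qed

lemma M_cases:
  assumes "S \<in> hcarr (M p)"
  obtains s where "hCauchy (V p) s" "S = hclass (V p) s"
  using assms unfolding ads_module_def by (rule pre.comp_cases)

lemmas M_simps = pre.comp_simps[folded ads_module_def]

lemma fibre_mult_closed: "S \<in> hcarr (M p) \<Longrightarrow> T \<in> hcarr (M q) \<Longrightarrow> fibre_mult p q S T \<in> hcarr (M (p * q))"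
  by (elim M_cases) (simp add: fibre_mult_hclass M_simps fibre_mult_Cauchy)

lemma fibre_mult_add_left:
  assumes "S \<in> hcarr (M p)" "S' \<in> hcarr (M p)" "T \<in> hcarr (M q)"
  shows "fibre_mult p q (hadd (M p) S S') T = hadd (M (p * q)) (fibre_mult p q S T) (fibre_mult p q S' T)"
  using assms pre.hCauchy_hadd[of p]
  by (elim M_cases) (simp add: fibre_mult_hclass M_simps fibre_mult_Cauchy distrib_right)

lemma fibre_mult_add_right:
  assumes "S \<in> hcarr (M p)" "T \<in> hcarr (M q)" "T' \<in> hcarr (M q)"
  shows "fibre_mult p q S (hadd (M q) T T') = hadd (M (p * q)) (fibre_mult p q S T) (fibre_mult p q S T')"
  using assms pre.hCauchy_hadd[of q]
  by (elim M_cases) (simp add: fibre_mult_hclass M_simps fibre_mult_Cauchy distrib_left A_simps)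

lemma fibre_mult_scale:
  assumes "S \<in> hcarr (M p)" "T \<in> hcarr (M q)"
  shows "fibre_mult p q (hscale (M p) c S) T = hscale (M (p * q)) c (fibre_mult p q S T)"
    "fibre_mult p q S (hscale (M q) c T) = hscale (M (p * q)) c (fibre_mult p q S T)"
  using assms pre.hCauchy_hscale[of p] pre.hCauchy_hscale[of q]
  by (elim M_cases; simp add: fibre_mult_hclass M_simps fibre_mult_Cauchy A_simps mult_scaleC_left mult_scaleC_right)+

lemma fibre_mult_lact:
  assumes "S \<in> hcarr (M p)" "T \<in> hcarr (M q)"
  shows "fibre_mult p q (hlact (M p) a S) T = hlact (M (p * q)) a (fibre_mult p q S T)"
  using assms pre.hCauchy_lact[of p]
  by (elim M_cases) (simp add: fibre_mult_hclass M_simps fibre_mult_Cauchy mult.assoc)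

lemma fibre_mult_ract:
  assumes "S \<in> hcarr (M p)" "T \<in> hcarr (M q)"
  shows "fibre_mult p q S (hract (M q) T a) = hract (M (p * q)) (fibre_mult p q S T) a"
  using assms pre.hCauchy_hract[of q]
  by (elim M_cases) (simp add: fibre_mult_hclass M_simps fibre_mult_Cauchy A_simps A_A mult.assoc)

lemma fibre_mult_norm:
  assumes "S \<in> hcarr (M p)" "T \<in> hcarr (M q)"
  shows "hnorm (M (p * q)) (fibre_mult p q S T) \<le> hnorm (M p) S * hnorm (M q) T"
proof -
  obtain s t where s: "hCauchy (V p) s" "S = hclass (V p) s" and t: "hCauchy (V q) t" "T = hclass (V q) t"
    using assms by (auto elim!: M_cases)
  show ?thesis
    unfolding s(2) t(2) fibre_mult_hclass[OF s(1) t(1)] ads_module_def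
    by (rule LIMSEQ_le[OF pre.comp_hnorm[OF fibre_mult_Cauchy[OF s(1) t(1)]]
          tendsto_mult[OF pre.comp_hnorm[OF s(1)] pre.comp_hnorm[OF t(1)]]])
      (use pre_mult_norm in blast)
qed

text \<open>The limit of \<open>pre_mult_inn\<close>. The coefficient \<open>\<langle>s\<^sub>n, s\<^sub>n'\<rangle>\<close> varies with \<open>n\<close>; it is first replaced by its limit.\<close>

lemma fibre_mult_inn:
  assumes "S \<in> hcarr (M p)" "S' \<in> hcarr (M p)" "T \<in> hcarr (M q)" "T' \<in> hcarr (M q)"
  shows "hinn (M (p * q)) (fibre_mult p q S T) (fibre_mult p q S' T') =
    hinn (M q) T (hlact (M q) (hinn (M p) S S') T')"
proof -
  obtain s s' t t' where s: "hCauchy (V p) s" "S = hclass (V p) s"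
    and s': "hCauchy (V p) s'" "S' = hclass (V p) s'" and t: "hCauchy (V q) t" "T = hclass (V q) t"
    and t': "hCauchy (V q) t'" "T' = hclass (V q) t'"
    using assms by (auto elim!: M_cases)
  define a where "a = hinn (M p) S S'"
  define an where "an n = hinn (V p) (s n) (s' n)" for n
  have a: "an \<longlonglongrightarrow> a"
    unfolding an_def[abs_def] a_def using pre.comp_inn[OF s(1) s'(1)] by (simp only: s s' ads_module_def)
  obtain B where B: "B > 0" "\<And>n. hnorm (V q) (t n) \<le> B" using pre.hCauchy_hnorm_bounded[OF t(1)] by blast
  obtain C where C: "C > 0" "\<And>n. hnorm (V q) (t' n) \<le> C" using pre.hCauchy_hnorm_bounded[OF t'(1)] by blast
  have "(\<lambda>n. hinn (V q) (t n) (an n * t' n) - hinn (V q) (t n) (a * t' n)) \<longlonglongrightarrow> 0"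
  proof (rule Lim_null_comparison[OF always_eventually])
    show "\<forall>n. norm (hinn (V q) (t n) (an n * t' n) - hinn (V q) (t n) (a * t' n)) \<le>
        B * (norm (an n - a) * C)"
    proof
      fix n
      have "hinn (V q) (t n) (an n * t' n) - hinn (V q) (t n) (a * t' n) = hinn (V q) (t n) ((an n - a) * t' n)"
        by (simp add: algebra_simps flip: L_diff)
      also have "norm \<dots> \<le> hnorm (V q) (t n) * hnorm (V q) ((an n - a) * t' n)"
        by (rule pre.cauchy_schwarz_norm) simp_all
      also have "\<dots> \<le> B * (norm (an n - a) * C)"
        using B C pre.hnorm_lact_le[of "t' n" q "an n - a"]
        by (intro mult_mono order_trans[OF _ mult_left_mono[OF C(2) norm_ge_zero]]) simp_all
      finally show "norm (hinn (V q) (t n) (an n * t' n) - hinn (V q) (t n) (a * t' n)) \<le>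
        B * (norm (an n - a) * C)" .
    qed
    have "(\<lambda>n. B * (norm (an n - a) * C)) \<longlonglongrightarrow> B * (norm (a - a) * C)"
      by (intro tendsto_intros a)
    then show "(\<lambda>n. B * (norm (an n - a) * C)) \<longlonglongrightarrow> 0" by simp
  qed
  moreover have "(\<lambda>n. hinn (V q) (t n) (hlact (V q) a (t' n))) \<longlonglongrightarrow> hinn (M q) T (hlact (M q) a T')"
    using pre.comp_inn[OF t(1) pre.hCauchy_lact[OF t'(1)], of a]
    by (simp add: t t' ads_module_def pre.comp_lact)
  ultimately have "(\<lambda>n. hinn (V q) (t n) (an n * t' n)) \<longlonglongrightarrow> hinn (M q) T (hlact (M q) a T')"
    using tendsto_add by fastforce
  then have "(\<lambda>n. hinn (V (p * q)) (s n * A p (t n)) (s' n * A p (t' n))) \<longlonglongrightarrow> hinn (M q) T (hlact (M q) a T')"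
    unfolding pre_mult_inn an_def .
  then show ?thesis
    unfolding a_def[symmetric] unfolding s(2) t(2) s'(2) t'(2)
    by (simp add: fibre_mult_hclass s t s' t' ads_module_def pre.comp_inn_eqI fibre_mult_Cauchy)
qed

lemma fibre_mult_pi: "fibre_mult p q (ads_\<pi> \<theta> p x) (ads_\<pi> \<theta> q y) = ads_\<pi> \<theta> (p * q) (x * A p y)"
  by (simp add: pi_def fibre_mult_hclass pre.hCauchy_const)

lemma fibre_mult_assoc:
  assumes "S \<in> hcarr (M p)" "T \<in> hcarr (M q)" "U \<in> hcarr (M r)"
  shows "fibre_mult (p * q) r (fibre_mult p q S T) U = fibre_mult p (q * r) S (fibre_mult q r T U)"
  using assms by (elim M_cases) (simp add: fibre_mult_hclass fibre_mult_Cauchy A_simps A_A mult.assoc)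

lemma fibre_mult_pi_left: "S \<in> hcarr (M p) \<Longrightarrow> fibre_mult 1 p (ads_\<pi> \<theta> 1 a) S = hlact (M p) a S"
  using fibre_mult_hclass[of 1 "\<lambda>n. a" p]
  by (elim M_cases) (simp add: pi_def M_simps pre.hCauchy_const A_one)

lemma fibre_mult_pi_right: "S \<in> hcarr (M p) \<Longrightarrow> fibre_mult p 1 S (ads_\<pi> \<theta> 1 a) = hract (M p) S a"
  using fibre_mult_hclass[of p _ 1 "\<lambda>n. a"]
  by (elim M_cases) (simp add: pi_def M_simps pre.hCauchy_const)

lemma M_hilbert: "hilbert_bimodule (M p)"
  unfolding ads_module_def by (rule pre.comp_hilbert_bimodule)

end



section \<open>The product as an isomorphism of the interior tensor product\<close>

lemma poly_mapping_carrier_induct [consumes 1, case_names zero add]: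
  fixes u :: "'k \<Rightarrow>\<^sub>0 complex"
  assumes "Poly_Mapping.keys u \<subseteq> K" and zero: "P 0"
    and add: "\<And>k c u. k \<in> K \<Longrightarrow> Poly_Mapping.keys u \<subseteq> K \<Longrightarrow> P u \<Longrightarrow> P (Poly_Mapping.single k c + u)"
  shows "P u"
  using assms(1)
proof (induction u rule: update_induct)
  case const
  show ?case by (rule zero)
next
  case (update u k c)
  have keys: "Poly_Mapping.keys (Poly_Mapping.update k c u) = insert k (Poly_Mapping.keys u)"
    using update(2) by (auto simp: in_keys_iff lookup_update split: if_splits)
  have "Poly_Mapping.update k c u = Poly_Mapping.single k c + u"
    using update(1)
    by (intro poly_mapping_eqI)
      (auto simp: lookup_update lookup_add lookup_single in_keys_iff when_def)
  then show ?case using add[of k u c] update(3,4) keys by simp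
qed

lemma keys_add_subset: "Poly_Mapping.keys u \<subseteq> K \<Longrightarrow> Poly_Mapping.keys v \<subseteq> K \<Longrightarrow> Poly_Mapping.keys (u + v) \<subseteq> K"
  using Poly_Mapping.keys_add[of u v] by blast

lemma poly_mapping_eq_sum_single:
  "(\<Sum>k\<in>Poly_Mapping.keys u. Poly_Mapping.single k (Poly_Mapping.lookup u k)) = u"
  by (rule poly_mapping_eqI)
    (simp add: lookup_sum lookup_single when_def in_keys_iff)

context algebraic_dynamical_system
begin

lemma M_pre_hilbert: "pre_hilbert_bimodule (M p)"
  unfolding ads_module_def by (rule pre.comp_pre_hilbert_bimodule)

sublocale Mod: pre_hilbert_bimodule "M p" for p
  by (rule M_pre_hilbert)

abbreviation free_tensor :: "'p \<Rightarrow> 'p \<Rightarrow> ('g group_cstar,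
    ((nat \<Rightarrow> 'g group_cstar) set \<times> (nat \<Rightarrow> 'g group_cstar) set) \<Rightarrow>\<^sub>0 complex) hbimod" where
  "free_tensor p q \<equiv> pre_tensor (M p) (M q)"

text \<open>The linear extension of the product to the free vector space, with the linear combinations formed
  in the algebra, term by term in representing sequences.\<close>

definition tensor_seq :: "'p \<Rightarrow> nat \<Rightarrow>
    ((nat \<Rightarrow> 'g group_cstar) set \<times> (nat \<Rightarrow> 'g group_cstar) set) \<Rightarrow> 'g group_cstar" where
  "tensor_seq p n k = hrep (fst k) n * A p (hrep (snd k) n)"

definition tensor_map where
  "tensor_map p q u = hclass (V (p * q)) (\<lambda>n. lincomb (tensor_seq p n) u)"

lemma free_tensor_carr: "hcarr (free_tensor p q) = {u. Poly_Mapping.keys u \<subseteq> hcarr (M p) \<times> hcarr (M q)}"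
  by (simp add: pre_tensor_def)

lemma tensor_seq_Cauchy:
  assumes "k \<in> hcarr (M p) \<times> hcarr (M q)"
  shows "hCauchy (V (p * q)) (\<lambda>n. tensor_seq p n k)"
    and "fibre_mult p q (fst k) (snd k) = hclass (V (p * q)) (\<lambda>n. tensor_seq p n k)"
proof -
  have "hCauchy (V p) (hrep (fst k))" "hCauchy (V q) (hrep (snd k))"
    using assms by (auto elim!: M_cases simp: pre.hrep_hclass)
  then show "hCauchy (V (p * q)) (\<lambda>n. tensor_seq p n k)"
    unfolding tensor_seq_def by (rule fibre_mult_Cauchy)
qed (simp add: fibre_mult_def tensor_seq_def)

lemma tensor_map_Cauchy:
  assumes "u \<in> hcarr (free_tensor p q)"
  shows "hCauchy (V (p * q)) (\<lambda>n. lincomb (tensor_seq p n) u)"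
proof -
  have "Poly_Mapping.keys u \<subseteq> hcarr (M p) \<times> hcarr (M q)" using assms by (simp add: free_tensor_carr)
  then show ?thesis
  proof (induction rule: poly_mapping_carrier_induct)
    case zero
    then show ?case by (simp add: pre.hCauchy_const)
  next
    case (add k c u)
    then show ?case
      using pre.hCauchy_hadd[OF pre.hCauchy_hscale[OF tensor_seq_Cauchy(1), of k p q c]]
      by (simp add: lincomb_add lincomb_single)
  qed
qed

lemma tensor_map_closed: "u \<in> hcarr (free_tensor p q) \<Longrightarrow> tensor_map p q u \<in> hcarr (M (p * q))"
  by (simp add: tensor_map_def M_simps tensor_map_Cauchy)

lemma tensor_map_add:
  assumes "u \<in> hcarr (free_tensor p q)" "v \<in> hcarr (free_tensor p q)"
  shows "tensor_map p q (u + v) = hadd (M (p * q)) (tensor_map p q u) (tensor_map p q v)"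
  using assms by (simp add: tensor_map_def M_simps tensor_map_Cauchy lincomb_add)

lemma tensor_map_scale:
  assumes "u \<in> hcarr (free_tensor p q)"
  shows "tensor_map p q (Poly_Mapping.map ((*) c) u) = hscale (M (p * q)) c (tensor_map p q u)"
  using assms by (simp add: tensor_map_def M_simps tensor_map_Cauchy lincomb_scale)

lemma tensor_map_single:
  assumes "k \<in> hcarr (M p) \<times> hcarr (M q)"
  shows "tensor_map p q (Poly_Mapping.single k c) = hscale (M (p * q)) c (fibre_mult p q (fst k) (snd k))"
  using tensor_seq_Cauchy[OF assms] by (simp add: tensor_map_def M_simps lincomb_single)

lemma single_V2: "k \<in> hcarr (M p) \<times> hcarr (M q) \<Longrightarrow> Poly_Mapping.single k c \<in> hcarr (free_tensor p q)"
  by (simp add: free_tensor_carr)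

lemma free_tensor_add: "u \<in> hcarr (free_tensor p q) \<Longrightarrow> v \<in> hcarr (free_tensor p q) \<Longrightarrow> u + v \<in> hcarr (free_tensor p q)"
  by (simp add: free_tensor_carr keys_add_subset)

lemma tensor_map_zero: "tensor_map p q 0 = hzero (M (p * q))"
  by (simp add: tensor_map_def M_simps)

text \<open>An operator on the free vector space that acts on the generators covers a linear operator on the
  module as soon as it does so for elementary tensors.\<close>

lemma tensor_map_generators:
  assumes F: "finite F" "F \<subseteq> hcarr (M p) \<times> hcarr (M q)"
    and h: "\<And>k. k \<in> hcarr (M p) \<times> hcarr (M q) \<Longrightarrow> h k \<in> hcarr (M p) \<times> hcarr (M q)"
    and G: "G (hzero (M (p * q))) = hzero (M (p * q))"
      "\<And>x y. x \<in> hcarr (M (p * q)) \<Longrightarrow> y \<in> hcarr (M (p * q)) \<Longrightarrow> G (hadd (M (p * q)) x y) = hadd (M (p * q)) (G x) (G y)"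
      "\<And>x c. x \<in> hcarr (M (p * q)) \<Longrightarrow> G (hscale (M (p * q)) c x) = hscale (M (p * q)) c (G x)"
    and hG: "\<And>k. k \<in> hcarr (M p) \<times> hcarr (M q) \<Longrightarrow>
      fibre_mult p q (fst (h k)) (snd (h k)) = G (fibre_mult p q (fst k) (snd k))"
  shows "(\<Sum>k\<in>F. Poly_Mapping.single (h k) (c k)) \<in> hcarr (free_tensor p q) \<and>
    (\<Sum>k\<in>F. Poly_Mapping.single k (c k)) \<in> hcarr (free_tensor p q) \<and>
    tensor_map p q (\<Sum>k\<in>F. Poly_Mapping.single (h k) (c k)) = G (tensor_map p q (\<Sum>k\<in>F. Poly_Mapping.single k (c k)))"
  using F
proof (induction F rule: finite_induct)
  case empty
  then show ?case by (simp add: tensor_map_zero G free_tensor_carr)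
next
  case (insert k F)
  then have k: "k \<in> hcarr (M p) \<times> hcarr (M q)" by simp
  have kp: "fibre_mult p q (fst k) (snd k) \<in> hcarr (M (p * q))" using k by (auto intro: fibre_mult_closed)
  then have ks: "hscale (M (p * q)) (c k) (fibre_mult p q (fst k) (snd k)) \<in> hcarr (M (p * q))"
    by (rule Mod.scale_closed)
  have IH: "(\<Sum>k\<in>F. Poly_Mapping.single (h k) (c k)) \<in> hcarr (free_tensor p q)"
    "(\<Sum>k\<in>F. Poly_Mapping.single k (c k)) \<in> hcarr (free_tensor p q)"
    "tensor_map p q (\<Sum>k\<in>F. Poly_Mapping.single (h k) (c k)) = G (tensor_map p q (\<Sum>k\<in>F. Poly_Mapping.single k (c k)))"
    using insert by auto
  show ?case
    using insert(1,2) IH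
    by (simp add: free_tensor_add single_V2 k h tensor_map_add tensor_map_single hG G kp ks tensor_map_closed)
qed

lemma free_tensor_simps: "hadd (free_tensor p q) = (+)" "hscale (free_tensor p q) = (\<lambda>c. Poly_Mapping.map ((*) c))"
  by (simp_all add: pre_tensor_def)

lemma M_lact_zero: "hlact (M p) a (hzero (M p)) = hzero (M p)"
  by (simp add: M_simps pre.hCauchy_const)

lemma M_ract_zero: "hract (M p) (hzero (M p)) a = hzero (M p)"
  by (simp add: M_simps pre.hCauchy_const)

lemma tensor_map_ract:
  assumes u: "u \<in> hcarr (free_tensor p q)"
  shows "hract (free_tensor p q) u a \<in> hcarr (free_tensor p q)" "tensor_map p q (hract (free_tensor p q) u a) = hract (M (p * q)) (tensor_map p q u) a"
proof -
  have "(\<Sum>k\<in>Poly_Mapping.keys u. Poly_Mapping.single (fst k, hract (M q) (snd k) a) (Poly_Mapping.lookup u k)) \<in> hcarr (free_tensor p q) \<and>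
      (\<Sum>k\<in>Poly_Mapping.keys u. Poly_Mapping.single k (Poly_Mapping.lookup u k)) \<in> hcarr (free_tensor p q) \<and>
      tensor_map p q (\<Sum>k\<in>Poly_Mapping.keys u. Poly_Mapping.single (fst k, hract (M q) (snd k) a) (Poly_Mapping.lookup u k)) =
      (\<lambda>x. hract (M (p * q)) x a) (tensor_map p q (\<Sum>k\<in>Poly_Mapping.keys u. Poly_Mapping.single k (Poly_Mapping.lookup u k)))"
    by (rule tensor_map_generators[where h = "\<lambda>k. (fst k, hract (M q) (snd k) a)" and G = "\<lambda>x. hract (M (p * q)) x a"])
      (use u in \<open>auto simp: free_tensor_carr M_ract_zero Mod.ract_closed Mod.ract_add_left Mod.ract_scale_left fibre_mult_ract\<close>)
  then show "hract (free_tensor p q) u a \<in> hcarr (free_tensor p q)" "tensor_map p q (hract (free_tensor p q) u a) = hract (M (p * q)) (tensor_map p q u) a"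
    unfolding poly_mapping_eq_sum_single by (simp_all add: pre_tensor_def)
qed

lemma tensor_map_lact:
  assumes u: "u \<in> hcarr (free_tensor p q)"
  shows "hlact (free_tensor p q) a u \<in> hcarr (free_tensor p q)" "tensor_map p q (hlact (free_tensor p q) a u) = hlact (M (p * q)) a (tensor_map p q u)"
proof -
  have "(\<Sum>k\<in>Poly_Mapping.keys u. Poly_Mapping.single (hlact (M p) a (fst k), snd k) (Poly_Mapping.lookup u k)) \<in> hcarr (free_tensor p q) \<and>
      (\<Sum>k\<in>Poly_Mapping.keys u. Poly_Mapping.single k (Poly_Mapping.lookup u k)) \<in> hcarr (free_tensor p q) \<and>
      tensor_map p q (\<Sum>k\<in>Poly_Mapping.keys u. Poly_Mapping.single (hlact (M p) a (fst k), snd k) (Poly_Mapping.lookup u k)) =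
      (hlact (M (p * q)) a) (tensor_map p q (\<Sum>k\<in>Poly_Mapping.keys u. Poly_Mapping.single k (Poly_Mapping.lookup u k)))"
    by (rule tensor_map_generators[where h = "\<lambda>k. (hlact (M p) a (fst k), snd k)" and G = "hlact (M (p * q)) a"])
      (use u in \<open>auto simp: free_tensor_carr M_lact_zero Mod.lact_closed Mod.lact_add_right Mod.lact_scale_right fibre_mult_lact\<close>)
  then show "hlact (free_tensor p q) a u \<in> hcarr (free_tensor p q)" "tensor_map p q (hlact (free_tensor p q) a u) = hlact (M (p * q)) a (tensor_map p q u)"
    unfolding poly_mapping_eq_sum_single by (simp_all add: pre_tensor_def)
qed

lemma tensor_map_inn:
  assumes u: "u \<in> hcarr (free_tensor p q)" and v: "v \<in> hcarr (free_tensor p q)"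
  shows "hinn (M (p * q)) (tensor_map p q u) (tensor_map p q v) = hinn (free_tensor p q) u v"
proof -
  let ?K = "hcarr (M p) \<times> hcarr (M q)"
  have uK: "Poly_Mapping.keys u \<subseteq> ?K" and vK: "Poly_Mapping.keys v \<subseteq> ?K"
    using u v by (simp_all add: free_tensor_carr)
  have "hinn (V (p * q)) (lincomb (tensor_seq p n) u) (lincomb (tensor_seq p n) v) =
      (\<Sum>k\<in>Poly_Mapping.keys u. \<Sum>l\<in>Poly_Mapping.keys v.
        (cnj (Poly_Mapping.lookup u k) * Poly_Mapping.lookup v l) *\<^sub>C
          hinn (V (p * q)) (tensor_seq p n k) (tensor_seq p n l))" for n
    by (simp add: lincomb_def star_sum star_scaleC sum_product mult_scaleC_left mult_scaleC_right
        scaleC_scaleC L_sum L_simps mult.commute)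
  moreover have "(\<lambda>n. hinn (V (p * q)) (tensor_seq p n k) (tensor_seq p n l)) \<longlonglongrightarrow>
      hinn (M q) (snd k) (hlact (M q) (hinn (M p) (fst k) (fst l)) (snd l))"
    if "k \<in> ?K" "l \<in> ?K" for k l
  proof -
    have "(\<lambda>n. hinn (V (p * q)) (tensor_seq p n k) (tensor_seq p n l)) \<longlonglongrightarrow>
        hinn (M (p * q)) (fibre_mult p q (fst k) (snd k)) (fibre_mult p q (fst l) (snd l))"
      unfolding tensor_seq_Cauchy(2)[OF that(1)] tensor_seq_Cauchy(2)[OF that(2)] ads_module_def
      by (intro pre.comp_inn tensor_seq_Cauchy that)
    moreover have "hinn (M (p * q)) (fibre_mult p q (fst k) (snd k)) (fibre_mult p q (fst l) (snd l)) =
        hinn (M q) (snd k) (hlact (M q) (hinn (M p) (fst k) (fst l)) (snd l))"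
      using that by (intro fibre_mult_inn) auto
    ultimately show ?thesis by simp
  qed
  then have "(\<lambda>n. \<Sum>k\<in>Poly_Mapping.keys u. \<Sum>l\<in>Poly_Mapping.keys v.
        (cnj (Poly_Mapping.lookup u k) * Poly_Mapping.lookup v l) *\<^sub>C
          hinn (V (p * q)) (tensor_seq p n k) (tensor_seq p n l)) \<longlonglongrightarrow> hinn (free_tensor p q) u v"
    using uK vK by (simp only: pre_tensor_def hmod.select_convs)
      (intro tendsto_sum bounded_linear.tendsto[OF bounded_linear_scaleC], blast)
  ultimately have "(\<lambda>n. hinn (V (p * q)) (lincomb (tensor_seq p n) u) (lincomb (tensor_seq p n) v)) \<longlonglongrightarrow> hinn (free_tensor p q) u v"
    by (simp only:)
  then show ?thesis
    unfolding tensor_map_def ads_module_def by (intro pre.comp_inn_eqI tensor_map_Cauchy u v)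
qed

lemma pi_closed: "ads_\<pi> \<theta> p x \<in> hcarr (M p)"
  by (simp add: pi_def M_simps)

lemma M_dense:
  assumes "S \<in> hcarr (M p)" "e > 0"
  shows "\<exists>x. hdist (M p) S (ads_\<pi> \<theta> p x) < e"
  using pre.comp_dense[of S p e] assms unfolding ads_module_def ads_\<pi>_def by blast

text \<open>The range is dense since \<open>\<pi>\<^sub>p(x) \<pi>\<^sub>q(1) = \<pi>\<^sub>p\<^sub>q(x)\<close>.\<close>

lemma tensor_isometric: "isometric_image (M (p * q)) (free_tensor p q) (tensor_map p q)"
proof (intro isometric_image.intro isometric_image_axioms.intro states_hilbert_module.intro M_pre_hilbert
    tensor_map_inn tensor_map_closed)
  show "states_pre_hilbert_module (M (p * q))" by (rule Mod.states_pre_hilbert_module_axioms)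
  show "hilbert_module (M (p * q))" unfolding ads_module_def by (rule pre.comp_hilbert_module)
  fix u v c a assume u: "u \<in> hcarr (free_tensor p q)"
  show "hscale (free_tensor p q) c u \<in> hcarr (free_tensor p q)"
    using u keys_map_times[of c u] by (auto simp: free_tensor_simps free_tensor_carr)
  show "tensor_map p q (hscale (free_tensor p q) c u) = hscale (M (p * q)) c (tensor_map p q u)"
    using u by (simp add: free_tensor_simps tensor_map_scale)
  show "hract (free_tensor p q) u a \<in> hcarr (free_tensor p q)" "tensor_map p q (hract (free_tensor p q) u a) = hract (M (p * q)) (tensor_map p q u) a"
    "hlact (free_tensor p q) a u \<in> hcarr (free_tensor p q)" "tensor_map p q (hlact (free_tensor p q) a u) = hlact (M (p * q)) a (tensor_map p q u)"
    by (rule tensor_map_ract tensor_map_lact; fact u)+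
  assume v: "v \<in> hcarr (free_tensor p q)"
  show "hadd (free_tensor p q) u v \<in> hcarr (free_tensor p q)" "tensor_map p q (hadd (free_tensor p q) u v) = hadd (M (p * q)) (tensor_map p q u) (tensor_map p q v)"
    using u v by (simp_all add: free_tensor_simps free_tensor_add tensor_map_add)
next
  fix w and e :: real assume w: "w \<in> hcarr (M (p * q))" and e: "e > 0"
  obtain x where x: "hdist (M (p * q)) w (ads_\<pi> \<theta> (p * q) x) < e" using M_dense[OF w e] by blast
  define u where "u = Poly_Mapping.single (ads_\<pi> \<theta> p x, ads_\<pi> \<theta> q 1) (1::complex)"
  have "tensor_map p q u = ads_\<pi> \<theta> (p * q) x"
    by (simp add: u_def tensor_map_single pi_closed fibre_mult_pi A_simps Mod.scale_one)
  then show "\<exists>u\<in>hcarr (free_tensor p q). hdist (M (p * q)) (tensor_map p q u) w < e"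
    using x w by (intro bexI[of _ u]) (simp_all add: Mod.hdist_commute pi_closed, simp add: u_def single_V2 pi_closed)
qed

lemma fibre_mult_tensor_iso:
  "\<exists>T. bimod_iso (tensor (M p) (M q)) (M (p * q)) T \<and>
    (\<forall>x\<in>hcarr (M p). \<forall>y\<in>hcarr (M q). fibre_mult p q x y = T (elem_tensor (M p) (M q) x y))"
proof -
  interpret I: isometric_image "M (p * q)" "free_tensor p q" "tensor_map p q" by (rule tensor_isometric)
  have "fibre_mult p q x y = I.ext_map (elem_tensor (M p) (M q) x y)" if "x \<in> hcarr (M p)" "y \<in> hcarr (M q)" for x y
    unfolding elem_tensor_def using that
    by (simp add: I.ext_map_hembed single_V2 tensor_map_single Mod.scale_one fibre_mult_closed)
  then show ?thesis unfolding tensor_def using I.ext_map_iso by blast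
qed


section \<open>The fibre over the identity\<close>

text \<open>As \<open>\<alpha>\<^sub>1\<close> and \<open>L\<^sub>1\<close> are identities, the length of a vector is its norm in the algebra, which is complete
  already.\<close>

lemma unit_fibre: "bimod_iso std_bimod (M 1) (ads_\<pi> \<theta> 1)"
proof -
  have n: "hnorm (V 1) x = norm x" for x
    by (simp add: hnorm_def L_one cstar_identity)
  have c: "hCauchy (V 1) (\<lambda>n. x)" for x by (rule pre.hCauchy_const) simp
  show ?thesis
    unfolding bimod_iso_def
  proof (intro conjI ballI allI)
    show "bij_betw (ads_\<pi> \<theta> 1) (hcarr std_bimod) (hcarr (M 1))"
    proof (rule bij_betw_imageI[OF inj_onI])
      fix x y assume "ads_\<pi> \<theta> 1 x = ads_\<pi> \<theta> 1 y"
      then have "(\<lambda>k::nat. norm (x - y)) \<longlonglongrightarrow> 0"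
        using pre.hclass_eq_iff[OF c c, of x y] by (simp add: pi_def n)
      then show "x = y" by (simp add: LIMSEQ_const_iff)
    next
      have "S \<in> range (ads_\<pi> \<theta> 1)" if S: "S \<in> hcarr (M 1)" for S
      proof -
        obtain s where s: "hCauchy (V 1) s" "S = hclass (V 1) s" using S by (rule M_cases)
        have "Cauchy s"
          by (rule Cauchy_compare[OF s(1) s(1), where K = "1/2"]) (simp add: n)
        then obtain l where l: "s \<longlonglongrightarrow> l" using Cauchy_convergent convergent_def by blast
        have "(\<lambda>k. norm (s k - l)) \<longlonglongrightarrow> 0" using tendsto_norm_zero[OF LIM_zero[OF l]] .
        then have "S = ads_\<pi> \<theta> 1 l"
          by (simp add: pi_def s pre.hclass_eq_iff c n)
        then show ?thesis by simp
      qed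
      then show "ads_\<pi> \<theta> 1 ` hcarr std_bimod = hcarr (M 1)"
        using pi_closed[of 1] by (auto simp: std_bimod_def)
    qed
    fix x y a c'
    show "hinn (M 1) (ads_\<pi> \<theta> 1 x) (ads_\<pi> \<theta> 1 y) = hinn std_bimod x y"
      unfolding pi_def ads_module_def by (rule pre.comp_inn_eqI[OF c c]) (simp add: L_one std_bimod_def)
    show "ads_\<pi> \<theta> 1 (hadd std_bimod x y) = hadd (M 1) (ads_\<pi> \<theta> 1 x) (ads_\<pi> \<theta> 1 y)"
      "ads_\<pi> \<theta> 1 (hscale std_bimod c' x) = hscale (M 1) c' (ads_\<pi> \<theta> 1 x)"
      "ads_\<pi> \<theta> 1 (hract std_bimod x a) = hract (M 1) (ads_\<pi> \<theta> 1 x) a"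
      "ads_\<pi> \<theta> 1 (hlact std_bimod a x) = hlact (M 1) a (ads_\<pi> \<theta> 1 x)"
      using c by (simp_all add: pi_def M_simps std_bimod_def A_one)
  qed
qed


section \<open>Uniqueness of the multiplication\<close>

lemma pi_linear:
  "ads_\<pi> \<theta> p (x + y) = hadd (M p) (ads_\<pi> \<theta> p x) (ads_\<pi> \<theta> p y)"
  "ads_\<pi> \<theta> p (c *\<^sub>C x) = hscale (M p) c (ads_\<pi> \<theta> p x)"
  by (simp_all add: pi_def M_simps)

lemma pi_hdist: "hdist (M p) (ads_\<pi> \<theta> p x) (ads_\<pi> \<theta> p y) \<le> norm (x - y)"
proof -
  have c: "hCauchy (V p) (\<lambda>n. z)" for z by (rule pre.hCauchy_const) simp
  have "hdist (M p) (ads_\<pi> \<theta> p x) (ads_\<pi> \<theta> p y) = hnorm (V p) (x - y)"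
    using pre.comp_hdist[OF c[of x] c[of y]] by (simp add: pi_def ads_module_def LIMSEQ_const_iff)
  also have "\<dots> \<le> norm (x - y)"
  proof (rule power2_le_imp_le)
    define z where "z = x - y"
    have "cpos (L p ((norm z)\<^sup>2 *\<^sub>R 1 - star z * z))" by (intro L_simps cpos_norm_sq_minus)
    then have "norm (L p (star z * z)) \<le> norm ((norm z)\<^sup>2 *\<^sub>R (1 :: 'g group_cstar))"
      by (intro cpos_norm_mono L_simps cpos_star_mult) (simp add: L_diff L_scaleR L_simps)
    then show "(hnorm (V p) (x - y))\<^sup>2 \<le> (norm (x - y))\<^sup>2" by (simp add: hnorm_power2 z_def)
  qed simp
  finally show ?thesis .
qed

lemma group_algebra_dense:
  assumes S: "S \<in> hcarr (M p)"
  obtains f where "(\<lambda>n. hdist (M p) S (ads_\<pi> \<theta> p (group_algebra_embed (f n)))) \<longlonglongrightarrow> 0"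
proof -
  have "\<exists>f. hdist (M p) S (ads_\<pi> \<theta> p (group_algebra_embed f)) < inverse (real (Suc n))" for n
  proof -
    have e: "inverse (real (Suc n)) / 2 > 0" by simp
    obtain x where x: "hdist (M p) S (ads_\<pi> \<theta> p x) < inverse (real (Suc n)) / 2"
      using M_dense[OF S e] by blast
    obtain s where "(\<lambda>k. group_algebra_embed (s k)) \<longlonglongrightarrow> x" by (rule embed_dense)
    from LIMSEQ_D[OF this e] obtain k where k: "norm (group_algebra_embed (s k) - x) < inverse (real (Suc n)) / 2"
      by blast
    have "hdist (M p) S (ads_\<pi> \<theta> p (group_algebra_embed (s k))) \<le>
        hdist (M p) S (ads_\<pi> \<theta> p x) + norm (x - group_algebra_embed (s k))"
      by (intro order_trans[OF Mod.hdist_triangle[of S p "ads_\<pi> \<theta> p x"]] add_left_mono pi_hdist S pi_closed)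
    also have "\<dots> < inverse (real (Suc n)) / 2 + inverse (real (Suc n)) / 2"
      using x k by (intro add_strict_mono) (simp_all only: norm_minus_commute)
    finally have "hdist (M p) S (ads_\<pi> \<theta> p (group_algebra_embed (s k))) < inverse (real (Suc n))"
      by (simp only: field_sum_of_halves)
    then show ?thesis by blast
  qed
  then obtain f where f: "\<And>n. hdist (M p) S (ads_\<pi> \<theta> p (group_algebra_embed (f n))) < inverse (real (Suc n))"
    by metis
  have "(\<lambda>n. hdist (M p) S (ads_\<pi> \<theta> p (group_algebra_embed (f n)))) \<longlonglongrightarrow> 0"
    by (rule tendsto_sandwich[OF _ _ tendsto_const LIMSEQ_inverse_real_of_nat])
      (auto intro!: always_eventually less_imp_le[OF f] simp del: of_nat_Suc)
  then show thesis by (rule that)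
qed

definition bounded_bilinear_on ::
    "'p \<Rightarrow> 'p \<Rightarrow> ((nat \<Rightarrow> 'g group_cstar) set \<Rightarrow> (nat \<Rightarrow> 'g group_cstar) set \<Rightarrow> (nat \<Rightarrow> 'g group_cstar) set) \<Rightarrow> real \<Rightarrow> bool"
  where
  "bounded_bilinear_on p q b C \<longleftrightarrow> (\<forall>x\<in>hcarr (M p). \<forall>y\<in>hcarr (M q).
     b x y \<in> hcarr (M (p * q)) \<and> hnorm (M (p * q)) (b x y) \<le> C * hnorm (M p) x * hnorm (M q) y \<and>
     (\<forall>x'\<in>hcarr (M p). b (hadd (M p) x x') y = hadd (M (p * q)) (b x y) (b x' y)) \<and>
     (\<forall>y'\<in>hcarr (M q). b x (hadd (M q) y y') = hadd (M (p * q)) (b x y) (b x y')) \<and>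
     (\<forall>c. b (hscale (M p) c x) y = hscale (M (p * q)) c (b x y) \<and>
          b x (hscale (M q) c y) = hscale (M (p * q)) c (b x y)))"

lemma bounded_bilinear_dist:
  assumes b: "bounded_bilinear_on p q b C"
    and x: "x \<in> hcarr (M p)" "x' \<in> hcarr (M p)" and y: "y \<in> hcarr (M q)" "y' \<in> hcarr (M q)"
  shows "hdist (M (p * q)) (b x y) (b x' y') \<le>
    \<bar>C\<bar> * (hnorm (M p) x * hdist (M q) y y' + hdist (M p) x x' * (hnorm (M q) y + hdist (M q) y y'))"
proof -
  have bc: "b x y \<in> hcarr (M (p * q))" if "x \<in> hcarr (M p)" "y \<in> hcarr (M q)" for x y
    using b that unfolding bounded_bilinear_on_def by blast
  have n: "hnorm (M (p * q)) (b x y) \<le> \<bar>C\<bar> * (hnorm (M p) x * hnorm (M q) y)"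
    if "x \<in> hcarr (M p)" "y \<in> hcarr (M q)" for x y
  proof -
    have "hnorm (M (p * q)) (b x y) \<le> C * (hnorm (M p) x * hnorm (M q) y)"
      using b that unfolding bounded_bilinear_on_def by (simp add: mult.assoc)
    also have "\<dots> \<le> \<bar>C\<bar> * (hnorm (M p) x * hnorm (M q) y)" by (intro mult_right_mono) simp_all
    finally show ?thesis .
  qed
  have "hdiff (M (p * q)) (b x y) (b x y') = b x (hdiff (M q) y y')"
    "hdiff (M (p * q)) (b x y') (b x' y') = b (hdiff (M p) x x') y'"
    using b x y unfolding bounded_bilinear_on_def hdiff_def by (simp_all add: Mod.scale_closed)
  then have 1: "hdist (M (p * q)) (b x y) (b x y') \<le> \<bar>C\<bar> * (hnorm (M p) x * hdist (M q) y y')"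
    and 2: "hdist (M (p * q)) (b x y') (b x' y') \<le> \<bar>C\<bar> * (hdist (M p) x x' * hnorm (M q) y')"
    using n x y by (simp_all add: Mod.diff_closed)
  have "hnorm (M q) y' \<le> hnorm (M q) y + hdist (M q) y y'"
    using Mod.hnorm_diff_le[OF y] by simp
  then have 3: "\<bar>C\<bar> * (hdist (M p) x x' * hnorm (M q) y') \<le>
      \<bar>C\<bar> * (hdist (M p) x x' * (hnorm (M q) y + hdist (M q) y y'))"
    by (intro mult_left_mono) simp_all
  have "hdist (M (p * q)) (b x y) (b x' y') \<le>
      hdist (M (p * q)) (b x y) (b x y') + hdist (M (p * q)) (b x y') (b x' y')"
    by (intro Mod.hdist_triangle bc x y)
  then show ?thesis using 1 2 3 by (simp add: distrib_left)
qed

text \<open>Linear combinations of group elements are dense in both factors, and bounded bilinear maps are jointly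
  continuous.\<close>

lemma bounded_bilinear_unique:
  assumes b: "bounded_bilinear_on p q b C" and b': "bounded_bilinear_on p q b' C'"
    and eq: "\<And>g h. b (ads_\<pi> \<theta> p (cstar_delta g)) (ads_\<pi> \<theta> q (cstar_delta h)) =
      b' (ads_\<pi> \<theta> p (cstar_delta g)) (ads_\<pi> \<theta> q (cstar_delta h))"
    and x: "x \<in> hcarr (M p)" and y: "y \<in> hcarr (M q)"
  shows "b x y = b' x y"
proof -
  have single: "group_algebra_embed (Poly_Mapping.single g c) = c *\<^sub>C cstar_delta g"
    for g :: 'g and c
    by (simp add: embed_eq_lincomb lincomb_single)
  have eq_alg: "b (ads_\<pi> \<theta> p (group_algebra_embed f)) (ads_\<pi> \<theta> q (group_algebra_embed h)) =
      b' (ads_\<pi> \<theta> p (group_algebra_embed f)) (ads_\<pi> \<theta> q (group_algebra_embed h))" for f h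
  proof (induction f rule: poly_mapping_single_induct)
    case (single g c)
    show ?case
    proof (induction h rule: poly_mapping_single_induct)
      case (single k d)
      show ?case
        using b b' eq[of g k] unfolding bounded_bilinear_on_def
        by (simp add: \<open>\<And>g c. group_algebra_embed (Poly_Mapping.single g c) = c *\<^sub>C cstar_delta g\<close>
            pi_linear pi_closed Mod.scale_closed)
    next
      case (sum h1 h2)
      then show ?case
        using b b' unfolding bounded_bilinear_on_def by (simp add: embed_add pi_linear pi_closed)
    qed
  next
    case (sum f1 f2)
    then show ?case
      using b b' unfolding bounded_bilinear_on_def by (simp add: embed_add pi_linear pi_closed)
  qed
  obtain f where f: "(\<lambda>n. hdist (M p) x (ads_\<pi> \<theta> p (group_algebra_embed (f n)))) \<longlonglongrightarrow> 0"
    using group_algebra_dense[OF x] by blast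
  obtain h where h: "(\<lambda>n. hdist (M q) y (ads_\<pi> \<theta> q (group_algebra_embed (h n)))) \<longlonglongrightarrow> 0"
    using group_algebra_dense[OF y] by blast
  define u where "u n = ads_\<pi> \<theta> p (group_algebra_embed (f n))" for n
  define v where "v n = ads_\<pi> \<theta> q (group_algebra_embed (h n))" for n
  have uv: "u n \<in> hcarr (M p)" "v n \<in> hcarr (M q)" for n by (simp_all add: u_def v_def pi_closed)
  have lim: "(\<lambda>n. hdist (M (p * q)) (b x y) (b (u n) (v n))) \<longlonglongrightarrow> 0" if b: "bounded_bilinear_on p q b C" for b C
  proof (rule tendsto_sandwich[OF _ _ tendsto_const])
    have "(\<lambda>n. \<bar>C\<bar> * (hnorm (M p) x * hdist (M q) y (v n) + hdist (M p) x (u n) * (hnorm (M q) y + hdist (M q) y (v n))))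
        \<longlonglongrightarrow> \<bar>C\<bar> * (hnorm (M p) x * 0 + 0 * (hnorm (M q) y + 0))"
      by (intro tendsto_intros) (use f h in \<open>simp_all only: u_def v_def\<close>)
    then show "(\<lambda>n. \<bar>C\<bar> * (hnorm (M p) x * hdist (M q) y (v n) + hdist (M p) x (u n) * (hnorm (M q) y + hdist (M q) y (v n))))
        \<longlonglongrightarrow> 0" by simp
    show "\<forall>\<^sub>F n in sequentially. hdist (M (p * q)) (b x y) (b (u n) (v n)) \<le>
        \<bar>C\<bar> * (hnorm (M p) x * hdist (M q) y (v n) + hdist (M p) x (u n) * (hnorm (M q) y + hdist (M q) y (v n)))"
      by (intro always_eventually allI bounded_bilinear_dist[OF b] x y uv)
  qed simp
  have cl: "b x y \<in> hcarr (M (p * q))" "b' x y \<in> hcarr (M (p * q))" "b (u n) (v n) \<in> hcarr (M (p * q))"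
    "b' (u n) (v n) \<in> hcarr (M (p * q))" for n
    using b b' x y uv unfolding bounded_bilinear_on_def by blast+
  have e: "b' (u n) (v n) = b (u n) (v n)" for n by (simp add: u_def v_def eq_alg)
  have "(\<lambda>n. hdist (M (p * q)) (b (u n) (v n)) (b' x y)) \<longlonglongrightarrow> 0"
    using lim[OF b'] unfolding e by (simp add: Mod.hdist_commute cl)
  then have "(\<lambda>n::nat. hdist (M (p * q)) (b x y) (b' x y)) \<longlonglongrightarrow> 0"
    by (rule null_compare[OF lim[OF b], where K = 1]) (simp_all add: Mod.hdist_triangle cl)
  then have 0: "hdist (M (p * q)) (b x y) (b' x y) = 0" by (simp add: LIMSEQ_const_iff)
  have "hilbert_module (M (p * q))" unfolding ads_module_def by (rule pre.comp_hilbert_module)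
  from hilbert_module.eq_if_hdist_zero[OF this cl(1,2) 0] show ?thesis .
qed

lemma fibre_mult_bounded_bilinear: "bounded_bilinear_on p q (fibre_mult p q) 1"
  unfolding bounded_bilinear_on_def
  by (simp add: fibre_mult_closed fibre_mult_norm fibre_mult_add_left fibre_mult_add_right fibre_mult_scale)

definition system_mult :: "'p \<times> (nat \<Rightarrow> 'g group_cstar) set \<Rightarrow> 'p \<times> (nat \<Rightarrow> 'g group_cstar) set \<Rightarrow>
    'p \<times> (nat \<Rightarrow> 'g group_cstar) set" where
  "system_mult u v = (fst u * fst v, fibre_mult (fst u) (fst v) (snd u) (snd v))"

lemma system_mult_bilinear: "bounded_fibrewise_bilinear M system_mult"
  unfolding bounded_fibrewise_bilinear_def
proof (intro allI exI ballI)
  fix p q x y assume "x \<in> hcarr (M p)" "y \<in> hcarr (M q)"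
  then show "system_mult (p, x) (q, y) = (p * q, fibre_mult p q x y) \<and> fibre_mult p q x y \<in> hcarr (M (p * q)) \<and>
        hnorm (M (p * q)) (fibre_mult p q x y) \<le> 1 * hnorm (M p) x * hnorm (M q) y \<and>
        (\<forall>x'\<in>hcarr (M p). fibre_mult p q (hadd (M p) x x') y = hadd (M (p * q)) (fibre_mult p q x y) (fibre_mult p q x' y)) \<and>
        (\<forall>y'\<in>hcarr (M q). fibre_mult p q x (hadd (M q) y y') = hadd (M (p * q)) (fibre_mult p q x y) (fibre_mult p q x y')) \<and>
        (\<forall>c. fibre_mult p q (hscale (M p) c x) y = hscale (M (p * q)) c (fibre_mult p q x y) \<and>
             fibre_mult p q x (hscale (M q) c y) = hscale (M (p * q)) c (fibre_mult p q x y))"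
    by (simp add: system_mult_def fibre_mult_closed fibre_mult_norm fibre_mult_add_left fibre_mult_add_right fibre_mult_scale)
qed

lemma system_mult_delta: "system_mult (p, ads_\<pi> \<theta> p (cstar_delta g)) (q, ads_\<pi> \<theta> q (cstar_delta h)) =
    (p * q, ads_\<pi> \<theta> (p * q) (cstar_delta (g + \<theta> p h)))"
  by (simp add: system_mult_def fibre_mult_pi A_props delta_add)

lemma system_mult_unique:
  assumes m: "bounded_fibrewise_bilinear M m"
    and delta: "\<And>p q g h. m (p, ads_\<pi> \<theta> p (cstar_delta g)) (q, ads_\<pi> \<theta> q (cstar_delta h)) =
      (p * q, ads_\<pi> \<theta> (p * q) (cstar_delta (g + \<theta> p h)))"
    and u: "u \<in> fibre_union M" and v: "v \<in> fibre_union M"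
  shows "m u v = system_mult u v"
proof -
  obtain p x where px: "u = (p, x)" "x \<in> hcarr (M p)" using u by (auto simp: fibre_union_def)
  obtain q y where qy: "v = (q, y)" "y \<in> hcarr (M q)" using v by (auto simp: fibre_union_def)
  obtain b C where bC: "\<forall>x\<in>hcarr (M p). \<forall>y\<in>hcarr (M q).
        m (p, x) (q, y) = (p * q, b x y) \<and> b x y \<in> hcarr (M (p * q)) \<and>
        hnorm (M (p * q)) (b x y) \<le> C * hnorm (M p) x * hnorm (M q) y \<and>
        (\<forall>x'\<in>hcarr (M p). b (hadd (M p) x x') y = hadd (M (p * q)) (b x y) (b x' y)) \<and>
        (\<forall>y'\<in>hcarr (M q). b x (hadd (M q) y y') = hadd (M (p * q)) (b x y) (b x y')) \<and>
        (\<forall>c. b (hscale (M p) c x) y = hscale (M (p * q)) c (b x y) \<and>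
             b x (hscale (M q) c y) = hscale (M (p * q)) c (b x y))"
    using m[unfolded bounded_fibrewise_bilinear_def, THEN spec, THEN spec, of p q]
    by (elim exE) (rule that)
  then have mb: "m (p, x) (q, y) = (p * q, b x y)" if "x \<in> hcarr (M p)" "y \<in> hcarr (M q)" for x y
    using that by simp
  have b: "bounded_bilinear_on p q b C"
    unfolding bounded_bilinear_on_def
  proof (intro ballI)
    fix x y assume "x \<in> hcarr (M p)" "y \<in> hcarr (M q)"
    from bC[THEN bspec, OF this(1), THEN bspec, OF this(2), THEN conjunct2]
    show "b x y \<in> hcarr (M (p * q)) \<and> hnorm (M (p * q)) (b x y) \<le> C * hnorm (M p) x * hnorm (M q) y \<and>
     (\<forall>x'\<in>hcarr (M p). b (hadd (M p) x x') y = hadd (M (p * q)) (b x y) (b x' y)) \<and>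
     (\<forall>y'\<in>hcarr (M q). b x (hadd (M q) y y') = hadd (M (p * q)) (b x y) (b x y')) \<and>
     (\<forall>c. b (hscale (M p) c x) y = hscale (M (p * q)) c (b x y) \<and>
          b x (hscale (M q) c y) = hscale (M (p * q)) c (b x y))" .
  qed
  have "b x y = fibre_mult p q x y"
  proof (rule bounded_bilinear_unique[OF b fibre_mult_bounded_bilinear _ px(2) qy(2)])
    fix g h
    show "b (ads_\<pi> \<theta> p (cstar_delta g)) (ads_\<pi> \<theta> q (cstar_delta h)) =
        fibre_mult p q (ads_\<pi> \<theta> p (cstar_delta g)) (ads_\<pi> \<theta> q (cstar_delta h))"
      using mb[OF pi_closed pi_closed, of "cstar_delta g" "cstar_delta h"] delta[of p g q h]
      by (simp add: fibre_mult_pi A_props delta_add)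
  qed
  then show ?thesis using mb px qy by (simp add: system_mult_def)
qed

lemma system_mult_product_system: "product_system M (ads_\<pi> \<theta> 1) system_mult"
  unfolding product_system_def
proof (intro conjI allI impI ballI)
  show "q = r" if "p * q = p * r" for p q r :: 'p using that by (rule left_cancel)
  show "hilbert_bimodule (M p)" for p by (rule M_hilbert)
  show "system_mult u v \<in> fibre_union M" if "u \<in> fibre_union M" "v \<in> fibre_union M" for u v
    using that by (auto simp: fibre_union_def system_mult_def fibre_mult_closed)
  show "system_mult (system_mult u v) w = system_mult u (system_mult v w)"
    if "u \<in> fibre_union M" "v \<in> fibre_union M" "w \<in> fibre_union M" for u v w
    using that by (auto simp: fibre_union_def system_mult_def fibre_mult_assoc mult.assoc)
  show "\<exists>T. bimod_iso (tensor (M p) (M q)) (M (p * q)) T \<and>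
      (\<forall>x\<in>hcarr (M p). \<forall>y\<in>hcarr (M q). system_mult (p, x) (q, y) = (p * q, T (elem_tensor (M p) (M q) x y)))"
    for p q
    using fibre_mult_tensor_iso[of p q] by (simp add: system_mult_def)
  show "bimod_iso std_bimod (M 1) (ads_\<pi> \<theta> 1)" by (rule unit_fibre)
  show "system_mult (1, ads_\<pi> \<theta> 1 a) (p, x) = (p, hlact (M p) a x)" if "x \<in> hcarr (M p)" for p a x
    using that by (simp add: system_mult_def fibre_mult_pi_left)
  show "system_mult (p, x) (1, ads_\<pi> \<theta> 1 a) = (p, hract (M p) x a)" if "x \<in> hcarr (M p)" for p a x
    using that by (simp add: system_mult_def fibre_mult_pi_right)
qed

end

theorem proposition7p4:
  fixes \<theta> :: "'p::{monoid_mult, countable} \<Rightarrow> 'g::{group_add, countable} \<Rightarrow> 'g"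
  assumes "algebraic_dynamical_system \<theta>"
  shows "\<exists>m.
    bounded_fibrewise_bilinear (ads_module \<theta>) m \<and>
    (\<forall>p q g h. m (p, ads_\<pi> \<theta> p (cstar_delta g)) (q, ads_\<pi> \<theta> q (cstar_delta h)) =
       (p * q, ads_\<pi> \<theta> (p * q) (cstar_delta (g + \<theta> p h)))) \<and>
    (\<forall>m'. bounded_fibrewise_bilinear (ads_module \<theta>) m' \<and>
       (\<forall>p q g h. m' (p, ads_\<pi> \<theta> p (cstar_delta g)) (q, ads_\<pi> \<theta> q (cstar_delta h)) =
          (p * q, ads_\<pi> \<theta> (p * q) (cstar_delta (g + \<theta> p h)))) \<longrightarrow>
       (\<forall>u\<in>fibre_union (ads_module \<theta>). \<forall>v\<in>fibre_union (ads_module \<theta>). m' u v = m u v)) \<and>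
    product_system (ads_module \<theta>) (ads_\<pi> \<theta> 1) m"
proof -
  interpret algebraic_dynamical_system \<theta> by (rule assms)
  show ?thesis
  proof (intro exI[of _ system_mult] conjI allI impI ballI)
    show "bounded_fibrewise_bilinear M system_mult" by (rule system_mult_bilinear)
    show "product_system M (ads_\<pi> \<theta> 1) system_mult" by (rule system_mult_product_system)
  qed (auto intro!: system_mult_delta system_mult_unique)
qed

end
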